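(* Let $\Omega\subset\mathbb{R}^n$ be a bounded domain with smooth boundary, $\Gamma\subset\partial\Omega$ a subboundary, $x_0\in\Gamma$, $T>0$, $\delta_0>0$, $M>0$, let $\mathcal{H}$ be the admissible set of vector fields defined in the context, and fix $H\in\mathcal{H}$ arbitrarily. Set $$\mathcal{P}=\{p\in L^\infty(\Omega):\ \|p\|_{L^\infty(\Omega)}\le M\}.$$ Let $a\in C^1(\overline\Omega)$ satisfy $|a(x)|\ne0$ for all $x\in\overline\Omega$. Then there exists a subdomain $D\subset\Omega$ with $x_0\in\partial D\cap\partial\Omega\subset\Gamma$, depending on $T,\Gamma,\mathcal{H}$, such that for every constant $M_0>0$ there exist constants $C>0$ and $\theta\in(0,1)$, depending on $T,\Gamma,\mathcal{H}$ and $M_0$ (with $a$ fixed), such that $$\|p_1-p_2\|_{L^2(D)}\le C\left(\|\partial_tu(p_1,a)-\partial_tu(p_2,a)\|_{L^2(\Gamma\times(0,T))}^{\theta}+\|\partial_tu(p_1,a)-\partial_tu(p_2,a)\|_{L^2(\Gamma\times(0,T))}\right)$$ for all $p_1,p_2\in\mathcal{P}$ and all choices of solutions $u(p_1,a),u(p_2,a)$ satisfying $\partial_tu(p_j,a)\in C^1(\overline\Omega\times[0,T])$ and $$\|\partial_tu(p_j,a)\|_{L^2(0,T;L^\infty(D))}\le M_0,\qquad j=1,2.$$ The subdomain $D$ is independent of the choice of $p_1,p_2$.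
   Context: A subboundary means a nonempty relatively open subset of $\partial\Omega$. $(x\cdot y)$ is the Euclidean scalar product, $|x|$ the Euclidean norm, $\nabla$ is the gradient in $x$, and $\nu(x)$ is the outward unit normal to $\partial\Omega$ at $x$. Admissible set: $$\mathcal{H}=\{H\in (C^1(\overline\Omega))^n:\ \|H\|_{(C^1(\overline\Omega))^n}\le M,\ (H(x_0)\cdot\nu(x_0))>\delta_0,\ |H(x)|>\delta_0\ \text{for } x\in\Omega\},$$ where for $H=(h_1,\dots,h_n)$ one may take $\|H\|_{(C^1(\overline\Omega))^n}=\max_{\overline\Omega}|H|+\max_{\overline\Omega}\big(\sum_{j,k}|\partial_kh_j|^2\big)^{1/2}$. With $H$ fixed, for $p\in\mathcal{P}$, $u(p,a)$ denotes one arbitrarily chosen solution $u\in C^1(\overline\Omega\times[0,T])$ of $$\partial_tu+(H(x)\cdot\nabla u)+p(x)u=0\ \text{ (a.e.) in }\Omega\times(0,T),\qquad u(x,0)=a(x),\ x\in\Omega.$$ No boundary condition is imposed, so there are in general many such solutions. *)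

theory Defs
  imports "HOL-Analysis.Analysis" "HOL-Probability.Essential_Supremum"
begin

unbundle inner_syntax

definition is_domain :: "'a::topological_space set \<Rightarrow> bool" where
  "is_domain S \<longleftrightarrow> open S \<and> connected S \<and> S \<noteq> {}"

definition subboundary :: "'a::topological_space set \<Rightarrow> 'a set \<Rightarrow> bool" where
  "subboundary \<Omega> \<Gamma> \<longleftrightarrow> \<Gamma> \<noteq> {} \<and> openin (top_of_set (frontier \<Omega>)) \<Gamma>"

definition gradient :: "('a::euclidean_space \<Rightarrow> real) \<Rightarrow> 'a \<Rightarrow> 'a" where
  "gradient f x = (\<Sum>b\<in>Basis. frechet_derivative f (at x) b *\<^sub>R b)"

text \<open>Continuous differentiability of order \<open>k\<close>, for open \<open>U\<close>.\<close>

primrec Ck_on :: "nat \<Rightarrow> 'a::euclidean_space set \<Rightarrow> ('a \<Rightarrow> 'b::real_normed_vector) \<Rightarrow> bool" where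
  "Ck_on 0 U f \<longleftrightarrow> continuous_on U f"
| "Ck_on (Suc k) U f \<longleftrightarrow> (\<forall>x\<in>U. f differentiable (at x)) \<and>
     (\<forall>b\<in>Basis. Ck_on k U (\<lambda>x. frechet_derivative f (at x) b))"

definition smooth_on :: "'a::euclidean_space set \<Rightarrow> ('a \<Rightarrow> 'b::real_normed_vector) \<Rightarrow> bool" where
  "smooth_on U f \<longleftrightarrow> (\<forall>k. Ck_on k U f)"

text \<open>A smooth defining function of \<open>\<Omega>\<close> near the boundary point \<open>x\<close>, negative inside \<open>\<Omega>\<close>,
  so that its normalized gradient is the outward unit normal.\<close>

definition defining_function ::
  "'a::euclidean_space set \<Rightarrow> 'a \<Rightarrow> 'a set \<Rightarrow> ('a \<Rightarrow> real) \<Rightarrow> bool" where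
  "defining_function \<Omega> x U \<rho> \<longleftrightarrow>
     open U \<and> x \<in> U \<and> smooth_on U \<rho> \<and> (\<forall>y\<in>U. gradient \<rho> y \<noteq> 0) \<and>
     \<Omega> \<inter> U = {y\<in>U. \<rho> y < 0} \<and> frontier \<Omega> \<inter> U = {y\<in>U. \<rho> y = 0}"

definition smooth_boundary :: "'a::euclidean_space set \<Rightarrow> bool" where
  "smooth_boundary \<Omega> \<longleftrightarrow> (\<forall>x\<in>frontier \<Omega>. \<exists>U \<rho>. defining_function \<Omega> x U \<rho>)"

text \<open>For \<open>x\<close> in a smooth boundary the vector below does not depend on \<open>\<rho>\<close>.\<close>

definition outward_normal :: "'a::euclidean_space set \<Rightarrow> 'a \<Rightarrow> 'a" where
  "outward_normal \<Omega> x =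
     (SOME v. \<exists>U \<rho>. defining_function \<Omega> x U \<rho> \<and> v = sgn (gradient \<rho> x))"

text \<open>The space \<open>C\<^sup>1\<close> on the closure of an open set \<open>S\<close>: the function and its first partial
  derivatives in \<open>S\<close> have continuous extensions to the closure.\<close>

definition C1_closure :: "'a::euclidean_space set \<Rightarrow> ('a \<Rightarrow> 'b::real_normed_vector) \<Rightarrow> bool" where
  "C1_closure S f \<longleftrightarrow>
     continuous_on (closure S) f \<and> (\<forall>x\<in>S. f differentiable (at x)) \<and>
     (\<forall>b\<in>Basis. \<exists>g. continuous_on (closure S) g \<and>
        (\<forall>x\<in>S. g x = frechet_derivative f (at x) b))"

text \<open>For \<open>H\<close> in \<open>C\<^sup>1\<close> of the closure, the supremum over \<open>\<Omega>\<close> in the second summand is the maximum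
  over the closure of the continuous extension of the Frobenius norm of the derivative.\<close>

definition C1_norm :: "(real^'n) set \<Rightarrow> (real^'n \<Rightarrow> real^'n) \<Rightarrow> real" where
  "C1_norm \<Omega> H = (SUP x\<in>closure \<Omega>. norm (H x)) +
     (SUP x\<in>\<Omega>. sqrt (\<Sum>j\<in>UNIV. \<Sum>k\<in>UNIV. (jacobian H (at x) $ j $ k)\<^sup>2))"

definition admissible_fields ::
  "(real^'n) set \<Rightarrow> real^'n \<Rightarrow> real \<Rightarrow> real \<Rightarrow> (real^'n \<Rightarrow> real^'n) set" where
  "admissible_fields \<Omega> x0 \<delta>0 M =
     {H. C1_closure \<Omega> H \<and> C1_norm \<Omega> H \<le> M \<and> H x0 \<bullet> outward_normal \<Omega> x0 > \<delta>0 \<and>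
         (\<forall>x\<in>\<Omega>. norm (H x) > \<delta>0)}"

text \<open>Lebesgue norms take values in \<open>[0,\<infinity>]\<close>; a function of infinite norm is not silently
  assigned the norm \<open>0\<close>. The exponent is meant to be positive.\<close>

definition ennreal_powr :: "ennreal \<Rightarrow> real \<Rightarrow> ennreal" where
  "ennreal_powr x r = (if x = \<infinity> then \<infinity> else ennreal (enn2real x powr r))"

definition L2_norm :: "'a measure \<Rightarrow> ('a \<Rightarrow> real) \<Rightarrow> ennreal" where
  "L2_norm \<mu> f = ennreal_powr (\<integral>\<^sup>+x. ennreal ((f x)\<^sup>2) \<partial>\<mu>) (1/2)"

definition Linf_norm :: "'a measure \<Rightarrow> ('a \<Rightarrow> real) \<Rightarrow> ennreal" where
  "Linf_norm \<mu> f = e2ennreal (esssup \<mu> (\<lambda>x. ereal \<bar>f x\<bar>))"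

definition L2_Linf_norm :: "real \<Rightarrow> (real^'n) set \<Rightarrow> ((real^'n) \<times> real \<Rightarrow> real) \<Rightarrow> ennreal" where
  "L2_Linf_norm T D w =
     ennreal_powr
       (\<integral>\<^sup>+t. (Linf_norm (lebesgue_on D) (\<lambda>x. w (x, t)))\<^sup>2 \<partial>lebesgue_on {0<..<T}) (1/2)"

text \<open>Hausdorff measure of integer dimension \<open>s\<close>, normalized by the volume of the unit ball, so
  that in dimension \<open>n - 1\<close> it is the surface measure on smooth hypersurfaces of \<open>\<real>\<^sup>n\<close>. The
  empty set has weight \<open>0\<close> also for \<open>s = 0\<close>, where the measure is the counting measure.\<close>

definition hausdorff_weight :: "nat \<Rightarrow> 'a::metric_space set \<Rightarrow> real" where
  "hausdorff_weight s U =
     (if U = {} then 0 else unit_ball_vol (real s) * (diameter U / 2) ^ s)"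

definition hausdorff_outer :: "nat \<Rightarrow> 'a::metric_space set \<Rightarrow> ennreal" where
  "hausdorff_outer s A =
     (SUP \<delta>\<in>{0<..}. INF U\<in>{U :: nat \<Rightarrow> 'a set. A \<subseteq> (\<Union>i. U i) \<and>
         (\<forall>i. bounded (U i) \<and> diameter (U i) \<le> \<delta>)}.
        \<Sum>i. ennreal (hausdorff_weight s (U i)))"

definition hausdorff_measure :: "nat \<Rightarrow> 'a::metric_space measure" where
  "hausdorff_measure s = measure_of UNIV (sets borel) (hausdorff_outer s)"

definition surface_measure :: "(real^'n) set \<Rightarrow> (real^'n) measure" where
  "surface_measure \<Gamma> = restrict_space (hausdorff_measure (CARD('n) - 1)) \<Gamma>"

definition lateral_L2_norm :: "(real^'n) set \<Rightarrow> real \<Rightarrow> ((real^'n) \<times> real \<Rightarrow> real) \<Rightarrow> ennreal" where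
  "lateral_L2_norm \<Gamma> T w = L2_norm (surface_measure \<Gamma> \<Otimes>\<^sub>M restrict_space lborel {0<..<T}) w"

definition bounded_coefficients :: "(real^'n) set \<Rightarrow> real \<Rightarrow> (real^'n \<Rightarrow> real) set" where
  "bounded_coefficients \<Omega> M =
     {p. p \<in> borel_measurable (lebesgue_on \<Omega>) \<and> Linf_norm (lebesgue_on \<Omega>) p \<le> ennreal M}"

text \<open>Taking the derivative within \<open>[0,T]\<close> makes it one-sided at the end points. For \<open>u\<close> in \<open>C\<^sup>1\<close>
  of the closed cylinder this is, on the whole closed cylinder, the continuous extension of the
  time derivative in the interior.\<close>

definition dt :: "real \<Rightarrow> ('a \<times> real \<Rightarrow> real) \<Rightarrow> 'a \<times> real \<Rightarrow> real" where
  "dt T u = (\<lambda>(x, t). vector_derivative (\<lambda>s. u (x, s)) (at t within {0..T}))"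

definition transport_solution ::
  "(real^'n) set \<Rightarrow> real \<Rightarrow> (real^'n \<Rightarrow> real^'n) \<Rightarrow> (real^'n \<Rightarrow> real) \<Rightarrow> (real^'n \<Rightarrow> real) \<Rightarrow>
   ((real^'n) \<times> real \<Rightarrow> real) \<Rightarrow> bool" where
  "transport_solution \<Omega> T H p a u \<longleftrightarrow>
     C1_closure (\<Omega> \<times> {0<..<T}) u \<and>
     (AE (x, t) in lebesgue_on (\<Omega> \<times> {0<..<T}).
        dt T u (x, t) + H x \<bullet> gradient (\<lambda>y. u (y, t)) x + p x * u (x, t) = 0) \<and>
     (\<forall>x\<in>\<Omega>. u (x, 0) = a x)"

end

theory Submission
  imports Defs
begin

text \<open>
  The coefficient can be read off the time derivative of the solution at the initial time: where
  \<open>u = a\<close>, the equation says \<open>p a = - (\<partial>\<^sub>t u + H \<bullet> \<nabla> a)\<close>. For two coefficients with the same initial value,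
  \<open>p1 - p2\<close> is therefore the difference of \<open>- \<partial>\<^sub>t u / a\<close> at time zero. The data give \<open>\<partial>\<^sub>t u\<close> on the subboundary
  only, but the equation transports information along the characteristics \<open>X' = H(X)\<close>, and near \<open>x0\<close>
  these leave the domain through \<open>\<Gamma>\<close> in a short time because \<open>H \<bullet> \<nu> > \<delta>0\<close> at \<open>x0\<close>.

  Along a characteristic both \<open>u\<close> and \<open>\<partial>\<^sub>t u\<close> are multiplied by the same exponential factor, as the
  coefficient does not depend on time (\<open>transport_along_curve\<close>). So the quotient \<open>\<partial>\<^sub>t u / u\<close> at the exit point \<open>P\<close> and the
  exit time \<open>\<tau>\<close> equals \<open>\<partial>\<^sub>t u / a\<close> at the starting point, at time zero. At \<open>(P, \<tau>)\<close> the modulus \<open>|u|\<close> is bounded below, and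
  the difference \<open>u1 - u2\<close> is there the integral over \<open>[0, \<tau>]\<close> of the difference of the time derivatives at
  \<open>P\<close>. This yields a pointwise bound of \<open>|p1 - p2|\<^sup>2\<close> by the squared difference of the time derivatives at
  \<open>(P, \<tau>)\<close> plus its time integral at \<open>P\<close> (\<open>coefficient_difference_le\<close>). The equation is assumed only almost everywhere,
  with a measurable coefficient; it first has to be seen that the coefficient agrees almost everywhere with a
  continuous function for which the equation holds at every point (\<open>transport_equation_everywhere\<close>).

  To integrate the bound over the cell \<open>D\<close>, the volume of \<open>D\<close> must be compared with surface measure
  times time under the map \<open>x \<mapsto> (P, \<tau>)\<close>. Two integral curves that reach the boundary at nearby points and times
  start at nearby points (\<open>exit_separation\<close>). Hence the points leaving through a set of diameter \<open>d\<close> during a time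
  interval \<open>I\<close> are covered by about \<open>|I| / d\<close> balls of radius proportional to \<open>d\<close>, with total volume of order
  \<open>|I| d\<^sup>n\<^sup>-\<^sup>1\<close>, and sums of \<open>d\<^sup>n\<^sup>-\<^sup>1\<close> over covers are what defines the Hausdorff measure (\<open>tube_le_outer\<close>). Riemann sums in time give the
  integral inequality (\<open>trace_integral_le\<close>).

  The cell has to serve all admissible fields at once. It is the part of the domain in a cone
  around the outward normal with tip slightly inside the domain (\<open>boundary_cone\<close>). The bounds defining the
  admissible set force every field into this cone near \<open>x0\<close>, so that a characteristic cannot leave through
  the sides of the cone (\<open>exit_point_frontier\<close>). The field is Lipschitz on the cell with a uniform constant and is extended to the
  whole space in order to have integral curves. The resulting estimate is linear in the lateral norm.
\<close>

section \<open>Hausdorff outer measure is a Borel measure\<close>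

text \<open>The infimum inside the definition of the Hausdorff outer measure, at one fixed mesh \<open>\<delta>\<close>.\<close>

definition hausdorff_content :: "nat \<Rightarrow> real \<Rightarrow> 'a::metric_space set \<Rightarrow> ennreal" where
  "hausdorff_content s \<delta> A =
     (INF U\<in>{U :: nat \<Rightarrow> 'a set. A \<subseteq> (\<Union>i. U i) \<and>
         (\<forall>i. bounded (U i) \<and> diameter (U i) \<le> \<delta>)}.
        \<Sum>i. ennreal (hausdorff_weight s (U i)))"

lemma hausdorff_outer_eq_SUP: "hausdorff_outer s A = (SUP \<delta>\<in>{0<..}. hausdorff_content s \<delta> A)"
  by (simp add: hausdorff_outer_def hausdorff_content_def)

lemma hausdorff_content_le:
  assumes "A \<subseteq> (\<Union>i. U i)" "\<And>i. bounded (U i)" "\<And>i. diameter (U i) \<le> \<delta>"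
  shows "hausdorff_content s \<delta> A \<le> (\<Sum>i. ennreal (hausdorff_weight s (U i)))"
  unfolding hausdorff_content_def by (rule INF_lower) (use assms in auto)

lemma hausdorff_content_cover:
  assumes "hausdorff_content s \<delta> A < c"
  obtains U where "A \<subseteq> (\<Union>i. U i)" "\<And>i. bounded (U i)" "\<And>i. diameter (U i) \<le> \<delta>"
    "(\<Sum>i. ennreal (hausdorff_weight s (U i))) < c"
  using assms unfolding hausdorff_content_def INF_less_iff by auto

lemma hausdorff_content_mono: "A \<subseteq> B \<Longrightarrow> hausdorff_content s \<delta> A \<le> hausdorff_content s \<delta> B"
  unfolding hausdorff_content_def by (rule INF_superset_mono) auto

lemma hausdorff_content_antimono:
  "\<delta> \<le> \<delta>' \<Longrightarrow> hausdorff_content s \<delta>' A \<le> hausdorff_content s \<delta> A"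
  unfolding hausdorff_content_def by (rule INF_superset_mono) (auto intro: order_trans)

lemma hausdorff_content_le_outer: "0 < \<delta> \<Longrightarrow> hausdorff_content s \<delta> A \<le> hausdorff_outer s A"
  unfolding hausdorff_outer_eq_SUP by (rule SUP_upper) auto

text \<open>Covers of the single sets that are optimal up to a geometric series of errors are merged into one cover.\<close>

lemma hausdorff_content_UN_le:
  "hausdorff_content s \<delta> (\<Union>i::nat. A i) \<le> (\<Sum>i. hausdorff_content s \<delta> (A i))"
proof (rule ennreal_le_epsilon)
  fix e :: real
  assume fin: "(\<Sum>i. hausdorff_content s \<delta> (A i)) < top" and e: "0 < e"
  have "\<exists>U. A i \<subseteq> (\<Union>j. U j) \<and> (\<forall>j. bounded (U j)) \<and> (\<forall>j. diameter (U j) \<le> \<delta>) \<and>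
      (\<Sum>j. ennreal (hausdorff_weight s (U j))) < hausdorff_content s \<delta> (A i) + ennreal (e * (1/2)^Suc i)"
    for i
  proof -
    have "hausdorff_content s \<delta> (A i) < top"
      using fin ennreal_suminf_lessD by blast
    then have "hausdorff_content s \<delta> (A i) < hausdorff_content s \<delta> (A i) + ennreal (e * (1/2)^Suc i)"
      using e by (metis add.right_neutral ennreal_add_left_cancel_less ennreal_less_zero_iff mult_pos_pos
          zero_less_divide_1_iff zero_less_numeral zero_less_power infinity_ennreal_def less_irrefl)
    then show ?thesis
      by (elim hausdorff_content_cover) blast
  qed
  then obtain U where U: "\<And>i. A i \<subseteq> (\<Union>j. U i j)" "\<And>i j. bounded (U i j)"
      "\<And>i j. diameter (U i j) \<le> \<delta>"
      "\<And>i. (\<Sum>j. ennreal (hausdorff_weight s (U i j))) < hausdorff_content s \<delta> (A i) + ennreal (e * (1/2)^Suc i)"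
    by metis
  define V where "V n = case_prod U (prod_decode n)" for n
  have "hausdorff_content s \<delta> (\<Union>i. A i) \<le> (\<Sum>n. ennreal (hausdorff_weight s (V n)))"
  proof (rule hausdorff_content_le)
    show "(\<Union>i. A i) \<subseteq> (\<Union>n. V n)"
    proof
      fix x assume "x \<in> (\<Union>i. A i)"
      then obtain i j where "x \<in> U i j" using U(1) by blast
      then have "x \<in> V (prod_encode (i,j))" by (simp add: V_def)
      then show "x \<in> (\<Union>n. V n)" by blast
    qed
  qed (auto simp: V_def U split: prod.split)
  also have "\<dots> = (\<Sum>i. \<Sum>j. ennreal (hausdorff_weight s (U i j)))"
    using suminf_ennreal_2dimen[of "\<lambda>i. \<Sum>j. ennreal (hausdorff_weight s (U i j))"
        "\<lambda>p. ennreal (hausdorff_weight s (case_prod U p))"]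
    by (simp add: V_def)
  also have "\<dots> \<le> (\<Sum>i. hausdorff_content s \<delta> (A i) + ennreal (e * (1/2)^Suc i))"
    using U(4) by (intro suminf_le) (auto intro: less_imp_le)
  also have "\<dots> = (\<Sum>i. hausdorff_content s \<delta> (A i)) + (\<Sum>i. ennreal (e * (1/2)^Suc i))"
    by (intro suminf_add[symmetric]) auto
  also have "(\<Sum>i. ennreal (e * (1/2)^Suc i)) = ennreal e"
  proof -
    have "(\<lambda>i. e * (1/2)^Suc i) sums (e * 1)"
      by (intro sums_mult power_half_series)
    then show ?thesis using e by (intro suminf_ennreal_eq) auto
  qed
  finally show "hausdorff_content s \<delta> (\<Union>i. A i) \<le> (\<Sum>i. hausdorff_content s \<delta> (A i)) + ennreal e" .
qed

lemma hausdorff_outer_mono: "A \<subseteq> B \<Longrightarrow> hausdorff_outer s A \<le> hausdorff_outer s B"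
  unfolding hausdorff_outer_eq_SUP by (intro SUP_mono') (rule hausdorff_content_mono)

lemma hausdorff_outer_empty: "hausdorff_outer s ({} :: 'a::metric_space set) = 0"
proof -
  have "hausdorff_content s \<delta> ({} :: 'a set) \<le> 0" if "\<delta> > 0" for \<delta>
    using hausdorff_content_le[of "{}" "\<lambda>_. {}" \<delta> s] that by (simp add: hausdorff_weight_def)
  then show ?thesis
    unfolding hausdorff_outer_eq_SUP by (auto intro!: antisym SUP_least)
qed

lemma hausdorff_outer_UN_le:
  "hausdorff_outer s (\<Union>i::nat. A i) \<le> (\<Sum>i. hausdorff_outer s (A i))"
  unfolding hausdorff_outer_eq_SUP[of s "\<Union>i. A i"]
proof (rule SUP_least)
  fix \<delta> :: real assume "\<delta> \<in> {0<..}"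
  then have "(\<Sum>i. hausdorff_content s \<delta> (A i)) \<le> (\<Sum>i. hausdorff_outer s (A i))"
    by (intro suminf_le) (auto intro: hausdorff_content_le_outer)
  then show "hausdorff_content s \<delta> (\<Union>i. A i) \<le> (\<Sum>i. hausdorff_outer s (A i))"
    using hausdorff_content_UN_le order_trans by blast
qed

text \<open>A covering set of diameter below the distance of \<open>A\<close> and \<open>B\<close> meets at most one of them, so a cover of the union splits into a cover of \<open>A\<close> and a cover of \<open>B\<close>.\<close>

lemma hausdorff_content_separated:
  assumes "\<gamma> > \<delta>" and sep: "\<And>x y. x \<in> A \<Longrightarrow> y \<in> B \<Longrightarrow> \<gamma> \<le> dist x y" and "\<delta> \<ge> 0"
  shows "hausdorff_content s \<delta> A + hausdorff_content s \<delta> B \<le> hausdorff_content s \<delta> (A \<union> B)"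
  unfolding hausdorff_content_def[of s \<delta> "A \<union> B"]
proof (rule INF_greatest)
  fix U :: "nat \<Rightarrow> 'a set"
  assume "U \<in> {U. A \<union> B \<subseteq> (\<Union>i. U i) \<and> (\<forall>i. bounded (U i) \<and> diameter (U i) \<le> \<delta>)}"
  then have U: "A \<union> B \<subseteq> (\<Union>i. U i)" "\<And>i. bounded (U i)" "\<And>i. diameter (U i) \<le> \<delta>"
    by auto
  define V where "V S i = (if U i \<inter> S = {} then {} else U i)" for S i
  have disj: "U i \<inter> A = {} \<or> U i \<inter> B = {}" for i
  proof (rule ccontr)
    assume "\<not> ?thesis"
    then obtain x y where "x \<in> U i \<inter> A" "y \<in> U i \<inter> B" by blast
    then show False
      using diameter_bounded_bound[OF U(2)[of i], of x y] U(3)[of i] sep[of x y] assms(1) by auto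
  qed
  have "hausdorff_content s \<delta> S \<le> (\<Sum>i. ennreal (hausdorff_weight s (V S i)))"
    if "S \<subseteq> A \<union> B" for S
  proof (rule hausdorff_content_le)
    show "S \<subseteq> (\<Union>i. V S i)"
    proof
      fix x assume "x \<in> S"
      then have "x \<in> (\<Union>i. U i)" using U(1) that by blast
      then obtain i where "x \<in> U i" by blast
      then have "x \<in> V S i" using \<open>x \<in> S\<close> by (auto simp: V_def)
      then show "x \<in> (\<Union>i. V S i)" by blast
    qed
  qed (use U \<open>\<delta> \<ge> 0\<close> in \<open>auto simp: V_def\<close>)
  then have "hausdorff_content s \<delta> A + hausdorff_content s \<delta> B \<le>
      (\<Sum>i. ennreal (hausdorff_weight s (V A i))) + (\<Sum>i. ennreal (hausdorff_weight s (V B i)))"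
    by (intro add_mono) auto
  also have "\<dots> = (\<Sum>i. ennreal (hausdorff_weight s (V A i)) + ennreal (hausdorff_weight s (V B i)))"
    by (intro suminf_add) auto
  also have "\<dots> \<le> (\<Sum>i. ennreal (hausdorff_weight s (U i)))"
  proof (intro suminf_le allI)
    fix i
    show "ennreal (hausdorff_weight s (V A i)) + ennreal (hausdorff_weight s (V B i)) \<le>
        ennreal (hausdorff_weight s (U i))"
      using disj[of i] by (auto simp: V_def hausdorff_weight_def)
  qed auto
  finally show "hausdorff_content s \<delta> A + hausdorff_content s \<delta> B \<le>
    (\<Sum>i. ennreal (hausdorff_weight s (U i)))" .
qed

lemma hausdorff_outer_separated:
  assumes "\<gamma> > 0" and sep: "\<And>x y. x \<in> A \<Longrightarrow> y \<in> B \<Longrightarrow> \<gamma> \<le> dist x y"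
  shows "hausdorff_outer s A + hausdorff_outer s B \<le> hausdorff_outer s (A \<union> B)"
proof -
  have *: "hausdorff_content s \<delta> A + hausdorff_content s \<delta>' B \<le> hausdorff_outer s (A \<union> B)"
    if "\<delta> > 0" "\<delta>' > 0" for \<delta> \<delta>'
  proof -
    define d where "d = min (min \<delta> \<delta>') (\<gamma>/2)"
    have d: "d > 0" "d \<le> \<delta>" "d \<le> \<delta>'" "d < \<gamma>" using that assms(1) by (auto simp: d_def)
    have "hausdorff_content s \<delta> A + hausdorff_content s \<delta>' B
        \<le> hausdorff_content s d A + hausdorff_content s d B"
      using d by (intro add_mono hausdorff_content_antimono)
    also have "\<dots> \<le> hausdorff_content s d (A \<union> B)"
      using d sep by (intro hausdorff_content_separated) auto
    also have "\<dots> \<le> hausdorff_outer s (A \<union> B)"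
      using d by (intro hausdorff_content_le_outer)
    finally show ?thesis .
  qed
  have "hausdorff_outer s A + hausdorff_content s \<delta>' B \<le> hausdorff_outer s (A \<union> B)"
    if "\<delta>' > 0" for \<delta>'
    unfolding hausdorff_outer_eq_SUP[of s A]
    by (subst ennreal_SUP_add_left[symmetric]) (auto intro!: SUP_least * that)
  then show ?thesis
    unfolding hausdorff_outer_eq_SUP[of s B]
    by (subst ennreal_SUP_add_right) (auto intro!: SUP_least)
qed

text \<open>An outer measure that is additive on sets at positive distance measures closed sets. The part of
  \<open>A\<close> at distance at least \<open>1/(k+1)\<close> from \<open>F\<close> is separated from \<open>F\<close>; what it misses of \<open>A - F\<close> is a
  tail of a sequence of rings around \<open>F\<close>. Rings of the same index parity are separated from each other, so
  the outer measures of all rings sum up to at most twice that of \<open>A\<close>, and the tails tend to zero.\<close>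

lemma caratheodory_criterion:
  fixes \<mu> :: "'a::metric_space set \<Rightarrow> ennreal"
  assumes empty: "\<mu> {} = 0" and mono: "\<And>A B. A \<subseteq> B \<Longrightarrow> \<mu> A \<le> \<mu> B"
    and sub: "\<And>A. \<mu> (\<Union>i::nat. A i) \<le> (\<Sum>i. \<mu> (A i))"
    and sep: "\<And>A B \<gamma>. 0 < \<gamma> \<Longrightarrow> (\<And>x y. x \<in> A \<Longrightarrow> y \<in> B \<Longrightarrow> \<gamma> \<le> dist x y) \<Longrightarrow> \<mu> A + \<mu> B \<le> \<mu> (A \<union> B)"
    and "closed F"
  shows "\<mu> (A \<inter> F) + \<mu> (A - F) = \<mu> A"
proof (rule antisym)
  have sub2: "\<mu> (A \<union> B) \<le> \<mu> A + \<mu> B" for A B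
  proof -
    have "A \<union> B = (\<Union>i. binaryset A B i)" by (simp add: UN_binaryset_eq)
    then have "\<mu> (A \<union> B) \<le> (\<Sum>i. \<mu> (binaryset A B i))" using sub by metis
    also have "\<dots> = \<mu> A + \<mu> B" using empty by (rule suminf_binaryset_eq)
    finally show ?thesis .
  qed
  have "A = (A \<inter> F) \<union> (A - F)" by blast
  then show "\<mu> A \<le> \<mu> (A \<inter> F) + \<mu> (A - F)" using sub2 by metis
  show "\<mu> (A \<inter> F) + \<mu> (A - F) \<le> \<mu> A"
  proof (cases "F = {} \<or> \<mu> A = top")
    case True then show ?thesis by (auto simp: empty)
  next
    case False
    then have F: "F \<noteq> {}" and fin: "\<mu> A < top" by (auto simp: less_top)
    define B where "B k = {x \<in> A. 1 / real (Suc k) \<le> infdist x F}" for k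
    define R where "R k = {x \<in> A. 1 / real (Suc (Suc k)) \<le> infdist x F \<and> infdist x F < 1 / real (Suc k)}" for k
    have lip: "infdist x F \<le> infdist y F + dist x y" for x y
      by (rule infdist_triangle)
    \<comment> \<open>Rings whose indices differ by at least two are a positive distance apart.\<close>
    have ring_sep: "1 / real (Suc (Suc j)) - 1 / real (Suc k) \<le> dist x y"
      if "x \<in> R j" "y \<in> R k" for x y j k
      using that lip[of x y] by (auto simp: R_def)
    have finite_rings: "(\<Sum>i<N. \<mu> (R (2 * i + c))) \<le> \<mu> (\<Union>i<N. R (2 * i + c))" for N c :: nat
    proof (induction N)
      case 0 then show ?case by (simp add: empty)
    next
      case (Suc N)
      have "(\<Sum>i<Suc N. \<mu> (R (2*i+c))) \<le> \<mu> (\<Union>i<N. R (2*i+c)) + \<mu> (R (2*N+c))"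
        using Suc by (simp add: add_right_mono)
      also have "\<dots> \<le> \<mu> ((\<Union>i<N. R (2*i+c)) \<union> R (2*N+c))"
      proof (rule sep)
        have "1 / real (Suc (2*N+c)) < 1 / real (2*N+c)" if "N > 0"
          using that by (intro divide_strict_left_mono) auto
        then show "0 < (if N = 0 then 1 else 1 / real (2*N+c) - 1 / real (Suc (2*N+c)))"
          by auto
      next
        fix x y assume x: "x \<in> (\<Union>i<N. R (2*i+c))" and y: "y \<in> R (2*N+c)"
        then obtain i where i: "i < N" "x \<in> R (2*i+c)" by blast
        have "1 / real (2*N+c) \<le> 1 / real (Suc (Suc (2*i+c)))"
          using i by (intro divide_left_mono) auto
        with ring_sep[OF i(2) y] i
        show "(if N = 0 then 1 else 1 / real (2*N+c) - 1 / real (Suc (2*N+c))) \<le> dist x y"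
          by auto
      qed
      also have "(\<Union>i<N. R (2*i+c)) \<union> R (2*N+c) = (\<Union>i<Suc N. R (2*i+c))"
        by (auto simp: less_Suc_eq)
      finally show ?case .
    qed
    have parity: "(\<Sum>i. \<mu> (R (2 * i + c))) \<le> \<mu> A" for c
    proof (rule suminf_le_const)
      fix N
      have "\<mu> (\<Union>i<N. R (2 * i + c)) \<le> \<mu> A" by (rule mono) (auto simp: R_def)
      with finite_rings[of c N] show "(\<Sum>i<N. \<mu> (R (2 * i + c))) \<le> \<mu> A" by (rule order_trans)
    qed auto
    have "(\<Sum>k<N. \<mu> (R k)) \<le> \<mu> A + \<mu> A" for N
    proof -
      have "(\<Sum>k<N. \<mu> (R k)) \<le> (\<Sum>k<2*N. \<mu> (R k))"
        by (rule sum_mono2) auto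
      also have "\<dots> = (\<Sum>i<N. \<mu> (R (2*i+0))) + (\<Sum>i<N. \<mu> (R (2*i+1)))"
        by (induction N) (auto simp: algebra_simps)
      also have "\<dots> \<le> (\<Sum>i. \<mu> (R (2*i+0))) + (\<Sum>i. \<mu> (R (2*i+1)))"
        by (intro add_mono sum_le_suminf) auto
      also have "\<dots> \<le> \<mu> A + \<mu> A" by (intro add_mono parity)
      finally show ?thesis .
    qed
    then have "(\<Sum>k. \<mu> (R k)) \<le> \<mu> A + \<mu> A" by (intro suminf_le_const) auto
    also have "\<dots> < top" using fin by auto
    finally have finR: "(\<Sum>k. \<mu> (R k)) < top" .
    have tail: "(\<lambda>k. \<Sum>j. \<mu> (R (j + k))) \<longlonglongrightarrow> 0"
    proof -
      have ne: "\<mu> (R k) \<noteq> top" for k using finR ennreal_suminf_lessD less_irrefl by metis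
      define f where "f k = enn2real (\<mu> (R k))" for k
      have f: "\<mu> (R k) = ennreal (f k)" "f k \<ge> 0" for k using ne by (auto simp: f_def less_top)
      have sm: "summable f" using finR f by (intro summable_suminf_not_top) (auto simp: less_top)
      have "(\<lambda>k. \<Sum>j. f (j + k)) \<longlonglongrightarrow> 0" using sm by (rule suminf_exist_split2)
      then have "(\<lambda>k. ennreal (\<Sum>j. f (j + k))) \<longlonglongrightarrow> ennreal 0" by (rule tendsto_ennrealI)
      moreover have "(\<Sum>j. \<mu> (R (j + k))) = ennreal (\<Sum>j. f (j + k))" for k
        unfolding f(1) using f(2) sm by (intro suminf_ennreal2) (auto simp: summable_iff_shift)
      ultimately show ?thesis by simp
    qed
    have "\<mu> (A \<inter> F) + \<mu> (A - F) \<le> \<mu> A + (\<Sum>j. \<mu> (R (j + k)))" for k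
    proof -
      have "A - F \<subseteq> B k \<union> (\<Union>j. R (j + k))"
      proof
        fix x assume x: "x \<in> A - F"
        then have pos: "infdist x F > 0"
          using \<open>closed F\<close> F by (simp add: infdist_pos_not_in_closed)
        show "x \<in> B k \<union> (\<Union>j. R (j + k))"
        proof (cases "x \<in> B k")
          case False
          then have lt: "infdist x F < 1 / real (Suc k)" using x by (auto simp: B_def)
          obtain n0 where "1 / real (Suc n0) < infdist x F" using pos nat_approx_posE by blast
          then have ex: "\<exists>n. 1 / real (Suc n) \<le> infdist x F" by (auto intro: less_imp_le)
          define n where "n = (LEAST n. 1 / real (Suc n) \<le> infdist x F)"
          have n: "1 / real (Suc n) \<le> infdist x F" using ex unfolding n_def by (rule LeastI_ex)
          have "n > k"
          proof (rule ccontr)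
            assume "\<not> n > k"
            then have "1 / real (Suc k) \<le> 1 / real (Suc n)" by (intro divide_left_mono) auto
            then show False using n lt by linarith
          qed
          then obtain m where m: "n = Suc m" "m \<ge> k" by (cases n) auto
          then have "\<not> 1 / real (Suc m) \<le> infdist x F" unfolding n_def using not_less_Least by (metis lessI)
          then have "x \<in> R m" using n m x by (auto simp: R_def)
          then have "x \<in> R ((m - k) + k)" using m by simp
          then show ?thesis by blast
        qed simp
      qed
      then have "\<mu> (A - F) \<le> \<mu> (B k \<union> (\<Union>j. R (j + k)))" by (rule mono)
      also have "\<dots> \<le> \<mu> (B k) + (\<Sum>j. \<mu> (R (j + k)))"
        using sub2 sub add_left_mono order_trans by meson
      finally have "\<mu> (A \<inter> F) + \<mu> (A - F) \<le> \<mu> (A \<inter> F) + \<mu> (B k) + (\<Sum>j. \<mu> (R (j + k)))"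
        by (simp add: add_left_mono add.assoc)
      also have "\<mu> (A \<inter> F) + \<mu> (B k) \<le> \<mu> ((A \<inter> F) \<union> B k)"
      proof (rule sep)
        show "0 < 1 / real (Suc k)" by simp
        fix x y assume "x \<in> A \<inter> F" "y \<in> B k"
        then show "1 / real (Suc k) \<le> dist x y"
          using infdist_le[of x F y] by (auto simp: B_def dist_commute)
      qed
      also have "\<mu> ((A \<inter> F) \<union> B k) \<le> \<mu> A" by (rule mono) (auto simp: B_def)
      finally show ?thesis by (simp add: add_right_mono)
    qed
    moreover have "(\<lambda>k. \<mu> A + (\<Sum>j. \<mu> (R (j + k)))) \<longlonglongrightarrow> \<mu> A + 0"
      by (intro tendsto_add tendsto_const tail)
    ultimately show ?thesis by (intro LIMSEQ_le_const) auto
  qed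
qed

text \<open>Without countable additivity \<open>measure_of\<close> would silently return the zero measure, and lateral
  norms would say nothing about the boundary.\<close>

lemma measure_space_hausdorff_outer:
  "measure_space UNIV (sets borel) (hausdorff_outer s :: 'a::metric_space set \<Rightarrow> ennreal)"
proof -
  let ?\<mu> = "hausdorff_outer s :: 'a set \<Rightarrow> ennreal"
  let ?L = "lambda_system UNIV (Pow UNIV) ?\<mu>"
  have "outer_measure_space (Pow UNIV) ?\<mu>"
    by (auto simp: outer_measure_space_def positive_def increasing_def countably_subadditive_def
        hausdorff_outer_empty hausdorff_outer_mono hausdorff_outer_UN_le)
  from sigma_algebra.caratheodory_lemma[OF sigma_algebra_Pow this]
  have ms: "measure_space UNIV ?L ?\<mu>" .
  then have sa: "sigma_algebra UNIV ?L" by (simp add: measure_space_def)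
  have "?\<mu> (A \<inter> F) + ?\<mu> (A - F) = ?\<mu> A" if "closed F" for F A :: "'a set"
    by (rule caratheodory_criterion[of ?\<mu>, OF hausdorff_outer_empty hausdorff_outer_mono
        hausdorff_outer_UN_le hausdorff_outer_separated that])
  then have "{S. closed S} \<subseteq> ?L"
    by (auto simp: lambda_system_def Int_commute Diff_eq)
  then have "sigma_sets UNIV {S. closed S} \<subseteq> ?L"
    by (rule sigma_algebra.sigma_sets_subset[OF sa])
  then have "sets borel \<subseteq> ?L"
    by (simp add: borel_eq_closed)
  then show ?thesis
    using ms by (auto simp: measure_space_def positive_def countably_additive_def
        sets.sigma_algebra_axioms[of "borel :: 'a measure", simplified])
qed

lemma sets_hausdorff_measure: "sets (hausdorff_measure s :: 'a::metric_space measure) = sets borel"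
  using sets.sigma_sets_eq[of "borel :: 'a measure"]
  by (simp add: hausdorff_measure_def sets_measure_of_conv)

lemma emeasure_hausdorff_measure:
  "A \<in> sets borel \<Longrightarrow> emeasure (hausdorff_measure s) A = hausdorff_outer s A"
  unfolding hausdorff_measure_def
  using measure_space_hausdorff_outer[of s]
  by (intro emeasure_measure_of_sigma) (auto simp: measure_space_def)

section \<open>Lipschitz extensions and integral curves\<close>

text \<open>McShane's formula: the largest \<open>L\<close>-Lipschitz function with the given values on \<open>S\<close>.\<close>

lemma lipschitz_extension_real:
  fixes f :: "'a::metric_space \<Rightarrow> real"
  assumes "L-lipschitz_on S f"
  obtains g where "\<And>x. x \<in> S \<Longrightarrow> g x = f x" "L-lipschitz_on UNIV g"
proof (cases "S = {}")
  case True
  have "L-lipschitz_on UNIV (\<lambda>x::'a. 0::real)"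
    using lipschitz_on_nonneg[OF assms] by (simp add: lipschitz_on_def)
  then show ?thesis using True that by blast
next
  case False
  have L: "L \<ge> 0" using assms by (rule lipschitz_on_nonneg)
  define g where "g x = (INF s\<in>S. f s + L * dist x s)" for x
  have tri: "f s \<le> f s' + L * dist s s'" if "s \<in> S" "s' \<in> S" for s s'
    using lipschitz_onD[OF assms that] by (simp add: dist_real_def)
  have bdd: "bdd_below ((\<lambda>s. f s + L * dist x s) ` S)" for x
  proof -
    obtain s0 where s0: "s0 \<in> S" using False by blast
    have "f s0 - L * dist x s0 \<le> f s + L * dist x s" if "s \<in> S" for s
    proof -
      have "L * dist s0 s \<le> L * (dist x s0 + dist x s)"
        using L by (intro mult_left_mono) (auto simp: dist_triangle3)
      with tri[OF s0 that] show ?thesis by (simp add: algebra_simps)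
    qed
    then show ?thesis by (intro bdd_belowI2)
  qed
  have "g x = f x" if "x \<in> S" for x
  proof (rule antisym)
    show "g x \<le> f x" unfolding g_def using cINF_lower[OF bdd that, of x] by simp
    show "f x \<le> g x" unfolding g_def using False tri[OF that] by (intro cINF_greatest) auto
  qed
  moreover have le: "g x \<le> g y + L * dist x y" for x y
  proof -
    have "g x - L * dist x y \<le> f s + L * dist y s" if "s \<in> S" for s
    proof -
      have "g x \<le> f s + L * dist x s" unfolding g_def by (rule cINF_lower[OF bdd that])
      also have "L * dist x s \<le> L * (dist x y + dist y s)"
        using L by (intro mult_left_mono) (auto simp: dist_triangle)
      finally show ?thesis by (simp add: algebra_simps)
    qed
    then have "g x - L * dist x y \<le> g y" unfolding g_def[of y] using False by (intro cINF_greatest) auto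
    then show ?thesis by simp
  qed
  have "L-lipschitz_on UNIV g"
  proof (rule lipschitz_onI)
    fix x y show "dist (g x) (g y) \<le> L * dist x y"
      using le[of x y] le[of y x] by (auto simp: dist_real_def dist_commute abs_le_iff)
  qed (rule L)
  ultimately show ?thesis by (rule that)
qed

lemma lipschitz_extension_cart:
  fixes f :: "'a::metric_space \<Rightarrow> real^'n"
  assumes "L-lipschitz_on S f"
  obtains g where "\<And>x. x \<in> S \<Longrightarrow> g x = f x" "(real CARD('n) * L)-lipschitz_on UNIV g"
proof -
  have L: "L \<ge> 0" using assms by (rule lipschitz_on_nonneg)
  have "L-lipschitz_on S (\<lambda>x. f x $ i)" for i
  proof (rule lipschitz_onI)
    fix x y assume "x \<in> S" "y \<in> S"
    then show "dist (f x $ i) (f y $ i) \<le> L * dist x y"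
      using lipschitz_onD[OF assms, of x y] dist_vec_nth_le[of "f x" i "f y"] by linarith
  qed (rule L)
  then have "\<exists>g. (\<forall>x\<in>S. g x = f x $ i) \<and> L-lipschitz_on UNIV g" for i
    using lipschitz_extension_real[of L S "\<lambda>x. f x $ i"] by metis
  then obtain g where g: "\<And>i x. x \<in> S \<Longrightarrow> g i x = f x $ i" "\<And>i. L-lipschitz_on UNIV (g i)"
    by metis
  show ?thesis
  proof (rule that[of "\<lambda>x. \<chi> i. g i x"])
    show "(real CARD('n) * L)-lipschitz_on UNIV (\<lambda>x. \<chi> i. g i x)"
    proof (rule lipschitz_onI)
      fix x y
      have "dist (\<chi> i. g i x) (\<chi> i. g i y) \<le> (\<Sum>i\<in>UNIV. \<bar>g i x - g i y\<bar>)"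
        using norm_le_l1_cart[of "(\<chi> i. g i x) - (\<chi> i. g i y)"] by (simp add: dist_norm)
      also have "\<dots> \<le> (\<Sum>i\<in>(UNIV::'n set). L * dist x y)"
        using lipschitz_onD[OF g(2), of x y] by (intro sum_mono) (auto simp: dist_real_def)
      finally show "dist (\<chi> i. g i x) (\<chi> i. g i y) \<le> real CARD('n) * L * dist x y"
        by simp
    qed (use L in simp)
  qed (simp add: g vec_eq_iff)
qed

text \<open>On a time interval of length at most \<open>1/(2L)\<close> the difference of two integral curves varies by at most
  half of its maximum. This compares the curves at any two times \<open>s\<close> and \<open>t\<close>, so it expresses at once the
  continuous dependence on the initial point and its counterpart backwards in time.\<close>

lemma integral_curves_gap:
  fixes \<phi> \<psi> :: "real \<Rightarrow> 'a::euclidean_space"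
  assumes G: "L-lipschitz_on UNIV G" and b: "L * b \<le> 1/2"
    and \<phi>: "\<And>t. t \<in> {0..b} \<Longrightarrow> (\<phi> has_vector_derivative G (\<phi> t)) (at t within {0..b})"
    and \<psi>: "\<And>t. t \<in> {0..b} \<Longrightarrow> (\<psi> has_vector_derivative G (\<psi> t)) (at t within {0..b})"
    and s: "s \<in> {0..b}" and t: "t \<in> {0..b}"
  shows "dist (\<phi> s) (\<psi> s) \<le> 2 * dist (\<phi> t) (\<psi> t)"
proof -
  have L: "L \<ge> 0" using G by (rule lipschitz_on_nonneg)
  define f where "f r = \<phi> r - \<psi> r" for r
  have f: "(f has_vector_derivative (G (\<phi> r) - G (\<psi> r))) (at r within {0..b})" if "r \<in> {0..b}" for r
    unfolding f_def by (intro has_vector_derivative_diff \<phi> \<psi> that)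
  have "continuous_on {0..b} f"
    by (rule continuous_on_vector_derivative) (rule f)
  then have "continuous_on {0..b} (\<lambda>r. norm (f r))" by (intro continuous_intros)
  moreover have "{0..b} \<noteq> {}" using s by auto
  ultimately obtain m where m: "m \<in> {0..b}" "\<And>r. r \<in> {0..b} \<Longrightarrow> norm (f r) \<le> norm (f m)"
    using continuous_attains_sup[of "{0..b}" "\<lambda>r. norm (f r)"] by auto
  have "norm (f m - f t) \<le> (L * norm (f m)) * norm (m - t)"
  proof (rule differentiable_bound[of "{0..b}" f "\<lambda>r h. h *\<^sub>R (G (\<phi> r) - G (\<psi> r))"])
    fix r assume r: "r \<in> {0..b}"
    show "(f has_derivative (\<lambda>h. h *\<^sub>R (G (\<phi> r) - G (\<psi> r)))) (at r within {0..b})"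
      using f[OF r] by (simp add: has_vector_derivative_def)
    have "norm (G (\<phi> r) - G (\<psi> r)) \<le> L * norm (f r)"
      using lipschitz_onD[OF G, of "\<phi> r" "\<psi> r"] by (simp add: dist_norm f_def)
    also have "\<dots> \<le> L * norm (f m)" using m(2)[OF r] L by (intro mult_left_mono)
    finally show "onorm (\<lambda>h. h *\<^sub>R (G (\<phi> r) - G (\<psi> r))) \<le> L * norm (f m)"
      by (subst onorm_scaleR_left) (auto simp: onorm_id)
  qed (use m t in auto)
  also have "\<dots> \<le> (L * norm (f m)) * b"
    using m t L by (intro mult_left_mono) auto
  also have "\<dots> = (L * b) * norm (f m)" by simp
  also have "\<dots> \<le> 1/2 * norm (f m)" using b by (intro mult_right_mono) auto
  finally have "norm (f m) \<le> 2 * norm (f t)"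
    using norm_triangle_ineq2[of "f m" "f t"] by linarith
  with m(2)[OF s] show ?thesis by (simp add: f_def dist_norm)
qed

text \<open>Banach's fixed point theorem for the Picard operator. Clamping the time to \<open>[0,a]\<close> lets the
  operator act on bounded continuous functions on the whole line, which form a complete space.\<close>

lemma lipschitz_integral_curve:
  fixes G :: "'a::euclidean_space \<Rightarrow> 'a"
  assumes G: "L-lipschitz_on UNIV G" and a: "0 \<le> a" "L * a \<le> 1/2"
  obtains X where "continuous_on UNIV X" "X 0 = x"
    "\<And>t. t \<in> {0..a} \<Longrightarrow> (X has_vector_derivative G (X t)) (at t within {0..a})"
proof -
  have L: "L \<ge> 0" using G by (rule lipschitz_on_nonneg)
  define cl where "cl t = max 0 (min a t)" for t :: real
  have cl: "cl t \<in> {0..a}" for t using a by (auto simp: cl_def)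
  have cl_id: "cl t = t" if "t \<in> {0..a}" for t using that by (auto simp: cl_def)
  have cont_cl: "continuous_on UNIV cl" unfolding cl_def by (intro continuous_intros)
  have contG: "continuous_on S G" for S
    using lipschitz_on_continuous_on[OF G] continuous_on_subset by blast
  have contGX: "continuous_on S (\<lambda>s. G (X s))" if "continuous_on S X" for S and X :: "real \<Rightarrow> 'a"
    by (rule continuous_on_compose2[OF contG that]) auto
  define F where "F X t = x + integral {0..cl t} (\<lambda>s. G (X s))" for X :: "real \<Rightarrow> 'a" and t
  have F_in: "F X \<in> bcontfun" if "continuous_on UNIV X" for X
  proof -
    have X: "continuous_on {0..a} (\<lambda>s. G (X s))"
      by (intro contGX continuous_on_subset[OF that]) auto
    have c: "continuous_on {0..a} (\<lambda>t. x + integral {0..t} (\<lambda>s. G (X s)))"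
      by (intro continuous_intros indefinite_integral_continuous_1 integrable_continuous_real X)
    have "continuous_on UNIV (F X)" unfolding F_def
      by (rule continuous_on_compose2[OF c cont_cl]) (use cl in auto)
    moreover have "bounded (range (F X))"
    proof (rule bounded_subset)
      show "bounded ((\<lambda>t. x + integral {0..t} (\<lambda>s. G (X s))) ` {0..a})"
        by (intro compact_imp_bounded compact_continuous_image c) auto
      show "range (F X) \<subseteq> (\<lambda>t. x + integral {0..t} (\<lambda>s. G (X s))) ` {0..a}"
        using cl by (auto simp: F_def)
    qed
    ultimately show ?thesis by (simp add: bcontfun_def)
  qed
  define FF where "FF \<phi> = Bcontfun (F (apply_bcontfun \<phi>))" for \<phi> :: "real \<Rightarrow>\<^sub>C 'a"
  have FF: "apply_bcontfun (FF \<phi>) = F (apply_bcontfun \<phi>)" for \<phi>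
    unfolding FF_def by (rule Bcontfun_inverse) (rule F_in, simp)
  have "dist (FF \<phi>) (FF \<psi>) \<le> 1/2 * dist \<phi> \<psi>" for \<phi> \<psi>
  proof (rule dist_bound)
    fix t
    have i: "(\<lambda>s. G (apply_bcontfun \<phi> s)) integrable_on {0..cl t}" for \<phi> :: "real \<Rightarrow>\<^sub>C 'a"
      by (intro integrable_continuous_real contGX) auto
    have "dist (apply_bcontfun (FF \<phi>) t) (apply_bcontfun (FF \<psi>) t) =
        norm (integral {0..cl t} (\<lambda>s. G (apply_bcontfun \<phi> s) - G (apply_bcontfun \<psi> s)))"
      by (simp add: FF F_def dist_norm integral_diff[OF i i])
    also have "\<dots> \<le> (L * dist \<phi> \<psi>) * (cl t - 0)"
    proof (rule integral_bound)
      show "continuous_on {0..cl t} (\<lambda>s. G (apply_bcontfun \<phi> s) - G (apply_bcontfun \<psi> s))"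
        by (intro continuous_intros contGX) auto
      fix s
      have "norm (G (apply_bcontfun \<phi> s) - G (apply_bcontfun \<psi> s)) \<le> L * dist (apply_bcontfun \<phi> s) (apply_bcontfun \<psi> s)"
        using lipschitz_onD[OF G] by (simp add: dist_norm)
      also have "\<dots> \<le> L * dist \<phi> \<psi>" by (intro mult_left_mono dist_bounded L)
      finally show "norm (G (apply_bcontfun \<phi> s) - G (apply_bcontfun \<psi> s)) \<le> L * dist \<phi> \<psi>" .
    qed (use cl in auto)
    also have "\<dots> \<le> (L * dist \<phi> \<psi>) * a"
      using cl[of t] L by (intro mult_left_mono) auto
    also have "\<dots> = (L * a) * dist \<phi> \<psi>" by simp
    also have "\<dots> \<le> 1/2 * dist \<phi> \<psi>" using a by (intro mult_right_mono) auto
    finally show "dist (apply_bcontfun (FF \<phi>) t) (apply_bcontfun (FF \<psi>) t) \<le> 1/2 * dist \<phi> \<psi>" .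
  qed
  then have "\<exists>!\<phi>. FF \<phi> = \<phi>" by (intro banach_fix_type[of "1/2"]) auto
  then obtain \<phi> where \<phi>: "FF \<phi> = \<phi>" by blast
  define X where "X = apply_bcontfun \<phi>"
  have contX: "continuous_on UNIV X" by (simp add: X_def)
  have X: "X t = x + integral {0..cl t} (\<lambda>s. G (X s))" for t
  proof -
    have "X = F X" using FF[of \<phi>] unfolding X_def \<phi> .
    then have "X t = F X t" by (rule fun_cong)
    then show ?thesis unfolding F_def .
  qed
  have "(X has_vector_derivative G (X t)) (at t within {0..a})" if t: "t \<in> {0..a}" for t
  proof (rule has_vector_derivative_transform[OF t])
    show "X r = x + integral {0..r} (\<lambda>s. G (X s))" if "r \<in> {0..a}" for r
      by (rule X[of r, unfolded cl_id[OF that]])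
    have "((\<lambda>r. integral {0..r} (\<lambda>s. G (X s))) has_vector_derivative G (X t)) (at t within {0..a})"
      by (intro integral_has_vector_derivative contGX continuous_on_subset[OF contX] t subset_UNIV)
    from has_vector_derivative_add[OF has_vector_derivative_const this, of x]
    show "((\<lambda>r. x + integral {0..r} (\<lambda>s. G (X s))) has_vector_derivative G (X t)) (at t within {0..a})"
      by (simp only: add_0)
  qed
  then show ?thesis
  proof (rule that[OF contX, rotated])
    have cl0: "cl 0 = 0" using a by (simp add: cl_def)
    have "integral {0..0} (\<lambda>s. G (X s)) = 0" using integral_refl[of "0::real"] by (simp only: cbox_interval)
    from X[of 0, unfolded cl0 this] have "X 0 = x + 0" .
    then show "X 0 = x" by (rule trans[OF _ add_0_right])
  qed
qed

section \<open>A cell at a boundary point\<close>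

lemma frechet_derivative_eq_gradient:
  fixes f :: "'a::euclidean_space \<Rightarrow> real"
  assumes "f differentiable (at x)"
  shows "frechet_derivative f (at x) v = gradient f x \<bullet> v"
proof -
  have lin: "linear (frechet_derivative f (at x))"
    using assms by (rule linear_frechet_derivative)
  have "frechet_derivative f (at x) v = frechet_derivative f (at x) (\<Sum>b\<in>Basis. (v \<bullet> b) *\<^sub>R b)"
    by (simp add: euclidean_representation)
  also have "\<dots> = (\<Sum>b\<in>Basis. (v \<bullet> b) * frechet_derivative f (at x) b)"
    by (simp add: linear_sum[OF lin] linear_cmul[OF lin])
  also have "\<dots> = gradient f x \<bullet> v"
    by (simp add: gradient_def inner_sum_left inner_commute[of v] mult.commute)
  finally show ?thesis .
qed

text \<open>Near \<open>x0\<close> the gradient of the defining function stays close to its value at \<open>x0\<close>, so the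
  function strictly increases along every segment whose direction lies in a fixed cone around the normal.
  Moving against such a direction from a point of the closure leads into the domain. Only this cone
  property of the boundary is used from here on.\<close>

lemma defining_function_cone:
  fixes \<Omega> :: "'a::euclidean_space set"
  assumes def: "defining_function \<Omega> x0 U \<rho>" and "open \<Omega>" and "0 < \<eta>"
  obtains r where "0 < r"
    "\<And>x y. x \<in> closure \<Omega> \<Longrightarrow> x \<in> ball x0 r \<Longrightarrow> y \<in> ball x0 r \<Longrightarrow> y \<noteq> x \<Longrightarrow>
       \<eta> * norm (x - y) \<le> (x - y) \<bullet> sgn (gradient \<rho> x0) \<Longrightarrow> y \<in> \<Omega>"
proof -
  let ?g = "gradient \<rho>"
  have U: "open U" "x0 \<in> U" and sm: "smooth_on U \<rho>" and nz: "?g x0 \<noteq> 0"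
    and in_\<Omega>: "\<Omega> \<inter> U = {y\<in>U. \<rho> y < 0}" and fr: "frontier \<Omega> \<inter> U = {y\<in>U. \<rho> y = 0}"
    using def by (auto simp: defining_function_def)
  have "Ck_on (Suc 0) U \<rho>" using sm unfolding smooth_on_def by blast
  then have diff: "\<And>x. x \<in> U \<Longrightarrow> \<rho> differentiable (at x)"
    and cont: "\<And>b. b \<in> Basis \<Longrightarrow> continuous_on U (\<lambda>x. frechet_derivative \<rho> (at x) b)"
    by auto
  have "continuous_on U ?g"
    unfolding gradient_def by (intro continuous_intros cont)
  then have "isCont ?g x0" using U continuous_on_eq_continuous_at by blast
  moreover have "0 < \<eta> * norm (?g x0) / 2" using nz \<open>0 < \<eta>\<close> by simp
  ultimately obtain d where d: "d > 0" "\<And>y. dist y x0 < d \<Longrightarrow> dist (?g y) (?g x0) < \<eta> * norm (?g x0) / 2"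
    unfolding continuous_at_eps_delta by blast
  obtain d' where d': "d' > 0" "ball x0 d' \<subseteq> U" using U openE by blast
  define r where "r = min d d'"
  have r: "ball x0 r \<subseteq> U" "r > 0" using d d' by (auto simp: r_def)
  show ?thesis
  proof (rule that[OF r(2)])
    fix x y
    assume x: "x \<in> closure \<Omega>" "x \<in> ball x0 r" and y: "y \<in> ball x0 r" "y \<noteq> x"
      and cone: "\<eta> * norm (x - y) \<le> (x - y) \<bullet> sgn (?g x0)"
    have "closed_segment y x \<subseteq> ball x0 r"
      using x y by (intro closed_segment_subset) auto
    moreover have "\<exists>z\<in>closed_segment y x. \<rho> x - \<rho> y = frechet_derivative \<rho> (at z) (x - y)"
    proof -
      let ?\<phi> = "\<lambda>t. \<rho> (y + t *\<^sub>R (x - y))"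
      have seg: "y + t *\<^sub>R (x - y) \<in> closed_segment y x" if "t \<in> {0..1}" for t
        using that by (auto simp: closed_segment_def algebra_simps intro!: exI[of _ t])
      have "(?\<phi> has_derivative (\<lambda>h. frechet_derivative \<rho> (at (y + t *\<^sub>R (x - y))) (h *\<^sub>R (x - y)))) (at t within {0..1})"
        if "t \<in> {0..1}" for t
      proof -
        have "(\<rho> has_derivative frechet_derivative \<rho> (at (y + t *\<^sub>R (x - y)))) (at (y + t *\<^sub>R (x - y)))"
          using frechet_derivative_works[THEN iffD1, OF diff] seg[OF that]
            \<open>closed_segment y x \<subseteq> ball x0 r\<close> r(1) by (meson subsetD)
        moreover have "((\<lambda>t. y + t *\<^sub>R (x - y)) has_derivative (\<lambda>h. h *\<^sub>R (x - y))) (at t within {0..1})"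
          by (auto intro!: derivative_eq_intros)
        ultimately show ?thesis
          by (rule has_derivative_compose[rotated])
      qed
      from mvt_very_simple[of 0 1 ?\<phi>, OF _ this] obtain t where "t \<in> {0..1}"
        "?\<phi> 1 - ?\<phi> 0 = frechet_derivative \<rho> (at (y + t *\<^sub>R (x - y))) ((1 - 0) *\<^sub>R (x - y))"
        by auto
      then show ?thesis using seg[of t] by (intro bexI[of _ "y + t *\<^sub>R (x - y)"]) auto
    qed
    ultimately obtain z where z: "z \<in> ball x0 r" "\<rho> x - \<rho> y = frechet_derivative \<rho> (at z) (x - y)"
      by blast
    note z(2)
    also have "frechet_derivative \<rho> (at z) (x - y) = ?g z \<bullet> (x - y)"
      using z(1) r(1) by (intro frechet_derivative_eq_gradient diff) blast
    finally have mv: "\<rho> x - \<rho> y = ?g z \<bullet> (x - y)" .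
    have "\<eta> * norm (x - y) * norm (?g x0) \<le> ((x - y) \<bullet> sgn (?g x0)) * norm (?g x0)"
      by (intro mult_right_mono cone) auto
    also have "\<dots> = ?g x0 \<bullet> (x - y)"
      using nz by (simp add: sgn_div_norm inner_commute)
    also have "\<dots> = ?g z \<bullet> (x - y) - (?g z - ?g x0) \<bullet> (x - y)"
      by (simp add: inner_diff_left)
    finally have "\<eta> * norm (x - y) * norm (?g x0) \<le> ?g z \<bullet> (x - y) - (?g z - ?g x0) \<bullet> (x - y)" .
    moreover have "- ((?g z - ?g x0) \<bullet> (x - y)) \<le> norm (?g z - ?g x0) * norm (x - y)"
      using Cauchy_Schwarz_ineq2[of "?g z - ?g x0" "x - y"] by linarith
    moreover have "norm (?g z - ?g x0) * norm (x - y) < (\<eta> * norm (?g x0) / 2) * norm (x - y)"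
      using d(2)[of z] z y by (intro mult_strict_right_mono) (auto simp: r_def dist_norm norm_minus_commute)
    moreover have "(\<eta> * norm (?g x0) / 2) * norm (x - y) = \<eta> * norm (x - y) * norm (?g x0) / 2" by simp
    ultimately have "\<eta> * norm (x - y) * norm (?g x0) / 2 < \<rho> x - \<rho> y"
      unfolding mv by linarith
    moreover have "0 < \<eta> * norm (x - y) * norm (?g x0)" using nz y \<open>0 < \<eta>\<close> by simp
    ultimately have "\<rho> y < \<rho> x" by linarith
    also have "\<rho> x \<le> 0"
    proof -
      have "x \<in> U" using x r by blast
      moreover have "x \<in> \<Omega> \<or> x \<in> frontier \<Omega>"
        using x \<open>open \<Omega>\<close> by (auto simp: frontier_def interior_open)
      ultimately have "x \<in> {y\<in>U. \<rho> y < 0} \<or> x \<in> {y\<in>U. \<rho> y = 0}" unfolding in_\<Omega>[symmetric] fr[symmetric] by blast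
      then show ?thesis by auto
    qed
    finally show "y \<in> \<Omega>" using in_\<Omega> y r(1) by blast
  qed
qed

text \<open>The cone property at a boundary point, for directions with \<open>v \<bullet> e \<ge> \<eta> |v|\<close>. The length \<open>\<epsilon>\<close> is
  the scale of the cell cut off below.\<close>

locale boundary_cone =
  fixes \<Omega> :: "'a::euclidean_space set" and x0 e :: 'a and \<eta> r \<epsilon> :: real
  assumes open_\<Omega>: "open \<Omega>" and x0: "x0 \<in> frontier \<Omega>" and e: "norm e = 1"
    and \<eta>: "0 < \<eta>" "\<eta> \<le> 1/4" and \<epsilon>: "0 < \<epsilon>" "30 * \<epsilon> < \<eta> * r"
    and cone: "\<And>x y. x \<in> closure \<Omega> \<Longrightarrow> x \<in> ball x0 r \<Longrightarrow> y \<in> ball x0 r \<Longrightarrow> y \<noteq> x \<Longrightarrow>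
       \<eta> * norm (x - y) \<le> (x - y) \<bullet> e \<Longrightarrow> y \<in> \<Omega>"
begin

text \<open>The cell is the part of the domain inside a cone opened in the direction of the outward normal,
  with its tip slightly inside the domain. The aperture constant \<open>2 \<eta>\<close> is twice that of the cone property:
  the cone is narrower, so segments from the apex to the cell stay in the domain, and far from \<open>x0\<close> it
  has left the domain, so that the cell is small.\<close>

definition apex :: 'a where "apex = x0 - \<epsilon> *\<^sub>R e"

definition cell :: "'a set" where
  "cell = {x \<in> \<Omega> \<inter> ball x0 r. 2 * \<eta> * norm (x - apex) < (x - apex) \<bullet> e}"

lemma e_inner: "e \<bullet> e = 1" using e by (simp add: norm_eq_1)

lemma x0_notin: "x0 \<notin> \<Omega>" and x0_closure: "x0 \<in> closure \<Omega>"
  using x0 open_\<Omega> by (auto simp: frontier_def interior_open)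

lemma r_pos: "r > 0"
proof -
  have "0 < \<eta> * r" using \<epsilon> by linarith
  then show ?thesis using \<eta> by (simp add: zero_less_mult_iff)
qed

lemma \<epsilon>_small: "30 * (\<epsilon> / \<eta>) < r" "\<epsilon> \<le> \<epsilon> / \<eta>"
  using \<epsilon> \<eta> by (auto simp: field_simps)

text \<open>In the cone, the component of \<open>x - x0\<close> along \<open>e\<close> is at least \<open>2 \<eta> |x - x0|\<close> up to an error of order \<open>\<epsilon>\<close>, while for a
  point of the domain it is below \<open>\<eta> |x - x0|\<close> by the cone property.\<close>

lemma cell_near: assumes "x \<in> cell" shows "norm (x - x0) \<le> 2 * (\<epsilon> / \<eta>)"
proof -
  have x: "x \<in> \<Omega>" "x \<in> ball x0 r" "2 * \<eta> * norm (x - apex) < (x - apex) \<bullet> e"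
    using assms by (auto simp: cell_def)
  have "x \<noteq> x0" using x x0_notin by auto
  have "(x - x0) \<bullet> e < \<eta> * norm (x - x0)"
  proof (rule ccontr)
    assume "\<not> ?thesis"
    then have "x0 \<in> \<Omega>"
      using x closure_subset[of \<Omega>] \<open>x \<noteq> x0\<close> r_pos by (intro cone[of x x0]) auto
    then show False using x0_notin by simp
  qed
  moreover have eq: "x - apex = (x - x0) + \<epsilon> *\<^sub>R e" by (simp add: apex_def)
  have "(x - apex) \<bullet> e = (x - x0) \<bullet> e + \<epsilon>" unfolding eq by (simp add: inner_add_left e_inner)
  moreover have "norm (x - x0) - \<epsilon> \<le> norm (x - apex)"
    unfolding eq using norm_triangle_ineq4[of "(x - x0) + \<epsilon> *\<^sub>R e" "\<epsilon> *\<^sub>R e"] e \<epsilon> by auto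
  then have "2 * \<eta> * (norm (x - x0) - \<epsilon>) \<le> 2 * \<eta> * norm (x - apex)"
    using \<eta> by (intro mult_left_mono) auto
  ultimately have "\<eta> * norm (x - x0) \<le> \<epsilon> + 2 * \<eta> * \<epsilon>"
    using x(3) by (simp add: algebra_simps)
  also have "2 * \<eta> * \<epsilon> \<le> 1 * \<epsilon>" using \<eta> \<epsilon> by (intro mult_right_mono) auto
  finally show ?thesis using \<eta> by (simp add: field_simps)
qed

lemma closure_cell_near: "x \<in> closure cell \<Longrightarrow> norm (x - x0) \<le> 2 * (\<epsilon> / \<eta>)"
proof -
  have "closure cell \<subseteq> cball x0 (2 * (\<epsilon> / \<eta>))"
    using cell_near by (intro closure_minimal) (auto simp: dist_norm norm_minus_commute)
  then show "x \<in> closure cell \<Longrightarrow> norm (x - x0) \<le> 2 * (\<epsilon> / \<eta>)"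
    by (auto simp: dist_norm norm_minus_commute)
qed

lemma closure_cell_ball: "closure cell \<subseteq> ball x0 r"
proof
  fix x assume "x \<in> closure cell"
  moreover have "0 < \<epsilon> / \<eta>" using \<epsilon> \<eta> by simp
  ultimately show "x \<in> ball x0 r"
    using closure_cell_near[of x] \<epsilon>_small by (simp add: dist_norm norm_minus_commute)
qed

lemma cell_subset: "cell \<subseteq> \<Omega>" by (auto simp: cell_def)

lemma bounded_cell: "bounded cell"
  by (rule bounded_subset[OF bounded_ball[of x0 r]]) (auto simp: cell_def)

lemma open_cell: "open cell"
proof -
  have "cell = (\<Omega> \<inter> ball x0 r) \<inter> {x. 2 * \<eta> * norm (x - apex) < (x - apex) \<bullet> e}"
    by (auto simp: cell_def)
  moreover have "open {x. 2 * \<eta> * norm (x - apex) < (x - apex) \<bullet> e}"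
    by (intro open_Collect_less continuous_intros)
  ultimately show ?thesis using open_\<Omega> by auto
qed

text \<open>Receding by \<open>s\<close> against the normal leaves room for an arbitrary displacement \<open>v\<close> of size \<open>s/3\<close>.\<close>

lemma back_in_\<Omega>:
  assumes "x \<in> closure \<Omega>" "norm (x - x0) \<le> 2 * (\<epsilon> / \<eta>)" "0 < s" "s \<le> 12 * (\<epsilon> / \<eta>)" "norm v \<le> s / 3"
  shows "x - s *\<^sub>R e + v \<in> \<Omega>"
proof (rule cone[of x])
  have pos: "0 < \<epsilon> / \<eta>" using \<epsilon> \<eta> by simp
  show "x \<in> closure \<Omega>" by fact
  show "x \<in> ball x0 r" using assms(2) \<epsilon>_small pos by (simp add: dist_norm norm_minus_commute)
  have "norm (x - s *\<^sub>R e + v - x0) \<le> norm (x - x0) + norm (s *\<^sub>R e) + norm v"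
    using norm_triangle_ineq4[of "x - x0" "s *\<^sub>R e"] norm_triangle_ineq[of "x - x0 - s *\<^sub>R e" v]
    by (simp add: algebra_simps)
  also have "\<dots> \<le> 2 * (\<epsilon> / \<eta>) + s + s/3" using assms e by auto
  also have "\<dots> < r" using assms \<epsilon>_small pos by linarith
  finally show "x - s *\<^sub>R e + v \<in> ball x0 r" by (simp add: dist_norm norm_minus_commute)
  have "v \<bullet> e \<le> s/3" using assms(5) norm_cauchy_schwarz[of v e] e by auto
  then have inn: "(x - (x - s *\<^sub>R e + v)) \<bullet> e \<ge> 2/3 * s"
    by (simp add: inner_diff_left e_inner algebra_simps)
  show "x - s *\<^sub>R e + v \<noteq> x"
  proof
    assume "x - s *\<^sub>R e + v = x"
    with inn have "2/3 * s \<le> 0" by simp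
    with \<open>0 < s\<close> show False by simp
  qed
  have "norm (x - (x - s *\<^sub>R e + v)) \<le> s + s/3"
    using norm_triangle_ineq4[of "s *\<^sub>R e" v] assms e by (simp add: algebra_simps)
  then have "\<eta> * norm (x - (x - s *\<^sub>R e + v)) \<le> 1/4 * (s + s/3)"
    using \<eta> \<open>0 < s\<close> by (intro mult_mono) auto
  also have "\<dots> \<le> 2/3 * s" using \<open>0 < s\<close> by simp
  also note inn
  finally show "\<eta> * norm (x - (x - s *\<^sub>R e + v)) \<le> (x - (x - s *\<^sub>R e + v)) \<bullet> e" .
qed

lemma axis_in_cell: assumes "0 < s" "s < \<epsilon>" shows "x0 - s *\<^sub>R e \<in> cell"
proof -
  have pos: "0 < \<epsilon> / \<eta>" using \<epsilon> \<eta> by simp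
  have "x0 - s *\<^sub>R e + 0 \<in> \<Omega>"
    using assms \<epsilon>_small pos by (intro back_in_\<Omega> x0_closure) auto
  moreover have "x0 - s *\<^sub>R e \<in> ball x0 r" using assms e \<epsilon>_small by (simp add: dist_norm)
  moreover have eq: "x0 - s *\<^sub>R e - apex = (\<epsilon> - s) *\<^sub>R e" by (simp add: apex_def algebra_simps)
  have "2 * \<eta> * norm (x0 - s *\<^sub>R e - apex) < (x0 - s *\<^sub>R e - apex) \<bullet> e"
    unfolding eq using assms \<eta> e by (simp add: e_inner)
  ultimately show ?thesis by (simp add: cell_def)
qed

lemma x0_frontier_cell: "x0 \<in> frontier cell"
proof -
  have "(\<lambda>n. x0 - (\<epsilon> / real (Suc (Suc n))) *\<^sub>R e) \<longlonglongrightarrow> x0 - 0 *\<^sub>R e"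
    by (intro tendsto_intros) (intro LIMSEQ_Suc[OF LIMSEQ_Suc[OF lim_const_over_n]])
  moreover have "x0 - (\<epsilon> / real (Suc (Suc n))) *\<^sub>R e \<in> cell" for n
    using \<epsilon> by (intro axis_in_cell) (auto simp: field_simps add_pos_nonneg)
  ultimately have "x0 \<in> closure cell" unfolding closure_sequential
    by (intro exI[of _ "\<lambda>n. x0 - (\<epsilon> / real (Suc (Suc n))) *\<^sub>R e"]) simp
  then show ?thesis using x0_notin cell_subset open_cell by (auto simp: frontier_def interior_open)
qed

lemma cell_segment:
  assumes "x \<in> cell" "0 < s" "s \<le> 1" shows "apex + s *\<^sub>R (x - apex) \<in> cell"
proof (cases "s = 1")
  case True then show ?thesis using assms by simp
next
  case False
  let ?y = "apex + s *\<^sub>R (x - apex)"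
  have x: "x \<in> \<Omega>" "x \<in> ball x0 r" "2 * \<eta> * norm (x - apex) < (x - apex) \<bullet> e"
    using assms by (auto simp: cell_def)
  have "apex \<in> ball x0 r" using e \<epsilon> \<epsilon>_small by (simp add: apex_def dist_norm)
  then have y: "?y \<in> ball x0 r"
    using mem_convex_alt[of "ball x0 r" x apex s "1 - s"] x assms by (simp add: algebra_simps)
  have xy: "x - ?y = (1 - s) *\<^sub>R (x - apex)" by (simp add: algebra_simps)
  have ne: "x \<noteq> apex" using x(3) by auto
  have "0 \<le> \<eta> * norm (x - apex)" using \<eta> by simp
  then have le: "\<eta> * norm (x - apex) \<le> (x - apex) \<bullet> e" using x(3) by linarith
  have "?y \<in> \<Omega>"
  proof (rule cone[of x])
    have "\<eta> * norm (x - ?y) = (1 - s) * (\<eta> * norm (x - apex))" unfolding xy using assms by simp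
    also have "\<dots> \<le> (1 - s) * ((x - apex) \<bullet> e)" using le assms by (intro mult_left_mono) auto
    finally show "\<eta> * norm (x - ?y) \<le> (x - ?y) \<bullet> e" unfolding xy by simp
    show "?y \<noteq> x"
    proof
      assume "?y = x"
      then have "(1 - s) *\<^sub>R (x - apex) = 0" using xy by simp
      then show False using False ne by simp
    qed
    show "x \<in> closure \<Omega>" using x closure_subset by blast
  qed (use x y in auto)
  moreover have "s * (2 * \<eta> * norm (x - apex)) < s * ((x - apex) \<bullet> e)"
    using x(3) assms by (intro mult_strict_left_mono)
  moreover have "?y - apex = s *\<^sub>R (x - apex)" by simp
  ultimately show ?thesis using y assms by (simp add: cell_def mult.left_commute)
qed

text \<open>The cell is a union of half-open segments issuing from the apex, and each of them meets a convex
  part of the cell near the apex.\<close>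

lemma connected_cell: "connected cell"
proof -
  have pos: "0 < \<epsilon> / \<eta>" using \<epsilon> \<eta> by simp
  have "x0 - \<epsilon> *\<^sub>R e + 0 \<in> \<Omega>"
    using \<epsilon> \<epsilon>_small pos by (intro back_in_\<Omega> x0_closure) auto
  then have "apex \<in> \<Omega> \<inter> ball x0 r" using e \<epsilon> \<epsilon>_small by (simp add: apex_def dist_norm)
  then obtain d where d: "d > 0" "ball apex d \<subseteq> \<Omega> \<inter> ball x0 r"
    using open_\<Omega> openE[of "\<Omega> \<inter> ball x0 r"] by blast
  let ?K = "{x. 2 * \<eta> * norm (x - apex) < (x - apex) \<bullet> e}"
  define C where "C = ball apex d \<inter> ?K"
  have C_cell: "C \<subseteq> cell" using d by (auto simp: C_def cell_def)
  have "convex ?K"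
  proof (rule convexI)
    fix x y and u v :: real
    assume x: "x \<in> ?K" and y: "y \<in> ?K" and uv: "0 \<le> u" "0 \<le> v" "u + v = 1"
    have eq: "u *\<^sub>R x + v *\<^sub>R y - apex = u *\<^sub>R (x - apex) + v *\<^sub>R (y - apex)"
      using uv by (simp add: algebra_simps flip: scaleR_add_left)
    have "2 * \<eta> * norm (u *\<^sub>R x + v *\<^sub>R y - apex) \<le> 2 * \<eta> * (u * norm (x - apex) + v * norm (y - apex))"
      unfolding eq using norm_triangle_ineq[of "u *\<^sub>R (x - apex)" "v *\<^sub>R (y - apex)"] \<eta> uv
      by (intro mult_left_mono) auto
    also have "\<dots> = u * (2 * \<eta> * norm (x - apex)) + v * (2 * \<eta> * norm (y - apex))"
      by (simp add: algebra_simps)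
    also have "\<dots> < u * ((x - apex) \<bullet> e) + v * ((y - apex) \<bullet> e)"
    proof (cases "u = 0")
      case False
      then have "u * (2 * \<eta> * norm (x - apex)) < u * ((x - apex) \<bullet> e)"
        using x uv by (intro mult_strict_left_mono) auto
      moreover have "v * (2 * \<eta> * norm (y - apex)) \<le> v * ((y - apex) \<bullet> e)"
        using y uv by (intro mult_left_mono) auto
      ultimately show ?thesis by linarith
    qed (use y uv in auto)
    also have "\<dots> = (u *\<^sub>R x + v *\<^sub>R y - apex) \<bullet> e" unfolding eq by (simp add: inner_add_left)
    finally show "u *\<^sub>R x + v *\<^sub>R y \<in> ?K" by simp
  qed
  then have conC: "connected C" unfolding C_def by (intro convex_connected convex_Int) auto
  define S where "S x = (\<lambda>s. apex + s *\<^sub>R (x - apex)) ` {0<..1::real}" for x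
  have conS: "connected (S x)" for x
    unfolding S_def by (intro connected_continuous_image continuous_intros convex_connected) auto
  have meet: "S x \<inter> C \<noteq> {}" if "x \<in> cell" for x
  proof -
    define s where "s = min 1 (d / (2 * (1 + norm (x - apex))))"
    have s: "0 < s" "s \<le> 1" using d by (auto simp: s_def add_pos_nonneg)
    have "s * norm (x - apex) \<le> d / (2 * (1 + norm (x - apex))) * norm (x - apex)"
      by (intro mult_right_mono) (auto simp: s_def)
    also have "\<dots> < d" using d by (simp add: field_simps add_pos_nonneg)
    finally have "apex + s *\<^sub>R (x - apex) \<in> ball apex d" using s by (simp add: dist_norm)
    moreover have "apex + s *\<^sub>R (x - apex) \<in> ?K" using cell_segment[OF that s] by (simp add: cell_def)
    moreover have "apex + s *\<^sub>R (x - apex) \<in> S x" using s unfolding S_def by (intro imageI) auto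
    ultimately show ?thesis unfolding C_def by blast
  qed
  have "cell = (\<Union>x\<in>cell. C \<union> S x)"
  proof
    have "x \<in> S x" for x
      unfolding S_def by (rule image_eqI[of _ _ 1]) auto
    then show "cell \<subseteq> (\<Union>x\<in>cell. C \<union> S x)" by blast
    have "S x \<subseteq> cell" if "x \<in> cell" for x
      unfolding S_def using cell_segment[OF that] by auto
    then show "(\<Union>x\<in>cell. C \<union> S x) \<subseteq> cell" using C_cell by blast
  qed
  moreover have "connected (\<Union>x\<in>cell. C \<union> S x)"
  proof (rule connected_Union)
    fix s assume "s \<in> (\<lambda>x. C \<union> S x) ` cell"
    then obtain x where "x \<in> cell" "s = C \<union> S x" by blast
    then show "connected s" using connected_Un[OF conC conS, of x] meet[of x] by blast
  next
    obtain x where "x \<in> cell" using axis_in_cell[of "\<epsilon>/2"] \<epsilon> by auto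
    then have "C \<noteq> {}" using meet by blast
    then show "\<Inter> ((\<lambda>x. C \<union> S x) ` cell) \<noteq> {}" by auto
  qed
  ultimately show ?thesis by simp
qed

lemma is_domain_cell: "is_domain cell"
  using open_cell connected_cell axis_in_cell[of "\<epsilon>/2"] \<epsilon> by (auto simp: is_domain_def)

text \<open>The cell is not convex, so the mean value inequality is applied along a detour: back from \<open>x\<close>
  against the normal by \<open>3 |x - y|\<close>, across in parallel to the segment from \<open>x\<close> to \<open>y\<close>, and forward
  to \<open>y\<close>. Its length is \<open>7 |x - y|\<close>.\<close>

lemma cell_lipschitz:
  fixes H :: "'a \<Rightarrow> 'b::real_normed_vector"
  assumes diff: "\<And>x. x \<in> \<Omega> \<Longrightarrow> H differentiable (at x)"
    and bnd: "\<And>x v. x \<in> \<Omega> \<Longrightarrow> norm (frechet_derivative H (at x) v) \<le> B * norm v"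
    and B: "0 \<le> B"
  shows "(7 * B)-lipschitz_on cell H"
proof (rule lipschitz_onI)
  fix x y assume xy: "x \<in> cell" "y \<in> cell"
  show "dist (H x) (H y) \<le> 7 * B * dist x y"
  proof (cases "x = y")
    case True then show ?thesis by simp
  next
    case False
    have seg: "norm (H a - H b) \<le> B * norm (a - b)" if "closed_segment a b \<subseteq> \<Omega>" for a b
    proof (rule differentiable_bound[of "closed_segment a b" H "\<lambda>z. frechet_derivative H (at z)"])
      fix z assume "z \<in> closed_segment a b"
      then have z: "z \<in> \<Omega>" using that by blast
      show "(H has_derivative frechet_derivative H (at z)) (at z within closed_segment a b)"
        by (rule has_derivative_at_withinI[OF frechet_derivative_works[THEN iffD1, OF diff[OF z]]])
      show "onorm (frechet_derivative H (at z)) \<le> B" by (rule onorm_bound[OF B bnd[OF z]])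
    qed auto
    define h where "h = norm (x - y)"
    have h: "0 < h" using False by (simp add: h_def)
    have near: "norm (x - x0) \<le> 2 * (\<epsilon> / \<eta>)" "norm (y - x0) \<le> 2 * (\<epsilon> / \<eta>)"
      using xy cell_near by auto
    have "h \<le> norm (x - x0) + norm (y - x0)"
      using norm_triangle_ineq4[of "x - x0" "y - x0"] by (simp add: h_def)
    then have h_le: "3 * h \<le> 12 * (\<epsilon> / \<eta>)" using near by linarith
    have backward: "closed_segment z (z - (3 * h) *\<^sub>R e) \<subseteq> \<Omega>" if "z \<in> cell" for z
    proof
      fix p assume "p \<in> closed_segment z (z - (3 * h) *\<^sub>R e)"
      then obtain u where u: "0 \<le> u" "u \<le> 1" "p = (1 - u) *\<^sub>R z + u *\<^sub>R (z - (3 * h) *\<^sub>R e)"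
        by (auto simp: closed_segment_def)
      have p: "p = z - (u * (3 * h)) *\<^sub>R e + 0" unfolding u(3) by (simp add: algebra_simps)
      show "p \<in> \<Omega>"
      proof (cases "u = 0")
        case True then show ?thesis using u that cell_subset by auto
      next
        case False
        have "u * (3 * h) \<le> 1 * (3 * h)" using u h by (intro mult_right_mono) auto
        then have "u * (3 * h) \<le> 12 * (\<epsilon> / \<eta>)" using h_le by linarith
        moreover have "z \<in> closure \<Omega>" using that cell_subset closure_subset by blast
        ultimately show ?thesis unfolding p using u h False cell_near[OF that]
          by (intro back_in_\<Omega>) auto
      qed
    qed
    have across: "closed_segment (x - (3 * h) *\<^sub>R e) (y - (3 * h) *\<^sub>R e) \<subseteq> \<Omega>"
    proof
      fix p assume "p \<in> closed_segment (x - (3 * h) *\<^sub>R e) (y - (3 * h) *\<^sub>R e)"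
      then obtain u where u: "0 \<le> u" "u \<le> 1"
        "p = (1 - u) *\<^sub>R (x - (3 * h) *\<^sub>R e) + u *\<^sub>R (y - (3 * h) *\<^sub>R e)"
        by (auto simp: closed_segment_def)
      have p: "p = x - (3 * h) *\<^sub>R e + u *\<^sub>R (y - x)" unfolding u(3) by (simp add: algebra_simps)
      have "norm (u *\<^sub>R (y - x)) \<le> 1 * h"
        unfolding norm_scaleR h_def using u by (intro mult_mono) (auto simp: norm_minus_commute)
      moreover have "x \<in> closure \<Omega>" using xy cell_subset closure_subset by blast
      ultimately show "p \<in> \<Omega>" unfolding p using h h_le near by (intro back_in_\<Omega>) auto
    qed
    let ?x = "x - (3 * h) *\<^sub>R e" and ?y = "y - (3 * h) *\<^sub>R e"
    have "norm (H x - H ?x) \<le> B * (3 * h)" "norm (H y - H ?y) \<le> B * (3 * h)"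
      using seg[OF backward[OF xy(1)]] seg[OF backward[OF xy(2)]] h e by auto
    moreover have "norm (H ?x - H ?y) \<le> B * h"
      using seg[OF across] by (simp add: h_def)
    moreover have "norm (H x - H y) \<le> norm (H x - H ?x) + norm (H ?x - H ?y) + norm (H y - H ?y)"
      using norm_triangle_ineq4[of "(H x - H ?x) + (H ?x - H ?y)" "H y - H ?y"]
        norm_triangle_ineq[of "H x - H ?x" "H ?x - H ?y"] by simp
    ultimately have "norm (H x - H y) \<le> 7 * B * h" by (simp add: algebra_simps)
    then show ?thesis by (simp add: dist_norm h_def)
  qed
qed (use B in simp)

end

section \<open>The flow out of the cell\<close>

text \<open>The mean value theorem for the component along \<open>w\<close>.\<close>

lemma inner_increment_ge:
  fixes f :: "real \<Rightarrow> 'a::real_inner"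
  assumes f: "\<And>t. t \<in> {0..b} \<Longrightarrow> (f has_vector_derivative f' t) (at t within {0..b})"
    and "0 \<le> b" and k: "\<And>t. 0 \<le> t \<Longrightarrow> t < b \<Longrightarrow> k \<le> f' t \<bullet> w"
  shows "k * b \<le> (f b - f 0) \<bullet> w"
proof (cases "b = 0")
  case False
  then have "0 < b" using assms(2) by simp
  have "((\<lambda>t. f t \<bullet> w) has_derivative (\<lambda>h. h * (f' t \<bullet> w))) (at t within {0..b})"
    if "0 \<le> t" "t \<le> b" for t
  proof -
    have "(f has_derivative (\<lambda>h. h *\<^sub>R f' t)) (at t within {0..b})"
      using f[of t] that by (simp add: has_vector_derivative_def)
    from has_derivative_inner_left[OF this, of w] show ?thesis by simp
  qed
  from mvt_simple[OF \<open>0 < b\<close> this] obtain t where "t \<in> {0<..<b}"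
    "f b \<bullet> w - f 0 \<bullet> w = (b - 0) * (f' t \<bullet> w)" by blast
  then show ?thesis using k[of t] \<open>0 < b\<close> by (simp add: inner_diff_left)
qed simp

lemma inner_sgn_self: "x \<bullet> sgn x = norm (x :: 'a::real_inner)"
  by (cases "x = 0") (simp_all add: sgn_div_norm power2_norm_eq_inner[symmetric] power2_eq_square)

text \<open>A field that crosses the cell in the direction of the cone: \<open>G x \<bullet> e \<ge> c \<ge> 2 \<eta> |G x|\<close> there. The
  time \<open>b\<close> is long enough to cross the cell with speed \<open>c\<close> and short enough for the contraction argument.\<close>

locale outflow = boundary_cone +
  fixes G :: "'a \<Rightarrow> 'a" and L c K b :: real
  assumes lip: "L-lipschitz_on UNIV G" and b: "0 < b" "L * b \<le> 1/2"
    and speed: "\<And>x. x \<in> cell \<Longrightarrow> norm (G x) \<le> K"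
    and drift: "\<And>x. x \<in> cell \<Longrightarrow> c \<le> G x \<bullet> e"
    and c: "0 < c" "2 * \<eta> * K \<le> c" "4 * (\<epsilon> / \<eta>) < c * b"
begin

definition flow :: "'a \<Rightarrow> real \<Rightarrow> 'a" where
  "flow x = (SOME X. continuous_on UNIV X \<and> X 0 = x \<and>
     (\<forall>t\<in>{0..b}. (X has_vector_derivative G (X t)) (at t within {0..b})))"

lemma flow: "continuous_on UNIV (flow x)" "flow x 0 = x"
  "\<And>t. t \<in> {0..b} \<Longrightarrow> (flow x has_vector_derivative G (flow x t)) (at t within {0..b})"
proof -
  have "\<exists>X. continuous_on UNIV X \<and> X 0 = x \<and>
     (\<forall>t\<in>{0..b}. (X has_vector_derivative G (X t)) (at t within {0..b}))"
  proof (rule lipschitz_integral_curve[OF lip _ b(2), of x])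
    show "0 \<le> b" using b by simp
  qed blast
  then have "continuous_on UNIV (flow x) \<and> flow x 0 = x \<and>
     (\<forall>t\<in>{0..b}. (flow x has_vector_derivative G (flow x t)) (at t within {0..b}))"
    unfolding flow_def by (rule someI_ex)
  then show "continuous_on UNIV (flow x)" "flow x 0 = x"
    "\<And>t. t \<in> {0..b} \<Longrightarrow> (flow x has_vector_derivative G (flow x t)) (at t within {0..b})"
    by auto
qed

lemma flow_within:
  assumes "0 \<le> t" "t \<le> d" "d \<le> b"
  shows "(flow x has_vector_derivative G (flow x t)) (at t within {0..d})"
  by (rule has_vector_derivative_within_subset[OF flow(3)]) (use assms in auto)

lemma flow_stable: "t \<in> {0..b} \<Longrightarrow> dist (flow x t) (flow y t) \<le> 2 * dist x y"
  using integral_curves_gap[OF lip b(2) flow(3) flow(3), where s=t and t=0] b by (simp add: flow(2))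

lemma continuous_on_flow: "continuous_on (UNIV \<times> {0..b}) (\<lambda>z. flow (fst z) (snd z))"
  unfolding continuous_on_def
proof
  fix w assume w: "w \<in> (UNIV :: 'a set) \<times> {0..b}"
  let ?F = "at w within UNIV \<times> {0..b}"
  show "((\<lambda>z. flow (fst z) (snd z)) \<longlongrightarrow> flow (fst w) (snd w)) ?F"
    unfolding tendsto_dist_iff[of _ "flow (fst w) (snd w)"]
  proof (rule tendsto_sandwich)
    show "\<forall>\<^sub>F z in ?F. 0 \<le> dist (flow (fst z) (snd z)) (flow (fst w) (snd w))" by simp
    have "\<forall>\<^sub>F z in ?F. z \<in> UNIV \<times> {0..b}" by (simp add: eventually_at_filter)
    then show "\<forall>\<^sub>F z in ?F. dist (flow (fst z) (snd z)) (flow (fst w) (snd w)) \<le>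
        2 * dist (fst z) (fst w) + dist (flow (fst w) (snd z)) (flow (fst w) (snd w))"
    proof (eventually_elim)
      case (elim z)
      then have "dist (flow (fst z) (snd z)) (flow (fst w) (snd z)) \<le> 2 * dist (fst z) (fst w)"
        by (intro flow_stable) auto
      then show ?case using dist_triangle[of "flow (fst z) (snd z)" "flow (fst w) (snd w)" "flow (fst w) (snd z)"]
        by linarith
    qed
    have "isCont (flow (fst w)) (snd w)" using flow(1) by (simp add: continuous_on_eq_continuous_at)
    then have "((\<lambda>z. flow (fst w) (snd z)) \<longlongrightarrow> flow (fst w) (snd w)) ?F"
      by (rule isCont_tendsto_compose) (intro tendsto_intros)
    then have "((\<lambda>z. 2 * dist (fst z) (fst w) + dist (flow (fst w) (snd z)) (flow (fst w) (snd w))) \<longlongrightarrow>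
      2 * dist (fst w) (fst w) + dist (flow (fst w) (snd w)) (flow (fst w) (snd w))) ?F"
      by (intro tendsto_intros)
    then show "((\<lambda>z. 2 * dist (fst z) (fst w) + dist (flow (fst w) (snd z)) (flow (fst w) (snd w))) \<longlongrightarrow> 0) ?F"
      by simp
  qed simp
qed

definition exit_time :: "'a \<Rightarrow> real" where
  "exit_time x = Inf {t \<in> {0..b}. flow x t \<notin> cell}"

definition exit_point :: "'a \<Rightarrow> 'a" where
  "exit_point x = flow x (exit_time x)"

text \<open>The component along \<open>e\<close> would grow by \<open>c b\<close>, more than the diameter of the cell allows.\<close>

lemma exits: assumes "x \<in> cell" shows "\<exists>t\<in>{0..<b}. flow x t \<notin> cell"
proof (rule ccontr)
  assume "\<not> ?thesis"
  then have inside: "flow x t \<in> cell" if "0 \<le> t" "t < b" for t using that by auto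
  have "c * b \<le> (flow x b - flow x 0) \<bullet> e"
    using b inside drift by (intro inner_increment_ge[of b "flow x" "\<lambda>t. G (flow x t)"] flow(3)) auto
  also have "\<dots> = (flow x b - x) \<bullet> e" by (simp add: flow)
  also have "\<dots> \<le> norm (flow x b - x)" using norm_cauchy_schwarz[of "flow x b - x" e] e by simp
  also have "\<dots> \<le> norm (flow x b - x0) + norm (x - x0)"
    using norm_triangle_ineq4[of "flow x b - x0" "x - x0"] by simp
  also have "\<dots> \<le> 2 * (\<epsilon> / \<eta>) + 2 * (\<epsilon> / \<eta>)"
  proof (rule add_mono[OF closure_cell_near cell_near[OF assms]])
    have "((\<lambda>t. flow x t) \<longlongrightarrow> flow x b) (at_left b)"
      using flow(1)[of x] by (auto simp: continuous_on_eq_continuous_at isCont_def intro: tendsto_mono[OF at_le])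
    moreover have "\<forall>\<^sub>F t in at_left b. flow x t \<in> closure cell"
      using eventually_at_left_real[OF b(1)]
      by eventually_elim (use inside closure_subset[of cell] in auto)
    ultimately show "flow x b \<in> closure cell"
      by (intro Lim_in_closed_set[of "closure cell"]) (auto simp: trivial_limit_at_left_real)
  qed
  finally show False using c by linarith
qed

lemma exit_time:
  assumes x: "x \<in> cell"
  shows "0 < exit_time x" "exit_time x < b" "exit_point x \<notin> cell"
    "\<And>t. 0 \<le> t \<Longrightarrow> t < exit_time x \<Longrightarrow> flow x t \<in> cell"
proof -
  let ?S = "{t \<in> {0..b}. flow x t \<notin> cell}"
  have "?S = {0..b} \<inter> flow x -` (- cell)" by auto
  moreover have "closed ({0..b} \<inter> flow x -` (- cell))"
    using open_cell by (intro continuous_closed_preimage continuous_on_subset[OF flow(1)]) auto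
  ultimately have "closed ?S" by simp
  moreover have bdd: "bdd_below ?S" by (intro bdd_belowI[of _ 0]) auto
  moreover obtain t0 where t0: "t0 \<in> ?S" "t0 < b" using exits[OF x] by auto
  ultimately have "exit_time x \<in> ?S" unfolding exit_time_def
    using closed_contains_Inf[of ?S] by blast
  then have mem: "0 \<le> exit_time x" "exit_time x \<le> b" "exit_point x \<notin> cell" by (auto simp: exit_point_def)
  show "exit_point x \<notin> cell" by fact
  have "exit_time x \<noteq> 0" using mem x by (auto simp: exit_point_def flow)
  then show "0 < exit_time x" using mem by simp
  have "exit_time x \<le> t0" unfolding exit_time_def using t0 bdd by (intro cInf_lower)
  then show "exit_time x < b" using t0 by simp
  fix t assume t: "0 \<le> t" "t < exit_time x"
  show "flow x t \<in> cell"
  proof (rule ccontr)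
    assume "flow x t \<notin> cell"
    then have "exit_time x \<le> t" unfolding exit_time_def using t mem bdd by (intro cInf_lower) auto
    then show False using t by simp
  qed
qed

lemma flow_speed:
  assumes x: "x \<in> cell" and "0 \<le> s" "s \<le> exit_time x"
  shows "dist x (flow x s) \<le> K * s"
proof -
  let ?w = "- sgn (flow x s - x)"
  have "(- K) * s \<le> (flow x s - flow x 0) \<bullet> ?w"
  proof (rule inner_increment_ge[of s "flow x" "\<lambda>t. G (flow x t)"])
    show "(flow x has_vector_derivative G (flow x t)) (at t within {0..s})" if "t \<in> {0..s}" for t
      using that assms exit_time(2)[OF x] by (intro flow_within) auto
    fix t assume "0 \<le> t" "t < s"
    then have "flow x t \<in> cell" using exit_time(4)[OF x, of t] assms by auto
    then have "norm (G (flow x t)) \<le> K" by (rule speed)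
    moreover have "norm (G (flow x t)) * norm ?w \<le> norm (G (flow x t)) * 1"
      by (intro mult_left_mono) (auto simp: norm_sgn)
    ultimately show "- K \<le> G (flow x t) \<bullet> ?w"
      using Cauchy_Schwarz_ineq2[of "G (flow x t)" ?w] by linarith
  qed (use assms in simp)
  also have "(flow x s - flow x 0) \<bullet> ?w = - norm (flow x s - x)"
    by (simp add: flow inner_sgn_self)
  finally show ?thesis by (simp add: dist_norm norm_minus_commute)
qed

lemma exit_point_closure: assumes x: "x \<in> cell" shows "exit_point x \<in> closure cell"
proof -
  let ?t = "exit_time x"
  have "isCont (flow x) ?t" using flow(1) by (simp add: continuous_on_eq_continuous_at)
  then have "(flow x \<longlongrightarrow> flow x ?t) (at_left ?t)"
    unfolding isCont_def by (rule tendsto_mono[OF at_le, rotated]) simp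
  moreover have "\<forall>\<^sub>F t in at_left ?t. flow x t \<in> closure cell"
    using eventually_at_left_real[OF exit_time(1)[OF x]]
    by eventually_elim (use exit_time(4)[OF x] closure_subset[of cell] in auto)
  ultimately show ?thesis unfolding exit_point_def
    by (intro Lim_in_closed_set[of "closure cell"]) (auto simp: trivial_limit_at_left_real)
qed

text \<open>The displacement along an integral curve stays in the cone of the field, so the exit point lies
  in the open cone with tip \<open>apex\<close>; it is also inside the ball. The only part of the boundary of the cell
  that is left lies in the boundary of \<open>\<Omega>\<close>.\<close>

lemma exit_point_frontier: assumes x: "x \<in> cell" shows "exit_point x \<in> frontier \<Omega>"
proof -
  let ?p = "exit_point x" and ?t = "exit_time x"
  let ?w = "e - (2 * \<eta>) *\<^sub>R sgn (?p - x)"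
  have "0 * ?t \<le> (flow x ?t - flow x 0) \<bullet> ?w"
  proof (rule inner_increment_ge[of ?t "flow x" "\<lambda>t. G (flow x t)"])
    show "(flow x has_vector_derivative G (flow x t)) (at t within {0..?t})" if "t \<in> {0..?t}" for t
      using that exit_time[OF x] by (intro flow_within) auto
    fix t assume "0 \<le> t" "t < ?t"
    then have t: "flow x t \<in> cell" using exit_time(4)[OF x, of t] by auto
    have "G (flow x t) \<bullet> sgn (?p - x) \<le> norm (G (flow x t)) * norm (sgn (?p - x))"
      by (rule norm_cauchy_schwarz)
    also have "\<dots> \<le> K * 1" using speed[OF t] by (intro mult_mono) (auto simp: norm_sgn intro: order_trans[OF norm_ge_zero])
    finally have "2 * \<eta> * (G (flow x t) \<bullet> sgn (?p - x)) \<le> 2 * \<eta> * K" using \<eta> by simp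
    with drift[OF t] c show "0 \<le> G (flow x t) \<bullet> ?w" by (simp add: inner_diff_right)
  qed (use exit_time[OF x] in simp)
  also have "(flow x ?t - flow x 0) \<bullet> ?w = (?p - x) \<bullet> e - 2 * \<eta> * norm (?p - x)"
    by (simp add: flow exit_point_def inner_diff_right inner_sgn_self)
  finally have "2 * \<eta> * norm (?p - x) \<le> (?p - x) \<bullet> e" by simp
  moreover have "2 * \<eta> * norm (x - apex) < (x - apex) \<bullet> e" using x by (simp add: cell_def)
  moreover have "2 * \<eta> * norm (?p - apex) \<le> 2 * \<eta> * (norm (?p - x) + norm (x - apex))"
    using \<eta> norm_triangle_ineq[of "?p - x" "x - apex"] by (intro mult_left_mono) auto
  moreover have "(?p - apex) \<bullet> e = (?p - x) \<bullet> e + (x - apex) \<bullet> e"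
    by (simp add: inner_diff_left)
  ultimately have "2 * \<eta> * norm (?p - apex) < (?p - apex) \<bullet> e" by (simp add: algebra_simps)
  moreover have "?p \<in> ball x0 r" using exit_point_closure[OF x] closure_cell_ball by blast
  ultimately have "?p \<notin> \<Omega>" using exit_time(3)[OF x] by (auto simp: cell_def)
  moreover have "?p \<in> closure \<Omega>" using exit_point_closure[OF x] closure_mono[OF cell_subset] by blast
  ultimately show ?thesis using open_\<Omega> by (simp add: frontier_def interior_open)
qed

text \<open>The map \<open>x \<mapsto> (exit_point x, exit_time x)\<close> has a Lipschitz inverse. For different exit
  times the later curve is first followed for the time difference, at speed at most \<open>K\<close>; from then on both
  curves reach the boundary simultaneously and are compared backwards in time.\<close>

lemma exit_separation:
  assumes "x \<in> cell" "y \<in> cell"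
  shows "dist x y \<le> 2 * dist (exit_point x) (exit_point y) + K * \<bar>exit_time x - exit_time y\<bar>"
  using assms
proof (induction "exit_time x" "exit_time y" arbitrary: x y rule: linorder_wlog)
  case sym
  then show ?case using dist_commute abs_minus_commute by metis
next
  case le
  define d where "d = exit_time y - exit_time x"
  let ?b = "exit_time x"
  have d: "0 \<le> d" and b': "?b \<in> {0..b}" "L * ?b \<le> 1/2" "d + ?b \<le> b"
  proof -
    show "0 \<le> d" using le by (simp add: d_def)
    show "?b \<in> {0..b}" "d + ?b \<le> b" using exit_time[OF le(2)] exit_time[OF le(3)] by (auto simp: d_def)
    then have "L * ?b \<le> L * b" using lipschitz_on_nonneg[OF lip] by (intro mult_left_mono) auto
    then show "L * ?b \<le> 1/2" using b by simp
  qed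
  have shift: "((\<lambda>t. flow y (d + t)) has_vector_derivative G (flow y (d + t))) (at t within {0..?b})"
    if "t \<in> {0..?b}" for t
  proof -
    have "((\<lambda>t. d + t) has_vector_derivative 1) (at t within {0..?b})"
      by (auto intro!: derivative_eq_intros)
    moreover have "(flow y has_vector_derivative G (flow y (d + t))) (at (d + t) within (\<lambda>t. d + t) ` {0..?b})"
      by (rule has_vector_derivative_within_subset[OF flow(3)]) (use that d b' in auto)
    ultimately show ?thesis
      using vector_diff_chain_within[of "\<lambda>t. d + t" 1 t "{0..?b}" "flow y" "G (flow y (d + t))"]
      by (simp add: o_def)
  qed
  have "dist (flow x 0) (flow y (d + 0)) \<le> 2 * dist (flow x ?b) (flow y (d + ?b))"
    by (rule integral_curves_gap[OF lip b'(2) _ shift]) (use b' in \<open>auto intro: flow_within\<close>)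
  then have "dist x (flow y d) \<le> 2 * dist (exit_point x) (exit_point y)"
    by (simp add: flow exit_point_def d_def)
  moreover have "dist y (flow y d) \<le> K * d"
    using le d exit_time[OF le(2)] by (intro flow_speed) (auto simp: d_def)
  ultimately have "dist x y \<le> 2 * dist (exit_point x) (exit_point y) + K * d"
    using dist_triangle2[of x y "flow y d"] by linarith
  then show ?case using d by (simp add: d_def)
qed

text \<open>The exit time is lower semicontinuous: a curve that stays in the open cell up to time \<open>t\<close> keeps
  a positive distance from its complement, and neighbouring curves stay close.\<close>

lemma exit_time_measurable: "exit_time \<in> borel_measurable (restrict_space borel cell)"
  unfolding borel_measurable_iff_greater
proof
  fix a
  have "open {x \<in> cell. a < exit_time x}"
    unfolding open_contains_ball
  proof
    fix x assume "x \<in> {x \<in> cell. a < exit_time x}"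
    then have x: "x \<in> cell" and a: "a < exit_time x" by auto
    define t where "t = max a 0"
    have t: "0 \<le> t" "t < exit_time x" "t \<le> b" using a exit_time[OF x] by (auto simp: t_def)
    have "compact (flow x ` {0..t})"
      by (intro compact_continuous_image continuous_on_subset[OF flow(1)]) auto
    moreover have "flow x ` {0..t} \<subseteq> cell" using exit_time(4)[OF x] t by auto
    ultimately obtain d where d: "d > 0" "(\<Union>p\<in>flow x ` {0..t}. ball p d) \<subseteq> cell"
      using compact_subset_open_imp_ball_epsilon_subset open_cell by metis
    have "ball x (d/2) \<subseteq> {x \<in> cell. a < exit_time x}"
    proof
      fix y assume "y \<in> ball x (d/2)"
      then have near: "2 * dist x y < d" by simp
      have in_cell: "flow y s \<in> cell" if "s \<in> {0..t}" for s
      proof -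
        have "dist (flow x s) (flow y s) \<le> 2 * dist x y" using that t by (intro flow_stable) auto
        then have "flow y s \<in> ball (flow x s) d" using near by simp
        then show ?thesis using d(2) that by blast
      qed
      from in_cell[of 0] have y: "y \<in> cell" using t by (simp add: flow)
      have "t < exit_time y"
      proof (rule ccontr)
        assume "\<not> t < exit_time y"
        then have "flow y (exit_time y) \<in> cell" using exit_time(1)[OF y] by (intro in_cell) auto
        then show False using exit_time(3)[OF y] by (simp add: exit_point_def)
      qed
      then show "y \<in> {x \<in> cell. a < exit_time x}" using y by (auto simp: t_def)
    qed
    then show "\<exists>e>0. ball x e \<subseteq> {x \<in> cell. a < exit_time x}" using d(1) by (intro exI[of _ "d/2"]) auto
  qed
  then show "{w \<in> space (restrict_space borel cell). a < exit_time w} \<in> sets (restrict_space borel cell)"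
    using open_cell by (auto simp: sets_restrict_space_iff space_restrict_space)
qed

lemma exit_point_measurable: "exit_point \<in> borel_measurable (restrict_space borel cell)"
proof -
  have id: "(\<lambda>x. x) \<in> borel_measurable (restrict_space borel cell)"
    by (rule measurable_restrict_space1) simp
  have "(\<lambda>x. (x, exit_time x)) \<in> measurable (restrict_space borel cell) (restrict_space borel (UNIV \<times> {0..b}))"
  proof (rule measurable_restrict_space2)
    show "(\<lambda>x. (x, exit_time x)) \<in> space (restrict_space borel cell) \<rightarrow> UNIV \<times> {0..b}"
      using exit_time(1,2) by (fastforce simp: space_restrict_space intro: less_imp_le)
    show "(\<lambda>x. (x, exit_time x)) \<in> borel_measurable (restrict_space borel cell)"
      by (intro borel_measurable_Pair id exit_time_measurable)
  qed
  from measurable_compose[OF this borel_measurable_continuous_on_restrict[OF continuous_on_flow]]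
  show ?thesis by (simp add: exit_point_def[abs_def])
qed

end

section \<open>Volume compared with surface measure and time\<close>

lemma sets_surface_measure: "sets (surface_measure \<Gamma>) = sets (restrict_space borel \<Gamma>)"
  unfolding surface_measure_def by (intro sets_restrict_space_cong sets_hausdorff_measure)

lemma space_surface_measure: "space (surface_measure \<Gamma>) = \<Gamma>"
  using sets_eq_imp_space_eq[OF sets_surface_measure] by (simp add: space_restrict_space)

lemma emeasure_surface_measure:
  fixes \<Gamma> :: "(real^'n) set"
  assumes "\<Gamma> \<in> sets borel" "A \<in> sets borel" "A \<subseteq> \<Gamma>"
  shows "emeasure (surface_measure \<Gamma>) A = hausdorff_outer (CARD('n) - 1) A"
  unfolding surface_measure_def
  using assms by (subst emeasure_restrict_space) (auto simp: sets_hausdorff_measure emeasure_hausdorff_measure)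

lemma lateral_measurable:
  fixes F :: "(real^'n) \<times> real \<Rightarrow> real"
  assumes F: "continuous_on (S \<times> {0..T}) F" and S: "\<Gamma> \<subseteq> S"
  shows "F \<in> borel_measurable (surface_measure \<Gamma> \<Otimes>\<^sub>M restrict_space lborel {0<..<T})"
proof -
  let ?N = "restrict_space lborel {0<..<T} :: real measure"
  let ?R = "restrict_space borel \<Gamma> \<Otimes>\<^sub>M restrict_space borel {0<..<T} :: ((real^'n) \<times> real) measure"
    have "sets (surface_measure \<Gamma> \<Otimes>\<^sub>M ?N) = sets ?R"
      by (intro sets_pair_measure_cong sets_surface_measure sets_restrict_space_cong) simp
    moreover have "F \<in> borel_measurable ?R"
    proof -
      have "(\<lambda>z. (fst z, snd z)) \<in> measurable ?R
          (restrict_space borel (\<Gamma> \<times> {0<..<T}))"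
      proof (rule measurable_restrict_space2)
        show "(\<lambda>z. (fst z, snd z)) \<in> space ?R \<rightarrow> \<Gamma> \<times> {0<..<T}"
          by (auto simp: space_pair_measure space_restrict_space)
        have "fst \<in> borel_measurable ?R"
          by (rule measurable_compose[OF measurable_fst]) (simp add: measurable_restrict_space1)
        moreover have "snd \<in> borel_measurable ?R"
          by (rule measurable_compose[OF measurable_snd]) (simp add: measurable_restrict_space1)
        ultimately show "(\<lambda>z. (fst z, snd z)) \<in> borel_measurable ?R"
          by (rule borel_measurable_Pair)
      qed
      moreover have "F \<in> borel_measurable (restrict_space borel (\<Gamma> \<times> {0<..<T}))"
        using S by (intro borel_measurable_continuous_on_restrict continuous_on_subset[OF F]) auto
      ultimately show ?thesis using measurable_compose by fastforce
    qed
    ultimately show ?thesis by (simp cong: measurable_cong_sets)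
qed

lemma grid_index:
  fixes s :: real
  assumes "0 < s" "s \<le> real N"
  obtains k where "k < N" "real k < s" "s \<le> real (Suc k)"
proof (rule that)
  have ce: "real_of_int \<lceil>s\<rceil> - 1 < s" "s \<le> real_of_int \<lceil>s\<rceil>" using ceiling_correct[of s] by auto
  have "1 \<le> \<lceil>s\<rceil>" using assms(1) by linarith
  then show k: "real (nat (\<lceil>s\<rceil> - 1)) < s" "s \<le> real (Suc (nat (\<lceil>s\<rceil> - 1)))" using ce by auto
  then have "real (nat (\<lceil>s\<rceil> - 1)) < real N" using assms by linarith
  then show "nat (\<lceil>s\<rceil> - 1) < N" by simp
qed

text \<open>\<open>tube_const n K * d ^ n\<close> is the volume of a ball of radius \<open>(2 + K) d\<close> in \<open>n\<close> dimensions.\<close>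

definition tube_const :: "nat \<Rightarrow> real \<Rightarrow> real" where
  "tube_const n K = unit_ball_vol (real n) * (2 + K) ^ n"

lemma tube_const_nonneg: "0 \<le> K \<Longrightarrow> 0 \<le> tube_const n K"
  unfolding tube_const_def by simp

text \<open>The density of the volume of \<open>D\<close>, seen through the exit point and the exit time, with respect
  to surface measure times time is at most this constant.\<close>

definition flux_const :: "nat \<Rightarrow> real \<Rightarrow> real" where
  "flux_const n K = 2 * (1 + tube_const n K) * 2 ^ (n - 1) / unit_ball_vol (real (n - 1))"

lemma flux_const_pos: "0 \<le> K \<Longrightarrow> 0 < flux_const n K"
  using tube_const_nonneg[of K n]
  by (auto simp: flux_const_def intro!: divide_pos_pos mult_pos_pos add_pos_nonneg unit_ball_vol_pos)

text \<open>The measure theoretic abstract of the flow out of the cell: points of \<open>D\<close> are parametrised by a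
  boundary point and a time, with Lipschitz dependence on both.\<close>

locale separated_exit =
  fixes D \<Gamma> :: "(real^'n) set" and P :: "real^'n \<Rightarrow> real^'n" and \<tau> :: "real^'n \<Rightarrow> real" and K :: real
  assumes D: "D \<in> sets borel" "emeasure lborel D < \<infinity>" and \<Gamma>: "\<Gamma> \<in> sets borel"
    and P: "P \<in> borel_measurable (restrict_space borel D)" "\<And>x. x \<in> D \<Longrightarrow> P x \<in> \<Gamma>"
    and \<tau>: "\<tau> \<in> borel_measurable (restrict_space borel D)"
    and sep: "\<And>x y. x \<in> D \<Longrightarrow> y \<in> D \<Longrightarrow> dist x y \<le> 2 * dist (P x) (P y) + K * \<bar>\<tau> x - \<tau> y\<bar>"
    and K: "0 \<le> K"
begin

definition tube :: "(real^'n) set \<Rightarrow> real \<Rightarrow> real \<Rightarrow> (real^'n) set" where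
  "tube A \<alpha> \<beta> = {x \<in> D. P x \<in> A \<and> \<alpha> < \<tau> x \<and> \<tau> x \<le> \<beta>}"

lemma tube_measurable: assumes "A \<in> sets borel" shows "tube A \<alpha> \<beta> \<in> sets borel"
proof -
  have "P -` A \<inter> space (restrict_space borel D) \<inter> (\<tau> -` {\<alpha><..\<beta>} \<inter> space (restrict_space borel D))
      \<in> sets (restrict_space borel D)"
    using P(1) \<tau> assms by (intro sets.Int measurable_sets[of _ _ borel]) auto
  moreover have "P -` A \<inter> space (restrict_space borel D) \<inter> (\<tau> -` {\<alpha><..\<beta>} \<inter> space (restrict_space borel D)) = tube A \<alpha> \<beta>"
    by (auto simp: tube_def space_restrict_space)
  ultimately show ?thesis using D by (simp add: sets_restrict_space_iff)
qed

lemma short_tube: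
  assumes A: "A \<in> sets borel" "bounded A" "diameter A \<le> d" "0 < d" and "\<beta> - \<alpha> \<le> d"
  shows "emeasure lborel (tube A \<alpha> \<beta>) \<le> ennreal (unit_ball_vol (real CARD('n)) * ((2 + K) * d) ^ CARD('n))"
proof (cases "tube A \<alpha> \<beta> = {}")
  case False
  then obtain x where x: "x \<in> tube A \<alpha> \<beta>" by blast
  have "tube A \<alpha> \<beta> \<subseteq> cball x ((2 + K) * d)"
  proof
    fix y assume y: "y \<in> tube A \<alpha> \<beta>"
    have "dist (P x) (P y) \<le> d"
      using diameter_bounded_bound[OF A(2), of "P x" "P y"] x y A(3) by (auto simp: tube_def)
    moreover have "\<bar>\<tau> x - \<tau> y\<bar> \<le> d" using x y assms(5) by (auto simp: tube_def)
    then have "K * \<bar>\<tau> x - \<tau> y\<bar> \<le> K * d" using K by (intro mult_left_mono)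
    ultimately have "dist x y \<le> 2 * d + K * d"
      using sep[of x y] x y by (auto simp: tube_def)
    then show "y \<in> cball x ((2 + K) * d)" by (simp add: algebra_simps)
  qed
  then have "emeasure lborel (tube A \<alpha> \<beta>) \<le> emeasure lborel (cball x ((2 + K) * d))"
    by (intro emeasure_mono) auto
  also have "\<dots> = ennreal (unit_ball_vol (real CARD('n)) * ((2 + K) * d) ^ CARD('n))"
    using K assms by (subst emeasure_cball) auto
  finally show ?thesis .
qed simp

text \<open>The time interval is cut into pieces of length \<open>d\<close>; each contributes a set of diameter at most \<open>(2 + K) d\<close>.\<close>

lemma tube_le:
  assumes A: "A \<in> sets borel" "bounded A" "diameter A \<le> d" "0 < d" and "\<alpha> \<le> \<beta>"
  shows "emeasure lborel (tube A \<alpha> \<beta>) \<le> ennreal (tube_const CARD('n) K * (\<beta> - \<alpha> + d) * d ^ (CARD('n) - 1))"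
proof -
  define N where "N = nat \<lceil>(\<beta> - \<alpha>) / d\<rceil>"
  have N: "real N \<le> (\<beta> - \<alpha>) / d + 1" "(\<beta> - \<alpha>) / d \<le> real N"
    using assms unfolding N_def by (auto simp: of_nat_nat ceiling_correct less_imp_le intro: real_nat_ceiling_ge)
  have "tube A \<alpha> \<beta> \<subseteq> (\<Union>k<N. tube A (\<alpha> + real k * d) (\<alpha> + real (Suc k) * d))"
  proof
    fix x assume x: "x \<in> tube A \<alpha> \<beta>"
    define s where "s = (\<tau> x - \<alpha>) / d"
    have s: "0 < s" "s \<le> real N" using x N(2) A(4)
      by (auto simp: s_def tube_def intro: order_trans[OF divide_right_mono N(2)])
    obtain k where k: "k < N" "real k < s" "s \<le> real (Suc k)" using grid_index[OF s] by blast
    note k(1)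
    moreover have "x \<in> tube A (\<alpha> + real k * d) (\<alpha> + real (Suc k) * d)"
      using x k A(4) by (auto simp: tube_def s_def field_simps)
    ultimately show "x \<in> (\<Union>k<N. tube A (\<alpha> + real k * d) (\<alpha> + real (Suc k) * d))" by blast
  qed
  then have "emeasure lborel (tube A \<alpha> \<beta>) \<le>
      emeasure lborel (\<Union>k<N. tube A (\<alpha> + real k * d) (\<alpha> + real (Suc k) * d))"
    using tube_measurable[OF A(1)] by (intro emeasure_mono) auto
  also have "\<dots> \<le> (\<Sum>k<N. emeasure lborel (tube A (\<alpha> + real k * d) (\<alpha> + real (Suc k) * d)))"
    using tube_measurable[OF A(1)] by (intro emeasure_subadditive_finite) auto
  also have "\<dots> \<le> (\<Sum>k<N. ennreal (unit_ball_vol (real CARD('n)) * ((2 + K) * d) ^ CARD('n)))"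
    using A by (intro sum_mono short_tube) (auto simp: algebra_simps)
  also have "\<dots> = ennreal (real N * (unit_ball_vol (real CARD('n)) * ((2 + K) * d) ^ CARD('n)))"
    using A K by (simp add: ennreal_mult ennreal_of_nat_eq_real_of_nat)
  also have "\<dots> \<le> ennreal (tube_const CARD('n) K * (\<beta> - \<alpha> + d) * d ^ (CARD('n) - 1))"
  proof (rule ennreal_leI)
    have "real N * (unit_ball_vol (real CARD('n)) * ((2 + K) * d) ^ CARD('n)) \<le>
        ((\<beta> - \<alpha>) / d + 1) * (unit_ball_vol (real CARD('n)) * ((2 + K) * d) ^ CARD('n))"
      using N A K by (intro mult_right_mono) auto
    also have "d ^ CARD('n) = d ^ Suc (CARD('n) - 1)" by simp
    then have "((2 + K) * d) ^ CARD('n) = (2 + K) ^ CARD('n) * (d * d ^ (CARD('n) - 1))"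
      unfolding power_mult_distrib power_Suc by (rule arg_cong)
    then have "((\<beta> - \<alpha>) / d + 1) * (unit_ball_vol (real CARD('n)) * ((2 + K) * d) ^ CARD('n)) =
        (((\<beta> - \<alpha>) / d + 1) * d) * (tube_const CARD('n) K * d ^ (CARD('n) - 1))"
      unfolding tube_const_def by (simp only: mult_ac)
    also have "((\<beta> - \<alpha>) / d + 1) * d = \<beta> - \<alpha> + d" using A(4) by (simp add: field_simps)
    also have "(\<beta> - \<alpha> + d) * (tube_const CARD('n) K * d ^ (CARD('n) - 1)) = tube_const CARD('n) K * (\<beta> - \<alpha> + d) * d ^ (CARD('n) - 1)"
      by (simp only: mult_ac)
    finally show "real N * (unit_ball_vol (real CARD('n)) * ((2 + K) * d) ^ CARD('n)) \<le>
        tube_const CARD('n) K * (\<beta> - \<alpha> + d) * d ^ (CARD('n) - 1)" .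
  qed
  finally show ?thesis .
qed

text \<open>The preceding bound holds for all \<open>d\<close> above the diameter of \<open>U\<close>; letting \<open>d\<close> decrease to the
  diameter also covers sets of diameter zero. The closure of \<open>U\<close> makes the tube measurable.\<close>

lemma tube_le_weight:
  assumes U: "bounded U" "diameter U \<le> \<beta> - \<alpha>" and "\<alpha> < \<beta>"
  shows "emeasure lborel (tube (closure U) \<alpha> \<beta>) \<le>
    ennreal (flux_const CARD('n) K * (\<beta> - \<alpha>)) * ennreal (hausdorff_weight (CARD('n) - 1) U)"
proof (cases "U = {}")
  case True then show ?thesis by (simp add: tube_def hausdorff_weight_def)
next
  case False
  let ?m = "CARD('n) - 1"
  have dia: "diameter (closure U) = diameter U" "0 \<le> diameter U"
    using U by (auto simp: diameter_closure diameter_ge_0)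
  have "((\<lambda>d. ennreal (tube_const CARD('n) K * (\<beta> - \<alpha> + d) * d ^ ?m)) \<longlongrightarrow>
      ennreal (tube_const CARD('n) K * (\<beta> - \<alpha> + diameter U) * diameter U ^ ?m)) (at_right (diameter U))"
    by (intro tendsto_ennrealI tendsto_intros)
  moreover have "\<forall>\<^sub>F d in at_right (diameter U). emeasure lborel (tube (closure U) \<alpha> \<beta>) \<le>
      ennreal (tube_const CARD('n) K * (\<beta> - \<alpha> + d) * d ^ ?m)"
    using eventually_at_right_less[of "diameter U"]
  proof eventually_elim
    case (elim d)
    then show ?case using U dia assms by (intro tube_le) auto
  qed
  ultimately have "emeasure lborel (tube (closure U) \<alpha> \<beta>) \<le> ennreal (tube_const CARD('n) K * (\<beta> - \<alpha> + diameter U) * diameter U ^ ?m)"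
    by (intro tendsto_lowerbound) auto
  also have "\<dots> \<le> ennreal (flux_const CARD('n) K * (\<beta> - \<alpha>) * hausdorff_weight ?m U)"
  proof (rule ennreal_leI)
    have "tube_const CARD('n) K * (\<beta> - \<alpha> + diameter U) * diameter U ^ ?m \<le> (1 + tube_const CARD('n) K) * (2 * (\<beta> - \<alpha>)) * diameter U ^ ?m"
      using U tube_const_nonneg[OF K, of "CARD('n)"] dia assms by (intro mult_mono mult_nonneg_nonneg) auto
    also have "\<dots> = flux_const CARD('n) K * (\<beta> - \<alpha>) * hausdorff_weight ?m U"
    proof -
      have "0 < unit_ball_vol (real ?m)" by simp
      then have "flux_const CARD('n) K * (unit_ball_vol (real ?m) * (diameter U / 2) ^ ?m) =
          2 * (1 + tube_const CARD('n) K) * (2 ^ ?m * (diameter U / 2) ^ ?m)"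
        unfolding flux_const_def by (simp del: unit_ball_vol_pos)
      also have "2 ^ ?m * (diameter U / 2) ^ ?m = diameter U ^ ?m"
        unfolding power_mult_distrib[symmetric] by simp
      finally show ?thesis
        using False by (simp add: hausdorff_weight_def algebra_simps)
    qed
    finally show "tube_const CARD('n) K * (\<beta> - \<alpha> + diameter U) * diameter U ^ ?m \<le> flux_const CARD('n) K * (\<beta> - \<alpha>) * hausdorff_weight ?m U" .
  qed
  also have "\<dots> = ennreal (flux_const CARD('n) K * (\<beta> - \<alpha>)) * ennreal (hausdorff_weight ?m U)"
    using flux_const_pos[OF K, of "CARD('n)"] assms by (intro ennreal_mult') auto
  finally show ?thesis .
qed

text \<open>A cover of \<open>A\<close> by small sets splits the tube over \<open>A\<close> into tubes whose volumes are controlled by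
  the weights in the definition of the Hausdorff measure.\<close>

lemma tube_le_outer:
  assumes A: "A \<in> sets borel" and "\<alpha> < \<beta>"
  shows "emeasure lborel (tube A \<alpha> \<beta>) \<le> ennreal (flux_const CARD('n) K * (\<beta> - \<alpha>)) * hausdorff_outer (CARD('n) - 1) A"
proof -
  let ?m = "CARD('n) - 1"
  define \<kappa> where "\<kappa> = flux_const CARD('n) K * (\<beta> - \<alpha>)"
  have \<kappa>: "0 < \<kappa>" using flux_const_pos[OF K, of "CARD('n)"] assms by (simp add: \<kappa>_def)
  have "ennreal (1 / \<kappa>) * emeasure lborel (tube A \<alpha> \<beta>) \<le> hausdorff_content ?m (\<beta> - \<alpha>) A"
    unfolding hausdorff_content_def
  proof (rule INF_greatest)
    fix U :: "nat \<Rightarrow> (real^'n) set"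
    assume "U \<in> {U. A \<subseteq> (\<Union>i. U i) \<and> (\<forall>i. bounded (U i) \<and> diameter (U i) \<le> \<beta> - \<alpha>)}"
    then have U: "A \<subseteq> (\<Union>i. U i)" "\<And>i. bounded (U i)" "\<And>i. diameter (U i) \<le> \<beta> - \<alpha>" by auto
    have "tube A \<alpha> \<beta> \<subseteq> (\<Union>i. tube (closure (U i)) \<alpha> \<beta>)"
    proof
      fix x assume x: "x \<in> tube A \<alpha> \<beta>"
      then have "P x \<in> (\<Union>i. U i)" using U(1) by (auto simp: tube_def)
      then obtain i where "P x \<in> U i" by blast
      then have "P x \<in> closure (U i)" using closure_subset by blast
      then show "x \<in> (\<Union>i. tube (closure (U i)) \<alpha> \<beta>)" using x by (auto simp: tube_def)
    qed
    then have "emeasure lborel (tube A \<alpha> \<beta>) \<le> emeasure lborel (\<Union>i. tube (closure (U i)) \<alpha> \<beta>)"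
      using tube_measurable by (intro emeasure_mono) auto
    also have "\<dots> \<le> (\<Sum>i. emeasure lborel (tube (closure (U i)) \<alpha> \<beta>))"
      using tube_measurable by (intro emeasure_subadditive_countably) auto
    also have "\<dots> \<le> (\<Sum>i. ennreal \<kappa> * ennreal (hausdorff_weight ?m (U i)))"
      using U assms unfolding \<kappa>_def by (intro suminf_le tube_le_weight) auto
    also have "\<dots> = ennreal \<kappa> * (\<Sum>i. ennreal (hausdorff_weight ?m (U i)))" by simp
    finally have "ennreal (1 / \<kappa>) * emeasure lborel (tube A \<alpha> \<beta>) \<le>
        ennreal (1 / \<kappa>) * (ennreal \<kappa> * (\<Sum>i. ennreal (hausdorff_weight ?m (U i))))"
      by (intro mult_left_mono) auto
    also have "\<dots> = (\<Sum>i. ennreal (hausdorff_weight ?m (U i)))"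
      using \<kappa> by (simp add: mult.assoc[symmetric] ennreal_mult[symmetric])
    finally show "ennreal (1 / \<kappa>) * emeasure lborel (tube A \<alpha> \<beta>) \<le> (\<Sum>i. ennreal (hausdorff_weight ?m (U i)))" .
  qed
  also have "\<dots> \<le> hausdorff_outer ?m A" using assms by (intro hausdorff_content_le_outer) simp
  finally have "ennreal \<kappa> * (ennreal (1 / \<kappa>) * emeasure lborel (tube A \<alpha> \<beta>)) \<le> ennreal \<kappa> * hausdorff_outer ?m A"
    by (intro mult_left_mono) auto
  then show ?thesis
    using \<kappa> by (simp add: mult.assoc[symmetric] ennreal_mult[symmetric] \<kappa>_def[symmetric])
qed

lemma exit_measurable:
  "\<tau> \<in> borel_measurable (restrict_space lborel D)"
  "P \<in> measurable (restrict_space lborel D) (surface_measure \<Gamma>)"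
proof -
  have sets_R: "sets (restrict_space lborel D) = sets (restrict_space borel D)"
    by (intro sets_restrict_space_cong) simp
  show "\<tau> \<in> borel_measurable (restrict_space lborel D)"
    using \<tau> measurable_cong_sets[OF sets_R refl] by blast
  have "P \<in> measurable (restrict_space borel D) (restrict_space borel \<Gamma>)"
    using P by (intro measurable_restrict_space2) (auto simp: space_restrict_space)
  then show "P \<in> measurable (restrict_space lborel D) (surface_measure \<Gamma>)"
    using measurable_cong_sets[OF sets_R sets_surface_measure[of \<Gamma>]] by blast
qed

text \<open>The volume of the slab, pushed forward to the boundary by the exit point, is a measure dominated
  by a multiple of surface measure.\<close>

lemma slab_integral_le:
  assumes g: "g \<in> borel_measurable (surface_measure \<Gamma>)" and "\<alpha> < \<beta>"
  shows "(\<integral>\<^sup>+x. g (P x) * indicator {\<alpha><..\<beta>} (\<tau> x) \<partial>restrict_space lborel D) \<le>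
    ennreal (flux_const CARD('n) K * (\<beta> - \<alpha>)) * (\<integral>\<^sup>+y. g y \<partial>surface_measure \<Gamma>)"
proof -
  let ?R = "restrict_space lborel D"
  let ?f = "\<lambda>x. indicator {\<alpha><..\<beta>} (\<tau> x) :: ennreal"
  note \<tau>R = exit_measurable(1) and PR = exit_measurable(2)
  have fR: "?f \<in> borel_measurable ?R" using \<tau>R by measurable
  define \<nu> where "\<nu> = distr (density ?R ?f) (surface_measure \<Gamma>) P"
  have PR': "P \<in> measurable (density ?R ?f) (surface_measure \<Gamma>)" using PR by simp
  have "\<nu> \<le> scale_measure (ennreal (flux_const CARD('n) K * (\<beta> - \<alpha>))) (surface_measure \<Gamma>)"
  proof (subst le_measure)
    show "sets \<nu> = sets (scale_measure (ennreal (flux_const CARD('n) K * (\<beta> - \<alpha>))) (surface_measure \<Gamma>))"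
      by (simp add: \<nu>_def)
    show "\<forall>A\<in>sets \<nu>. emeasure \<nu> A \<le> emeasure (scale_measure (ennreal (flux_const CARD('n) K * (\<beta> - \<alpha>))) (surface_measure \<Gamma>)) A"
    proof
      fix A assume "A \<in> sets \<nu>"
      then have A: "A \<in> sets (surface_measure \<Gamma>)" by (simp add: \<nu>_def)
      then have A': "A \<in> sets borel" "A \<subseteq> \<Gamma>"
        using \<Gamma> by (auto simp: sets_surface_measure sets_restrict_space_iff)
      have mem: "P -` A \<inter> space ?R \<in> sets ?R" using PR A by (rule measurable_sets)
      have "emeasure \<nu> A = (\<integral>\<^sup>+x. ?f x * indicator (P -` A \<inter> space ?R) x \<partial>?R)"
        unfolding \<nu>_def using emeasure_distr[OF PR' A] emeasure_density[OF fR mem] by simp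
      also have "\<dots> = (\<integral>\<^sup>+x. indicator (tube A \<alpha> \<beta>) x \<partial>?R)"
        by (intro nn_integral_cong) (auto simp: tube_def space_restrict_space indicator_def)
      also have "\<dots> = emeasure ?R (tube A \<alpha> \<beta>)"
        using tube_measurable[OF A'(1)] D
        by (intro nn_integral_indicator) (auto simp: sets_restrict_space_iff tube_def)
      also have "\<dots> = emeasure lborel (tube A \<alpha> \<beta>)"
        using D by (intro emeasure_restrict_space) (auto simp: tube_def)
      also have "\<dots> \<le> ennreal (flux_const CARD('n) K * (\<beta> - \<alpha>)) * emeasure (surface_measure \<Gamma>) A"
        using tube_le_outer[OF A'(1) assms(2)] emeasure_surface_measure[OF \<Gamma> A'] by simp
      finally show "emeasure \<nu> A \<le> emeasure (scale_measure (ennreal (flux_const CARD('n) K * (\<beta> - \<alpha>))) (surface_measure \<Gamma>)) A"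
        by simp
    qed
  qed
  then have "(\<integral>\<^sup>+y. g y \<partial>\<nu>) \<le> (\<integral>\<^sup>+y. g y \<partial>scale_measure (ennreal (flux_const CARD('n) K * (\<beta> - \<alpha>))) (surface_measure \<Gamma>))"
    by (intro nn_integral_mono_measure) (auto simp: \<nu>_def)
  also have "\<dots> = ennreal (flux_const CARD('n) K * (\<beta> - \<alpha>)) * (\<integral>\<^sup>+y. g y \<partial>surface_measure \<Gamma>)"
    using g by (simp add: nn_integral_scale_measure)
  also have "(\<integral>\<^sup>+y. g y \<partial>\<nu>) = (\<integral>\<^sup>+x. ?f x * g (P x) \<partial>?R)"
  proof -
    have "(\<lambda>x. g (P x)) \<in> borel_measurable ?R" using measurable_compose[OF PR g] .
    then show ?thesis unfolding \<nu>_def using nn_integral_distr[OF PR', of g] g nn_integral_density[OF fR] by simp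
  qed
  finally show ?thesis by (simp add: mult.commute)
qed

text \<open>For a continuous integrand the value at the exit time may be replaced by its mean over a short
  time interval containing the exit time, up to an error \<open>\<epsilon>\<close> by uniform continuity. The integral over
  \<open>D\<close> becomes a Riemann sum of slab integrals in time. The time integral is the inner one, because the time
  factor is the one known to be sigma-finite.\<close>

lemma trace_integral_le:
  fixes F :: "(real^'n) \<times> real \<Rightarrow> real"
  assumes S: "compact S" "\<Gamma> \<subseteq> S" and F: "continuous_on (S \<times> {0..T}) F"
    and b: "0 < b" "b < T" and \<tau>_b: "\<And>x. x \<in> D \<Longrightarrow> 0 < \<tau> x \<and> \<tau> x \<le> b"
  shows "(\<integral>\<^sup>+x. ennreal (F (P x, \<tau> x)) \<partial>restrict_space lborel D) \<le>
    ennreal (flux_const CARD('n) K) * (\<integral>\<^sup>+z. ennreal (F z) \<partial>(surface_measure \<Gamma> \<Otimes>\<^sub>M restrict_space lborel {0<..<T}))"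
    (is "?I \<le> ennreal (flux_const CARD('n) K) * ?J")
proof (rule ennreal_le_epsilon)
  fix \<epsilon>' :: real
  assume "0 < \<epsilon>'"
  let ?N = "restrict_space lborel {0<..<T} :: real measure"
  let ?R = "restrict_space lborel D"
  interpret N: sigma_finite_measure ?N
    by (intro sigma_finite_measure_restrict_space sigma_finite_lborel) simp
  obtain v where v: "0 \<le> v" "emeasure lborel D = ennreal v"
    using D(2) by (cases "emeasure lborel D") auto
  define \<epsilon> where "\<epsilon> = \<epsilon>' / (v + 1)"
  have \<epsilon>: "0 < \<epsilon>" "\<epsilon> * v \<le> \<epsilon>'" using \<open>0 < \<epsilon>'\<close> v by (auto simp: \<epsilon>_def field_simps)
  have "uniformly_continuous_on (S \<times> {0..T}) F"
    using F S by (intro compact_uniformly_continuous compact_Times) auto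
  then obtain \<delta> where \<delta>: "0 < \<delta>"
    "\<And>z w. z \<in> S \<times> {0..T} \<Longrightarrow> w \<in> S \<times> {0..T} \<Longrightarrow> dist w z < \<delta> \<Longrightarrow> dist (F w) (F z) < \<epsilon>"
    unfolding uniformly_continuous_on_def using \<epsilon>(1) by metis
  obtain n where n: "b / \<delta> < real n" using reals_Archimedean2 by blast
  have "0 < b / \<delta>" using b \<delta> by simp
  then have n0: "0 < real n" using n by linarith
  define h where "h = b / real n"
  have h: "0 < h" "h < \<delta>" "real n * h = b" using b \<delta> n n0 by (auto simp: h_def field_simps)
  have Fm: "(\<lambda>z. ennreal (F z)) \<in> borel_measurable (surface_measure \<Gamma> \<Otimes>\<^sub>M ?N)"
    by (rule measurable_compose[OF lateral_measurable[OF F S(2)]]) simp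
  define I where "I k = {real k * h<..real (Suc k) * h}" for k
  have I_sub: "I k \<subseteq> {0<..<T}" if "k < n" for k
  proof -
    have "real (Suc k) * h \<le> real n * h" using that h by (intro mult_right_mono) auto
    moreover have "0 \<le> real k * h" using h by simp
    ultimately show ?thesis using h b unfolding I_def
      by (intro subsetI) (unfold greaterThanAtMost_iff greaterThanLessThan_iff, linarith)
  qed
  have I_meas: "emeasure ?N (I k) = ennreal h" if "k < n" for k
  proof -
    have "emeasure ?N (I k) = emeasure lborel (I k)"
      using I_sub[OF that] by (intro emeasure_restrict_space) auto
    also have "\<dots> = ennreal h" unfolding I_def using h by (subst emeasure_lborel_Ioc) (auto simp: algebra_simps)
    finally show ?thesis .
  qed
  have I_sets: "I k \<in> sets ?N" if "k < n" for k
    using I_sub[OF that] by (auto simp: sets_restrict_space_iff I_def)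
  define g where "g k y = (\<integral>\<^sup>+s. ennreal (F (y, s)) * indicator (I k) s \<partial>?N)" for k y
  have ind_meas: "(\<lambda>z. indicator (I k) (snd z) :: ennreal) \<in> borel_measurable (surface_measure \<Gamma> \<Otimes>\<^sub>M ?N)" if "k < n" for k
    by (rule measurable_compose[OF measurable_snd]) (use I_sets[OF that] in simp)
  have Fk_meas: "(\<lambda>z. ennreal (F z) * indicator (I k) (snd z)) \<in> borel_measurable (surface_measure \<Gamma> \<Otimes>\<^sub>M ?N)" if "k < n" for k
    by (intro borel_measurable_times_ennreal Fm ind_meas that)
  have g_meas: "g k \<in> borel_measurable (surface_measure \<Gamma>)" if "k < n" for k
    unfolding g_def[abs_def] using N.borel_measurable_nn_integral_fst[OF Fk_meas[OF that]] by simp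
  have pointwise: "ennreal (F (P x, \<tau> x)) \<le> (\<Sum>k<n. ennreal (1/h) * (g k (P x) * indicator (I k) (\<tau> x))) + ennreal \<epsilon>"
    if x: "x \<in> D" for x
  proof -
    have "0 < \<tau> x / h" "\<tau> x / h \<le> real n" using \<tau>_b[OF x] h by (auto simp: field_simps)
    then obtain k where k: "k < n" "real k < \<tau> x / h" "\<tau> x / h \<le> real (Suc k)" by (rule grid_index)
    then have \<tau>k: "\<tau> x \<in> I k" using h by (auto simp: I_def field_simps)
    have "ennreal h * ennreal (F (P x, \<tau> x)) = (\<integral>\<^sup>+s. ennreal (F (P x, \<tau> x)) * indicator (I k) s \<partial>?N)"
      unfolding nn_integral_cmult_indicator[OF I_sets[OF k(1)]] I_meas[OF k(1)] by (rule mult.commute)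
    also have "\<dots> \<le> (\<integral>\<^sup>+s. ennreal (F (P x, s)) * indicator (I k) s + ennreal \<epsilon> * indicator (I k) s \<partial>?N)"
    proof (rule nn_integral_mono)
      fix s
      show "ennreal (F (P x, \<tau> x)) * indicator (I k) s \<le> ennreal (F (P x, s)) * indicator (I k) s + ennreal \<epsilon> * indicator (I k) s"
      proof (cases "s \<in> I k")
        case True
        have "dist (P x, \<tau> x) (P x, s) < \<delta>"
          using True \<tau>k h by (auto simp: I_def dist_Pair_Pair dist_real_def algebra_simps)
        moreover have "P x \<in> S" using P(2)[OF x] S by blast
        moreover have "s \<in> {0..T}" "\<tau> x \<in> {0..T}" using I_sub[OF k(1)] True \<tau>k by auto
        ultimately have "dist (F (P x, \<tau> x)) (F (P x, s)) < \<epsilon>" by (intro \<delta>(2)) auto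
        then have "F (P x, \<tau> x) \<le> F (P x, s) + \<epsilon>" by (simp add: dist_real_def)
        then have "ennreal (F (P x, \<tau> x)) \<le> ennreal (F (P x, s) + \<epsilon>)" by (rule ennreal_leI)
        also have "\<dots> \<le> ennreal (F (P x, s)) + ennreal \<epsilon>" 
          using \<epsilon> by (cases "0 \<le> F (P x, s)") (auto simp: ennreal_neg intro: order_trans[OF ennreal_leI])
        finally show ?thesis using True by simp
      qed simp
    qed
    also have "\<dots> = (\<integral>\<^sup>+s. ennreal (F (P x, s)) * indicator (I k) s \<partial>?N) + (\<integral>\<^sup>+s. ennreal \<epsilon> * indicator (I k) s \<partial>?N)"
    proof (rule nn_integral_add)
      have "P x \<in> space (surface_measure \<Gamma>)" using P(2)[OF x] by (simp add: space_surface_measure)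
      then show "(\<lambda>s. ennreal (F (P x, s)) * indicator (I k) s) \<in> borel_measurable ?N"
        using measurable_compose[OF measurable_Pair1' Fk_meas[OF k(1)]] by simp
      show "(\<lambda>s. ennreal \<epsilon> * indicator (I k) s) \<in> borel_measurable ?N" using I_sets[OF k(1)] by simp
    qed
    also have "\<dots> = g k (P x) + ennreal \<epsilon> * ennreal h"
      using I_sets[OF k(1)] I_meas[OF k(1)] by (simp add: nn_integral_cmult_indicator g_def)
    finally have "ennreal (1/h) * (ennreal h * ennreal (F (P x, \<tau> x))) \<le> ennreal (1/h) * (g k (P x) + ennreal \<epsilon> * ennreal h)"
      by (intro mult_left_mono) auto
    then have "ennreal (F (P x, \<tau> x)) \<le> ennreal (1/h) * g k (P x) + ennreal \<epsilon>"
      using h \<epsilon> by (simp add: mult.assoc[symmetric] ennreal_mult[symmetric] distrib_left)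
    also have "ennreal (1/h) * g k (P x) = ennreal (1/h) * (g k (P x) * indicator (I k) (\<tau> x))" using \<tau>k by simp
    also have "\<dots> \<le> (\<Sum>k<n. ennreal (1/h) * (g k (P x) * indicator (I k) (\<tau> x)))"
      using k by (intro member_le_sum) auto
    finally show ?thesis by (simp add: add_right_mono)
  qed
  note \<tau>R = exit_measurable(1) and PR = exit_measurable(2)
  have term_meas: "(\<lambda>x. g k (P x) * indicator (I k) (\<tau> x)) \<in> borel_measurable ?R" if "k < n" for k
  proof (rule borel_measurable_times_ennreal)
    show "(\<lambda>x. g k (P x)) \<in> borel_measurable ?R" by (rule measurable_compose[OF PR g_meas[OF that]])
    show "(\<lambda>x. indicator (I k) (\<tau> x) :: ennreal) \<in> borel_measurable ?R"
      by (rule measurable_compose[OF \<tau>R]) (simp add: I_def)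
  qed
  have scaled_meas: "(\<lambda>x. ennreal (1/h) * (g k (P x) * indicator (I k) (\<tau> x))) \<in> borel_measurable ?R" if "k < n" for k
    by (rule borel_measurable_times_ennreal[OF _ term_meas[OF that]]) simp
  have "?I \<le> (\<integral>\<^sup>+x. (\<Sum>k<n. ennreal (1/h) * (g k (P x) * indicator (I k) (\<tau> x))) + ennreal \<epsilon> \<partial>?R)"
    using pointwise by (intro nn_integral_mono) (simp add: space_restrict_space)
  also have "\<dots> = (\<integral>\<^sup>+x. (\<Sum>k<n. ennreal (1/h) * (g k (P x) * indicator (I k) (\<tau> x))) \<partial>?R) + (\<integral>\<^sup>+x. ennreal \<epsilon> \<partial>?R)"
    using scaled_meas by (intro nn_integral_add borel_measurable_sum) auto
  also have "(\<integral>\<^sup>+x. ennreal \<epsilon> \<partial>?R) = ennreal (\<epsilon> * v)"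
    using D v \<epsilon> by (simp add: emeasure_restrict_space space_restrict_space ennreal_mult)
  also have "(\<integral>\<^sup>+x. (\<Sum>k<n. ennreal (1/h) * (g k (P x) * indicator (I k) (\<tau> x))) \<partial>?R) =
      (\<Sum>k<n. ennreal (1/h) * (\<integral>\<^sup>+x. g k (P x) * indicator (I k) (\<tau> x) \<partial>?R))"
    using scaled_meas term_meas by (subst nn_integral_sum) (auto intro!: sum.cong nn_integral_cmult)
  also have "\<dots> \<le> (\<Sum>k<n. ennreal (flux_const CARD('n) K) * (\<integral>\<^sup>+y. g k y \<partial>surface_measure \<Gamma>))"
  proof (rule sum_mono)
    fix k assume "k \<in> {..<n}"
    then have k: "k < n" by simp
    have len: "real (Suc k) * h - real k * h = h" by (simp add: algebra_simps)
    have "real k * h < real (Suc k) * h" using h by simp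
    from slab_integral_le[OF g_meas[OF k] this]
    have "ennreal (1/h) * (\<integral>\<^sup>+x. g k (P x) * indicator (I k) (\<tau> x) \<partial>?R) \<le>
        ennreal (1/h) * (ennreal (flux_const CARD('n) K * h) * (\<integral>\<^sup>+y. g k y \<partial>surface_measure \<Gamma>))"
      unfolding len I_def by (rule mult_left_mono) simp
    also have "\<dots> = ennreal (flux_const CARD('n) K) * (\<integral>\<^sup>+y. g k y \<partial>surface_measure \<Gamma>)"
      using h flux_const_pos[OF K, of "CARD('n)"] by (simp add: mult.assoc[symmetric] ennreal_mult[symmetric])
    finally show "ennreal (1/h) * (\<integral>\<^sup>+x. g k (P x) * indicator (I k) (\<tau> x) \<partial>?R) \<le>
        ennreal (flux_const CARD('n) K) * (\<integral>\<^sup>+y. g k y \<partial>surface_measure \<Gamma>)" .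
  qed
  also have "\<dots> = ennreal (flux_const CARD('n) K) * (\<integral>\<^sup>+y. (\<Sum>k<n. g k y) \<partial>surface_measure \<Gamma>)"
    using g_meas by (subst nn_integral_sum) (auto simp: sum_distrib_left)
  also have "(\<integral>\<^sup>+y. (\<Sum>k<n. g k y) \<partial>surface_measure \<Gamma>) \<le> (\<integral>\<^sup>+y. (\<integral>\<^sup>+s. ennreal (F (y, s)) \<partial>?N) \<partial>surface_measure \<Gamma>)"
  proof (rule nn_integral_mono)
    fix y assume y: "y \<in> space (surface_measure \<Gamma>)"
    have m: "(\<lambda>s. ennreal (F (y, s)) * indicator (I k) s) \<in> borel_measurable ?N" if "k < n" for k
      using measurable_compose[OF measurable_Pair1'[OF y] Fk_meas[OF that]] by simp
    have ind: "(\<Sum>k<m. indicator (I k) s) = (indicator {0<..real m * h} s :: ennreal)" for s m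
    proof (induction m)
      case (Suc m)
      have "0 \<le> real m * h" "real m * h \<le> real (Suc m) * h" using h by auto
      then have "indicator {0<..real m * h} s + indicator (I m) s = (indicator {0<..real (Suc m) * h} s :: ennreal)"
        by (auto simp: I_def indicator_def)
      then show ?case using Suc by simp
    qed simp
    have "(\<Sum>k<n. g k y) = (\<integral>\<^sup>+s. (\<Sum>k<n. ennreal (F (y, s)) * indicator (I k) s) \<partial>?N)"
      unfolding g_def using m by (subst nn_integral_sum) auto
    also have "\<dots> = (\<integral>\<^sup>+s. ennreal (F (y, s)) * indicator {0<..real n * h} s \<partial>?N)"
      unfolding sum_distrib_left[symmetric] ind ..
    also have "\<dots> \<le> (\<integral>\<^sup>+s. ennreal (F (y, s)) \<partial>?N)"
      by (intro nn_integral_mono) (auto simp: indicator_def)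
    finally show "(\<Sum>k<n. g k y) \<le> (\<integral>\<^sup>+s. ennreal (F (y, s)) \<partial>?N)" .
  qed
  also have "\<dots> = ?J" by (rule N.nn_integral_fst[OF Fm])
  finally have "?I \<le> ennreal (flux_const CARD('n) K) * ?J + ennreal (\<epsilon> * v)"
    by (simp add: add_right_mono mult_left_mono)
  also have "\<dots> \<le> ennreal (flux_const CARD('n) K) * ?J + ennreal \<epsilon>'"
    using \<epsilon> by (intro add_left_mono ennreal_leI)
  finally show "?I \<le> ennreal (flux_const CARD('n) K) * ?J + ennreal \<epsilon>'" .
qed

end

section \<open>Functions of class C1 on the closed cylinder\<close>

text \<open>Nonempty open sets have positive Lebesgue measure.\<close>

lemma AE_closed_imp_all:
  fixes f :: "'a::euclidean_space \<Rightarrow> 'b::topological_space"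
  assumes "open S" "continuous_on S f" "closed C" "AE x in lebesgue. x \<in> S \<longrightarrow> f x \<in> C" "x \<in> S"
  shows "f x \<in> C"
proof -
  have "open (S \<inter> f -` (- C))"
    using assms by (intro continuous_open_preimage) auto
  then have "closed (- (S \<inter> f -` (- C)))" by (rule closed_Compl)
  moreover have "AE x \<in> S in lebesgue. x \<in> - (S \<inter> f -` (- C))"
    using assms(4) by eventually_elim auto
  ultimately have "x \<in> - (S \<inter> f -` (- C))"
    using mem_closed_if_AE_lebesgue_open assms(1,5) by blast
  then show ?thesis using assms(5) by blast
qed

lemma closure_cylinder: "0 < T \<Longrightarrow> closure (\<Omega> \<times> {0<..<T::real}) = closure \<Omega> \<times> {0..T}"
  by (simp add: closure_Times)

lemma C1_cylinder_continuous:
  "0 < T \<Longrightarrow> C1_closure (\<Omega> \<times> {0<..<T::real}) u \<Longrightarrow> continuous_on (closure \<Omega> \<times> {0..T}) u"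
  by (simp add: C1_closure_def closure_cylinder)

context
  fixes \<Omega> :: "(real^'n) set" and T :: real and u :: "(real^'n) \<times> real \<Rightarrow> real"
  assumes \<Omega>: "open \<Omega>" and T: "0 < T" and u: "C1_closure (\<Omega> \<times> {0<..<T}) u"
begin

lemma C1_cylinder_has_derivative:
  assumes "x \<in> \<Omega>" "0 < t" "t < T"
  shows "(u has_derivative frechet_derivative u (at (x, t))) (at (x, t))"
  using u assms by (auto simp: C1_closure_def frechet_derivative_works[THEN iffD1])

lemma time_derivative:
  assumes x: "x \<in> \<Omega>" and t: "0 < t" "t < T"
  shows "((\<lambda>s. u (x, s)) has_vector_derivative frechet_derivative u (at (x, t)) (0, 1)) (at t)"
    and "dt T u (x, t) = frechet_derivative u (at (x, t)) (0, 1)"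
proof -
  have "((\<lambda>s. (x, s)) has_vector_derivative (0, 1)) (at t)"
    by (auto simp: has_vector_derivative_def intro!: derivative_eq_intros)
  moreover have "(u has_derivative frechet_derivative u (at (x, t))) (at (x, t) within range (\<lambda>s. (x, s)))"
    by (rule has_derivative_at_withinI[OF C1_cylinder_has_derivative[OF x t]])
  ultimately show *: "((\<lambda>s. u (x, s)) has_vector_derivative frechet_derivative u (at (x, t)) (0, 1)) (at t)"
    using vector_derivative_diff_chain_within[of "\<lambda>s. (x, s)" "(0, 1)" t UNIV u] by (simp add: o_def)
  have "((\<lambda>s. u (x, s)) has_vector_derivative frechet_derivative u (at (x, t)) (0, 1)) (at t within {0..T})"
    by (rule has_vector_derivative_at_within[OF *])
  then show "dt T u (x, t) = frechet_derivative u (at (x, t)) (0, 1)"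
    using t T by (simp add: dt_def vector_derivative_within_cbox[of 0 T, simplified])
qed

lemma space_derivative:
  assumes x: "x \<in> \<Omega>" and t: "0 < t" "t < T"
  shows "((\<lambda>y. u (y, t)) has_derivative (\<lambda>v. frechet_derivative u (at (x, t)) (v, 0))) (at x)"
    and "gradient (\<lambda>y. u (y, t)) x \<bullet> v = frechet_derivative u (at (x, t)) (v, 0)"
proof -
  have "((\<lambda>y. (y, t)) has_derivative (\<lambda>v. (v, 0))) (at x)"
    by (auto intro!: derivative_eq_intros)
  from has_derivative_compose[OF this C1_cylinder_has_derivative[OF x t]]
  show *: "((\<lambda>y. u (y, t)) has_derivative (\<lambda>v. frechet_derivative u (at (x, t)) (v, 0))) (at x)" .
  have "(\<lambda>y. u (y, t)) differentiable (at x)" using * by (rule differentiableI)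
  from frechet_derivative_eq_gradient[OF this, of v] frechet_derivative_at[OF *]
  show "gradient (\<lambda>y. u (y, t)) x \<bullet> v = frechet_derivative u (at (x, t)) (v, 0)" by metis
qed

text \<open>The spatial derivatives of \<open>u\<close>, extended continuously to the closed cylinder, are at time zero
  the derivatives of the initial value: difference quotients of \<open>u\<close> at small positive times are close to the
  extension at \<open>(x, 0)\<close>, uniformly in time, and this survives the limit to time zero.\<close>

lemma initial_partial_derivative:
  assumes g: "continuous_on (closure \<Omega> \<times> {0..T}) g"
      "\<And>x t. x \<in> \<Omega> \<Longrightarrow> 0 < t \<Longrightarrow> t < T \<Longrightarrow> g (x, t) = frechet_derivative u (at (x, t)) (b, 0)"
    and init: "\<And>x. x \<in> \<Omega> \<Longrightarrow> u (x, 0) = a x" and a: "a differentiable (at x)" and x: "x \<in> \<Omega>"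
    and b: "norm b = 1"
  shows "frechet_derivative a (at x) b = g (x, 0)"
proof -
  define \<Delta> where "\<Delta> = frechet_derivative a (at x) b"
  have "\<bar>\<Delta> - g (x, 0)\<bar> \<le> \<epsilon>" if \<epsilon>: "0 < \<epsilon>" for \<epsilon>
  proof -
    have "(x, 0) \<in> closure \<Omega> \<times> {0..T}" using x T closure_subset by auto
    then obtain \<delta>1 where \<delta>1: "0 < \<delta>1"
      "\<And>z. z \<in> closure \<Omega> \<times> {0..T} \<Longrightarrow> dist z (x, 0) < \<delta>1 \<Longrightarrow> dist (g z) (g (x, 0)) < \<epsilon>"
      using g(1) \<epsilon> unfolding continuous_on_iff by blast
    obtain \<delta>2 where \<delta>2: "0 < \<delta>2" "ball x \<delta>2 \<subseteq> \<Omega>" using \<Omega> x openE by blast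
    define \<delta> where "\<delta> = min (min \<delta>1 \<delta>2) T"
    have \<delta>: "0 < \<delta>" "\<delta> \<le> \<delta>1" "\<delta> \<le> \<delta>2" "\<delta> \<le> T" using \<delta>1 \<delta>2 T by (auto simp: \<delta>_def)
    have in_\<Omega>: "x + s *\<^sub>R b \<in> \<Omega>" if "0 \<le> s" "s < \<delta>" for s
      using that \<delta> \<delta>2 b by (auto simp: dist_norm intro!: subsetD[OF \<delta>2(2)])
    have incr: "\<bar>u (x + h *\<^sub>R b, t) - u (x, t) - h * g (x, 0)\<bar> \<le> \<epsilon> * h"
      if h: "0 < h" "h < \<delta>/2" and t: "0 < t" "t < \<delta>/2" for h t
    proof -
      have tT: "t < T" using t \<delta> by linarith
      let ?\<phi> = "\<lambda>s. u (x + s *\<^sub>R b, t) - s * g (x, 0)"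
      have "norm (?\<phi> h - ?\<phi> 0) \<le> \<epsilon> * norm (h - 0)"
      proof (rule differentiable_bound[of "{0..h}" ?\<phi> "\<lambda>s k. k * (g (x + s *\<^sub>R b, t) - g (x, 0))"])
        fix s assume s: "s \<in> {0..h}"
        then have p: "x + s *\<^sub>R b \<in> \<Omega>" using h \<delta> by (intro in_\<Omega>) auto
        have "((\<lambda>s. x + s *\<^sub>R b) has_derivative (\<lambda>k. k *\<^sub>R b)) (at s within {0..h})"
          by (auto intro!: derivative_eq_intros)
        from has_derivative_compose[OF this space_derivative(1)[OF p t(1) tT]]
        have "((\<lambda>s. u (x + s *\<^sub>R b, t)) has_derivative (\<lambda>k. frechet_derivative u (at (x + s *\<^sub>R b, t)) (k *\<^sub>R b, 0))) (at s within {0..h})" .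
        moreover have "frechet_derivative u (at (x + s *\<^sub>R b, t)) (k *\<^sub>R b, 0) = k * g (x + s *\<^sub>R b, t)" for k
        proof -
          have "linear (frechet_derivative u (at (x + s *\<^sub>R b, t)))"
            by (rule has_derivative_linear[OF C1_cylinder_has_derivative[OF p t(1) tT]])
          from linear_cmul[OF this, of k "(b, 0)"] show ?thesis using g(2)[OF p t(1) tT] by simp
        qed
        ultimately have "((\<lambda>s. u (x + s *\<^sub>R b, t)) has_derivative (\<lambda>k. k * g (x + s *\<^sub>R b, t))) (at s within {0..h})"
          by simp
        then show "(?\<phi> has_derivative (\<lambda>k. k * (g (x + s *\<^sub>R b, t) - g (x, 0)))) (at s within {0..h})"
          by (auto intro!: derivative_eq_intros simp: algebra_simps)
        have "dist (x + s *\<^sub>R b, t) (x, 0) \<le> \<bar>s\<bar> + \<bar>t\<bar>"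
          using norm_Pair_le[of "s *\<^sub>R b" t] b by (simp add: dist_norm)
        also have "\<dots> < \<delta>1" using s h t \<delta> by auto
        finally have "dist (g (x + s *\<^sub>R b, t)) (g (x, 0)) < \<epsilon>"
          using p t tT closure_subset[of \<Omega>] by (intro \<delta>1(2)) auto
        then show "onorm (\<lambda>k. k * (g (x + s *\<^sub>R b, t) - g (x, 0))) \<le> \<epsilon>"
          using \<epsilon> by (intro onorm_bound) (auto simp: abs_mult dist_real_def mult.commute[of \<epsilon>] intro!: mult_left_mono)
      qed (use h in auto)
      then show ?thesis using h by simp
    qed
    have incr0: "\<bar>a (x + h *\<^sub>R b) - a x - h * g (x, 0)\<bar> \<le> \<epsilon> * h" if h: "0 < h" "h < \<delta>/2" for h
    proof -
      have cu: "((\<lambda>t. u (y, t)) \<longlongrightarrow> u (y, 0)) (at_right 0)" if "y \<in> \<Omega>" for y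
      proof -
        have "continuous_on {0..T} (\<lambda>t. u (y, t))"
          using that closure_subset by (intro continuous_on_compose2[OF C1_cylinder_continuous[OF T u]] continuous_intros) auto
        then have "((\<lambda>t. u (y, t)) \<longlongrightarrow> u (y, 0)) (at 0 within {0..T})" using T by (auto simp: continuous_on_def)
        then show ?thesis using T at_within_Icc_at_right by metis
      qed
      have p: "x + h *\<^sub>R b \<in> \<Omega>" using h \<delta> by (intro in_\<Omega>) auto
      have "((\<lambda>t. \<bar>u (x + h *\<^sub>R b, t) - u (x, t) - h * g (x, 0)\<bar>) \<longlongrightarrow>
          \<bar>u (x + h *\<^sub>R b, 0) - u (x, 0) - h * g (x, 0)\<bar>) (at_right 0)"
        by (intro tendsto_intros cu p x)
      moreover have "\<forall>\<^sub>F t in at_right 0. \<bar>u (x + h *\<^sub>R b, t) - u (x, t) - h * g (x, 0)\<bar> \<le> \<epsilon> * h"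
        using eventually_at_right_real[of 0 "\<delta>/2"] \<delta> incr[OF h] by (auto elim: eventually_mono)
      ultimately have "\<bar>u (x + h *\<^sub>R b, 0) - u (x, 0) - h * g (x, 0)\<bar> \<le> \<epsilon> * h"
        by (rule tendsto_upperbound) simp
      then show ?thesis using init p x by simp
    qed
    have "((\<lambda>h. a (x + h *\<^sub>R b)) has_derivative (\<lambda>k. frechet_derivative a (at x) (k *\<^sub>R b))) (at 0)"
    proof -
      have "((\<lambda>h. x + h *\<^sub>R b) has_derivative (\<lambda>k. k *\<^sub>R b)) (at 0)"
        by (auto intro!: derivative_eq_intros)
      moreover have "(a has_derivative frechet_derivative a (at x)) (at (x + 0 *\<^sub>R b))"
        using a by (simp add: frechet_derivative_works[THEN iffD1])
      ultimately show ?thesis by (rule has_derivative_compose)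
    qed
    moreover have "frechet_derivative a (at x) (k *\<^sub>R b) = \<Delta> * k" for k
      using linear_cmul[OF linear_frechet_derivative[OF a], of k b] by (simp add: \<Delta>_def)
    ultimately have "((\<lambda>h. a (x + h *\<^sub>R b)) has_field_derivative \<Delta>) (at 0)"
      by (simp add: has_field_derivative_def)
    then have "((\<lambda>h. (a (x + h *\<^sub>R b) - a x) / h) \<longlongrightarrow> \<Delta>) (at 0)"
      by (simp add: has_field_derivative_iff)
    then have "((\<lambda>h. (a (x + h *\<^sub>R b) - a x) / h) \<longlongrightarrow> \<Delta>) (at_right 0)"
      by (rule tendsto_mono[OF at_le, rotated]) simp
    then have "((\<lambda>h. \<bar>(a (x + h *\<^sub>R b) - a x) / h - g (x, 0)\<bar>) \<longlongrightarrow> \<bar>\<Delta> - g (x, 0)\<bar>) (at_right 0)"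
      by (intro tendsto_intros)
    moreover have "\<bar>(a (x + h *\<^sub>R b) - a x) / h - g (x, 0)\<bar> \<le> \<epsilon>" if h: "0 < h" "h < \<delta>/2" for h
    proof -
      have "(a (x + h *\<^sub>R b) - a x) / h - g (x, 0) = (a (x + h *\<^sub>R b) - a x - h * g (x, 0)) / h"
        using h by (simp add: field_simps)
      then show ?thesis using incr0[OF h] h by (simp add: abs_divide pos_divide_le_eq)
    qed
    then have "\<forall>\<^sub>F h in at_right 0. \<bar>(a (x + h *\<^sub>R b) - a x) / h - g (x, 0)\<bar> \<le> \<epsilon>"
      using eventually_at_right_real[of 0 "\<delta>/2"] \<delta> by (auto elim: eventually_mono)
    ultimately show "\<bar>\<Delta> - g (x, 0)\<bar> \<le> \<epsilon>" by (rule tendsto_upperbound) simp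
  qed
  then have "\<bar>\<Delta> - g (x, 0)\<bar> \<le> 0" using field_le_epsilon[of "\<bar>\<Delta> - g (x, 0)\<bar>" 0] by simp
  then show ?thesis by (simp add: \<Delta>_def)
qed

end

section \<open>The coefficient as a continuous function\<close>

text \<open>The coefficient that the equation prescribes at the initial time, where \<open>u = a\<close>.\<close>

definition recovered_coefficient ::
  "real \<Rightarrow> (real^'n \<Rightarrow> real^'n) \<Rightarrow> (real^'n \<Rightarrow> real) \<Rightarrow> ((real^'n) \<times> real \<Rightarrow> real) \<Rightarrow> real^'n \<Rightarrow> real" where
  "recovered_coefficient T H a u x = - (dt T u (x, 0) + H x \<bullet> gradient a x) / a x"

lemma C1_closure_continuous_gradient:
  assumes "C1_closure \<Omega> (a :: 'a::euclidean_space \<Rightarrow> real)"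
  shows "continuous_on \<Omega> (gradient a)"
  unfolding gradient_def
proof (intro continuous_intros)
  fix b :: 'a assume "b \<in> Basis"
  then obtain g where g: "continuous_on (closure \<Omega>) g" "\<forall>x\<in>\<Omega>. g x = frechet_derivative a (at x) b"
    using assms unfolding C1_closure_def by blast
  have "continuous_on \<Omega> g" by (rule continuous_on_subset[OF g(1) closure_subset])
  then show "continuous_on \<Omega> (\<lambda>x. frechet_derivative a (at x) b)"
    by (rule continuous_on_eq) (use g(2) in auto)
qed

lemma Linf_norm_AE_le:
  assumes "Linf_norm \<mu> p \<le> ennreal M" "0 \<le> M"
  shows "AE x in \<mu>. \<bar>p x\<bar> \<le> M"
proof -
  have "esssup \<mu> (\<lambda>x. ereal \<bar>p x\<bar>) \<le> ereal M"
  proof (rule ccontr)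
    assume "\<not> ?thesis"
    then have lt: "ereal M < esssup \<mu> (\<lambda>x. ereal \<bar>p x\<bar>)" by simp
    then have "enn2ereal (e2ennreal (esssup \<mu> (\<lambda>x. ereal \<bar>p x\<bar>))) = esssup \<mu> (\<lambda>x. ereal \<bar>p x\<bar>)"
      using assms(2) by (intro enn2ereal_e2ennreal) (metis ereal_less_eq(5) less_imp_le order_trans)
    moreover have "enn2ereal (e2ennreal (esssup \<mu> (\<lambda>x. ereal \<bar>p x\<bar>))) \<le> enn2ereal (ennreal M)"
      using assms(1) unfolding Linf_norm_def by (simp add: less_eq_ennreal.rep_eq)
    ultimately show False using lt assms(2) by (simp add: enn2ereal_ennreal)
  qed
  with esssup_AE[of "\<lambda>x. ereal \<bar>p x\<bar>" \<mu>] show ?thesis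
    by (auto elim!: eventually_mono dest: order_trans)
qed

text \<open>By Fubini, for almost every \<open>x\<close> the equation holds at almost all times, hence by continuity in
  time at all of them, and at time zero it identifies \<open>p x\<close>. The identified function is continuous. With it
  in place of \<open>p\<close> every term of the equation is continuous in \<open>x\<close> too, so the equation and the bound on
  the coefficient hold at every point. This makes the equation meaningful along single characteristics.\<close>

lemma transport_equation_everywhere:
  fixes \<Omega> :: "(real^'n) set"
  assumes \<Omega>: "open \<Omega>" and T: "0 < T" and M: "0 \<le> M"
    and sol: "transport_solution \<Omega> T H p a u" and p: "p \<in> bounded_coefficients \<Omega> M"
    and dtu: "C1_closure (\<Omega> \<times> {0<..<T}) (dt T u)"
    and a: "C1_closure \<Omega> a" "\<forall>x\<in>closure \<Omega>. a x \<noteq> 0" and H: "continuous_on \<Omega> H"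
  defines "q \<equiv> recovered_coefficient T H a u"
  shows "AE x in lebesgue_on \<Omega>. p x = q x"
    and "continuous_on \<Omega> q"
    and "\<And>x. x \<in> \<Omega> \<Longrightarrow> \<bar>q x\<bar> \<le> M"
    and "\<And>x t. x \<in> \<Omega> \<Longrightarrow> 0 < t \<Longrightarrow> t < T \<Longrightarrow>
      dt T u (x, t) + H x \<bullet> gradient (\<lambda>y. u (y, t)) x + q x * u (x, t) = 0"
proof -
  let ?Q = "\<Omega> \<times> {0<..<T}"
  have u: "C1_closure ?Q u" and init: "\<And>x. x \<in> \<Omega> \<Longrightarrow> u (x, 0) = a x"
    and ae: "AE (x, t) in lebesgue_on ?Q. dt T u (x, t) + H x \<bullet> gradient (\<lambda>y. u (y, t)) x + p x * u (x, t) = 0"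
    using sol by (auto simp: transport_solution_def)
  have cl: "\<Omega> \<subseteq> closure \<Omega>" by (rule closure_subset)
  have cu: "continuous_on (closure \<Omega> \<times> {0..T}) u" by (rule C1_cylinder_continuous[OF T u])
  have cdt: "continuous_on (closure \<Omega> \<times> {0..T}) (dt T u)" by (rule C1_cylinder_continuous[OF T dtu])
  have "\<exists>g. continuous_on (closure \<Omega> \<times> {0..T}) g \<and>
      (\<forall>x\<in>\<Omega>. \<forall>t\<in>{0<..<T}. g (x, t) = frechet_derivative u (at (x, t)) (b, 0))" if "b \<in> Basis" for b :: "real^'n"
  proof -
    have "(b, 0) \<in> (Basis :: ((real^'n) \<times> real) set)" using that by (simp add: Basis_prod_def)
    then obtain g where "continuous_on (closure ?Q) g" "\<forall>x\<in>?Q. g x = frechet_derivative u (at x) (b, 0)"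
      using u unfolding C1_closure_def by blast
    then show ?thesis unfolding closure_cylinder[OF T] by (intro exI[of _ g]) auto
  qed
  then have "\<forall>b\<in>Basis. \<exists>g. continuous_on (closure \<Omega> \<times> {0..T}) g \<and>
      (\<forall>x\<in>\<Omega>. \<forall>t\<in>{0<..<T}. g (x, t) = frechet_derivative u (at (x, t)) (b, 0))" by blast
  from bchoice[OF this] obtain g where g_spec: "\<forall>b\<in>Basis. continuous_on (closure \<Omega> \<times> {0..T}) (g b) \<and>
      (\<forall>x\<in>\<Omega>. \<forall>t\<in>{0<..<T}. g b (x, t) = frechet_derivative u (at (x, t)) (b, 0))" ..
  then have g_cont: "\<And>b. b \<in> Basis \<Longrightarrow> continuous_on (closure \<Omega> \<times> {0..T}) (g b)"
    and g: "\<And>b x t. b \<in> Basis \<Longrightarrow> x \<in> \<Omega> \<Longrightarrow> 0 < t \<Longrightarrow> t < T \<Longrightarrow> g b (x, t) = frechet_derivative u (at (x, t)) (b, 0)"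
    by auto
  define S where "S x t = (\<Sum>b\<in>Basis. (H x \<bullet> b) * g b (x, t))" for x t
  have S: "H x \<bullet> gradient (\<lambda>y. u (y, t)) x = S x t" if "x \<in> \<Omega>" "0 < t" "t < T" for x t
    unfolding S_def
    by (subst euclidean_inner) (use g[OF _ that] space_derivative(2)[OF \<Omega> T u that] in \<open>intro sum.cong, auto\<close>)
  have S0: "H x \<bullet> gradient a x = S x 0" if x: "x \<in> \<Omega>" for x
    unfolding S_def
  proof (subst euclidean_inner, rule sum.cong)
    fix b :: "real^'n" assume b: "b \<in> Basis"
    have diff: "a differentiable (at x)" using a(1) x by (simp add: C1_closure_def)
    have "frechet_derivative a (at x) b = g b (x, 0)"
      using b by (intro initial_partial_derivative[OF \<Omega> T u g_cont g init diff x]) auto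
    then show "(H x \<bullet> b) * (gradient a x \<bullet> b) = (H x \<bullet> b) * g b (x, 0)"
      using frechet_derivative_eq_gradient[OF diff] by simp
  qed simp
  have q_eq: "q x * a x = - (dt T u (x, 0) + S x 0)" if "x \<in> \<Omega>" for x
    using a(2) that cl S0[OF that] by (auto simp: q_def recovered_coefficient_def)
  show cq: "continuous_on \<Omega> q"
  proof -
    have "continuous_on \<Omega> (\<lambda>x. dt T u (x, 0))"
      using cl T by (intro continuous_on_compose2[OF cdt] continuous_intros) auto
    moreover have "continuous_on \<Omega> a"
      using a(1) cl by (auto simp: C1_closure_def intro: continuous_on_subset)
    ultimately show ?thesis
      unfolding q_def recovered_coefficient_def[abs_def]
      using a(2) cl by (intro continuous_intros H C1_closure_continuous_gradient a(1)) auto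
  qed
  have sets_Q: "?Q \<in> sets lebesgue" using \<Omega> by (simp add: borel_open open_Times)
  have "AE z in lebesgue. z \<in> ?Q \<longrightarrow> (case z of (x, t) \<Rightarrow> dt T u (x, t) + H x \<bullet> gradient (\<lambda>y. u (y, t)) x + p x * u (x, t) = 0)"
    using ae sets_Q by (subst (asm) AE_restrict_space_iff) auto
  then have "AE z in lborel \<Otimes>\<^sub>M lborel. z \<in> ?Q \<longrightarrow> (case z of (x, t) \<Rightarrow> dt T u (x, t) + H x \<bullet> gradient (\<lambda>y. u (y, t)) x + p x * u (x, t) = 0)"
    unfolding lborel_prod AE_completion_iff .
  from lborel_pair.AE_pair[OF this]
  have slices: "AE x in lborel. AE t in lborel. x \<in> \<Omega> \<longrightarrow> t \<in> {0<..<T} \<longrightarrow>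
      dt T u (x, t) + S x t + p x * u (x, t) = 0"
  proof (eventually_elim)
    case (elim x)
    then show ?case by eventually_elim (use S in auto)
  qed
  have good: "AE x in lborel. x \<in> \<Omega> \<longrightarrow> p x = q x \<and> (\<forall>t\<in>{0<..<T}. dt T u (x, t) + S x t + q x * u (x, t) = 0)"
    using slices
  proof (eventually_elim)
    case (elim x)
    show ?case
    proof
      assume x: "x \<in> \<Omega>"
      define E where "E t = dt T u (x, t) + S x t + p x * u (x, t)" for t
      have slice: "continuous_on {0..T} (\<lambda>t. f (x, t))" if "continuous_on (closure \<Omega> \<times> {0..T}) f" for f :: "_ \<Rightarrow> real"
        using x cl by (intro continuous_on_compose2[OF that] continuous_intros) auto
      have cE: "continuous_on {0..T} E"
        unfolding E_def S_def using cu cdt g_cont by (intro continuous_intros slice) auto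
      have aeE: "AE t in lebesgue. t \<in> {0<..<T} \<longrightarrow> E t \<in> {0}"
        unfolding AE_completion_iff using elim by eventually_elim (use x in \<open>auto simp: E_def\<close>)
      have "E t \<in> {0}" if "t \<in> {0<..<T}" for t
        by (rule AE_closed_imp_all[OF _ continuous_on_subset[OF cE] _ aeE that]) auto
      then have E0: "E t = 0" if "t \<in> {0<..<T}" for t using that by blast
      have "closure {0<..<T} = {0..T}" using T by simp
      then have "E 0 = 0"
        using cE E0 T by (intro continuous_constant_on_closure[of "{0<..<T}" E 0 0]) auto
      then have "p x * a x = q x * a x" using q_eq[OF x] init[OF x] by (simp add: E_def)
      then have pq: "p x = q x" using a(2) x cl by auto
      then show "p x = q x \<and> (\<forall>t\<in>{0<..<T}. dt T u (x, t) + S x t + q x * u (x, t) = 0)"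
        using E0 by (auto simp: E_def)
    qed
  qed
  have sets_\<Omega>: "\<Omega> \<in> sets lebesgue" using \<Omega> by (simp add: borel_open)
  show pq: "AE x in lebesgue_on \<Omega>. p x = q x"
    using good sets_\<Omega> by (subst AE_restrict_space_iff) (auto simp: AE_completion_iff elim: eventually_mono)
  show "\<bar>q x\<bar> \<le> M" if "x \<in> \<Omega>" for x
  proof -
    have "AE x in lebesgue_on \<Omega>. \<bar>p x\<bar> \<le> M"
      using p M by (intro Linf_norm_AE_le) (auto simp: bounded_coefficients_def)
    then have "AE x in lebesgue_on \<Omega>. q x \<in> {-M..M}"
      using pq by eventually_elim auto
    then have "AE x in lebesgue. x \<in> \<Omega> \<longrightarrow> q x \<in> {-M..M}"
      using sets_\<Omega> by (subst (asm) AE_restrict_space_iff) auto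
    from AE_closed_imp_all[OF \<Omega> cq _ this that] show ?thesis by auto
  qed
  show "dt T u (x, t) + H x \<bullet> gradient (\<lambda>y. u (y, t)) x + q x * u (x, t) = 0"
    if x: "x \<in> \<Omega>" and t: "0 < t" "t < T" for x t
  proof -
    have slice: "continuous_on \<Omega> (\<lambda>x. f (x, t))" if "continuous_on (closure \<Omega> \<times> {0..T}) f" for f :: "_ \<Rightarrow> real"
      using t cl by (intro continuous_on_compose2[OF that] continuous_intros) auto
    have "continuous_on \<Omega> (\<lambda>x. dt T u (x, t) + S x t + q x * u (x, t))"
      unfolding S_def using cu cdt g_cont cq H by (intro continuous_intros slice) auto
    moreover have "AE x in lebesgue. x \<in> \<Omega> \<longrightarrow> dt T u (x, t) + S x t + q x * u (x, t) \<in> {0}"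
      unfolding AE_completion_iff using good by eventually_elim (use t in auto)
    ultimately have "dt T u (x, t) + S x t + q x * u (x, t) \<in> {0}"
      by (intro AE_closed_imp_all[OF \<Omega> _ _ _ x]) auto
    then show ?thesis using S[OF x t] by simp
  qed
qed

section \<open>Transport along characteristics\<close>

text \<open>Along a characteristic, \<open>u\<close> is multiplied by the exponential of minus the integral of \<open>q\<close>. The
  factor does not depend on the starting time, so differentiating in the starting time shows that the time
  derivative of \<open>u\<close> is multiplied by the same factor; no second derivatives of \<open>u\<close> enter.\<close>

lemma transport_along_curve:
  fixes \<Omega> :: "(real^'n) set"
  assumes \<Omega>: "open \<Omega>" and T: "0 < T"
    and u: "C1_closure (\<Omega> \<times> {0<..<T}) u" and dtu: "C1_closure (\<Omega> \<times> {0<..<T}) (dt T u)"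
    and q: "continuous_on \<Omega> q" "\<And>x. x \<in> \<Omega> \<Longrightarrow> \<bar>q x\<bar> \<le> M"
    and eq: "\<And>x t. x \<in> \<Omega> \<Longrightarrow> 0 < t \<Longrightarrow> t < T \<Longrightarrow>
      dt T u (x, t) + H x \<bullet> gradient (\<lambda>y. u (y, t)) x + q x * u (x, t) = 0"
    and \<sigma>: "0 < \<sigma>" "\<sigma> < T"
    and X_in: "\<And>s. 0 \<le> s \<Longrightarrow> s \<le> \<sigma> \<Longrightarrow> X s \<in> \<Omega>"
    and X': "\<And>s. 0 \<le> s \<Longrightarrow> s \<le> \<sigma> \<Longrightarrow> (X has_vector_derivative H (X s)) (at s within {0..\<sigma>})"
  obtains E where "exp (- M * T) \<le> E" "u (X \<sigma>, \<sigma>) = E * u (X 0, 0)" "dt T u (X \<sigma>, \<sigma>) = E * dt T u (X 0, 0)"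
proof -
  have cX: "continuous_on {0..\<sigma>} X"
    by (rule continuous_on_vector_derivative) (use X' in auto)
  have cqX: "continuous_on {0..s} (\<lambda>r. q (X r))" if "s \<le> \<sigma>" for s
    by (rule continuous_on_compose2[OF q(1) continuous_on_subset[OF cX]]) (use X_in that in auto)
  define I where "I s = integral {0..s} (\<lambda>r. q (X r))" for s
  define E where "E = exp (- I \<sigma>)"
  have cu: "continuous_on (closure \<Omega> \<times> {0..T}) u" by (rule C1_cylinder_continuous[OF T u])
  have cdt: "continuous_on (closure \<Omega> \<times> {0..T}) (dt T u)" by (rule C1_cylinder_continuous[OF T dtu])
  have cl: "X 0 \<in> closure \<Omega>" "X \<sigma> \<in> closure \<Omega>" using X_in[of 0] X_in[of \<sigma>] \<sigma> closure_subset by auto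
  have E_ge: "exp (- M * T) \<le> E"
  proof -
    have "0 \<le> \<bar>q (X 0)\<bar>" by simp
    also have "\<dots> \<le> M" using X_in[of 0] \<sigma> by (intro q(2)) auto
    finally have M: "0 \<le> M" .
    have "norm (I \<sigma>) \<le> M * (\<sigma> - 0)" unfolding I_def
      using \<sigma> q(2) X_in by (intro integral_bound cqX) auto
    also have "\<dots> \<le> M * T" using M \<sigma> by (intro mult_left_mono) auto
    finally show ?thesis by (simp add: E_def abs_le_iff)
  qed
  have open_case: "u (X \<sigma>, \<sigma> + t) = E * u (X 0, t)" if t: "0 < t" "t < T - \<sigma>" for t
  proof -
    let ?\<phi> = "\<lambda>s. u (X s, s + t) * exp (I s)"
    have "(?\<phi> has_field_derivative 0) (at s within {0..\<sigma>})" if s: "s \<in> {0..\<sigma>}" for s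
    proof -
      have p: "X s \<in> \<Omega>" and st: "0 < s + t" "s + t < T" using s t X_in by auto
      let ?u' = "frechet_derivative u (at (X s, s + t))"
      have "((\<lambda>s. (X s, s + t)) has_vector_derivative (H (X s), 1)) (at s within {0..\<sigma>})"
      proof -
        have "((\<lambda>s. s + t) has_vector_derivative 1) (at s within {0..\<sigma>})"
          by (auto intro!: derivative_eq_intros)
        then show ?thesis using s by (intro has_vector_derivative_Pair X') auto
      qed
      moreover have "(u has_derivative ?u') (at (X s, s + t) within (\<lambda>s. (X s, s + t)) ` {0..\<sigma>})"
        by (rule has_derivative_at_withinI[OF C1_cylinder_has_derivative[OF \<Omega> T u p st]])
      ultimately have "((\<lambda>s. u (X s, s + t)) has_vector_derivative ?u' (H (X s), 1)) (at s within {0..\<sigma>})"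
        using vector_derivative_diff_chain_within[of "\<lambda>s. (X s, s + t)" "(H (X s), 1)" s "{0..\<sigma>}" u ?u']
        by (simp add: o_def)
      moreover have "?u' (H (X s), 1) = - (q (X s) * u (X s, s + t))"
      proof -
        have lin: "linear ?u'" by (rule has_derivative_linear[OF C1_cylinder_has_derivative[OF \<Omega> T u p st]])
        have "?u' (H (X s), 1) = ?u' (H (X s), 0) + ?u' (0, 1)"
          using linear_add[OF lin, of "(H (X s), 0)" "(0, 1)"] by simp
        also have "\<dots> = H (X s) \<bullet> gradient (\<lambda>y. u (y, s + t)) (X s) + dt T u (X s, s + t)"
          using space_derivative(2)[OF \<Omega> T u p st] time_derivative(2)[OF \<Omega> T u p st] by (simp add: inner_commute)
        finally show ?thesis using eq[OF p st] by linarith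
      qed
      ultimately have "((\<lambda>s. u (X s, s + t)) has_field_derivative - (q (X s) * u (X s, s + t))) (at s within {0..\<sigma>})"
        by (simp add: has_real_derivative_iff_has_vector_derivative)
      moreover have "(I has_field_derivative q (X s)) (at s within {0..\<sigma>})"
        unfolding I_def by (rule integral_has_real_derivative[OF cqX s]) simp
      ultimately show ?thesis
        by (auto intro!: derivative_eq_intros)
    qed
    from has_field_derivative_zero_constant[OF _ this] obtain c where c: "\<And>s. s \<in> {0..\<sigma>} \<Longrightarrow> ?\<phi> s = c"
      by auto
    have "I 0 = 0" by (simp add: I_def)
    have "u (X \<sigma>, \<sigma> + t) * exp (I \<sigma>) = u (X 0, 0 + t) * exp (I 0)"
      using c[of 0] c[of \<sigma>] \<sigma> by simp
    then have "u (X \<sigma>, \<sigma> + t) * exp (I \<sigma>) = u (X 0, t)" using \<open>I 0 = 0\<close> by simp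
    then show ?thesis by (simp add: E_def exp_minus field_simps)
  qed
  have cont: "continuous_on {0..T - \<sigma>} (\<lambda>t. f (X \<sigma>, \<sigma> + t) - E * f (X 0, t))"
    if "continuous_on (closure \<Omega> \<times> {0..T}) f" for f :: "_ \<Rightarrow> real"
    using cl \<sigma> by (intro continuous_intros continuous_on_compose2[OF that]) auto
  have "closure {0<..<T - \<sigma>} = {0..T - \<sigma>}" using \<sigma> by simp
  note ext = continuous_constant_on_closure[of "{0<..<T - \<sigma>}" _ 0 0, unfolded this]
  have "u (X \<sigma>, \<sigma> + 0) - E * u (X 0, 0) = 0"
    by (rule ext[OF cont[OF cu]]) (use open_case \<sigma> in auto)
  moreover have "dt T u (X \<sigma>, \<sigma> + 0) - E * dt T u (X 0, 0) = 0"
  proof (rule ext[OF cont[OF cdt]])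
    fix t assume "t \<in> {0<..<T - \<sigma>}"
    then have t: "0 < t" "t < T - \<sigma>" by auto
    have "((\<lambda>t. u (X \<sigma>, \<sigma> + t)) has_vector_derivative dt T u (X \<sigma>, \<sigma> + t)) (at t)"
    proof -
      have "((\<lambda>t. \<sigma> + t) has_vector_derivative 1) (at t)" by (auto intro!: derivative_eq_intros)
      moreover have "((\<lambda>s. u (X \<sigma>, s)) has_vector_derivative dt T u (X \<sigma>, \<sigma> + t)) (at (\<sigma> + t))"
        using time_derivative[OF \<Omega> T u X_in[of \<sigma>], of "\<sigma> + t"] \<sigma> t by auto
      ultimately show ?thesis
        using vector_diff_chain_at[of "\<lambda>t. \<sigma> + t" 1 t "\<lambda>s. u (X \<sigma>, s)"] by (simp add: o_def)
    qed
    moreover have "((\<lambda>t. u (X 0, t)) has_vector_derivative dt T u (X 0, t)) (at t)"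
      using time_derivative[OF \<Omega> T u X_in[of 0], of t] \<sigma> t by auto
    ultimately have "((\<lambda>t. u (X \<sigma>, \<sigma> + t) - E * u (X 0, t)) has_vector_derivative
        (dt T u (X \<sigma>, \<sigma> + t) - E * dt T u (X 0, t))) (at t)"
      by (intro has_vector_derivative_diff has_vector_derivative_mult_right)
    moreover have "((\<lambda>t. u (X \<sigma>, \<sigma> + t) - E * u (X 0, t)) has_vector_derivative 0) (at t)"
    proof (rule has_vector_derivative_transform_within_open[of "\<lambda>_. 0" 0 t "{0<..<T - \<sigma>}"])
      show "t \<in> {0<..<T - \<sigma>}" using t by simp
      fix r assume "r \<in> {0<..<T - \<sigma>}"
      then show "0 = u (X \<sigma>, \<sigma> + r) - E * u (X 0, r)" using open_case[of r] by simp
    qed auto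
    ultimately show "dt T u (X \<sigma>, \<sigma> + t) - E * dt T u (X 0, t) = 0"
      by (rule vector_derivative_unique_at)
  qed (use \<sigma> in auto)
  ultimately show ?thesis using E_ge by (intro that[of E]) auto
qed

text \<open>The quotient of the time derivative of \<open>u\<close> and \<open>u\<close> itself is the same at both ends of the
  characteristic. By continuity this remains true when the curve ends on the boundary, where the equation is not
  available.\<close>

lemma transport_to_boundary:
  fixes \<Omega> :: "(real^'n) set"
  assumes \<Omega>: "open \<Omega>" and T: "0 < T"
    and u: "C1_closure (\<Omega> \<times> {0<..<T}) u" and dtu: "C1_closure (\<Omega> \<times> {0<..<T}) (dt T u)"
    and q: "continuous_on \<Omega> q" "\<And>x. x \<in> \<Omega> \<Longrightarrow> \<bar>q x\<bar> \<le> M"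
    and eq: "\<And>x t. x \<in> \<Omega> \<Longrightarrow> 0 < t \<Longrightarrow> t < T \<Longrightarrow>
      dt T u (x, t) + H x \<bullet> gradient (\<lambda>y. u (y, t)) x + q x * u (x, t) = 0"
    and \<tau>: "0 < \<tau>" "\<tau> < T"
    and X_in: "\<And>s. 0 \<le> s \<Longrightarrow> s < \<tau> \<Longrightarrow> X s \<in> \<Omega>" and X_end: "X \<tau> \<in> closure \<Omega>"
    and cX: "continuous_on {0..\<tau>} X"
    and X': "\<And>s. 0 \<le> s \<Longrightarrow> s < \<tau> \<Longrightarrow> (X has_vector_derivative H (X s)) (at s within {0..\<tau>})"
  shows "dt T u (X \<tau>, \<tau>) * u (X 0, 0) = dt T u (X 0, 0) * u (X \<tau>, \<tau>)"
    and "exp (- M * T) * \<bar>u (X 0, 0)\<bar> \<le> \<bar>u (X \<tau>, \<tau>)\<bar>"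
proof -
  have cu: "continuous_on (closure \<Omega> \<times> {0..T}) u" by (rule C1_cylinder_continuous[OF T u])
  have cdt: "continuous_on (closure \<Omega> \<times> {0..T}) (dt T u)" by (rule C1_cylinder_continuous[OF T dtu])
  have X_cl: "X s \<in> closure \<Omega>" if "s \<in> {0..\<tau>}" for s
    using that X_in[of s] X_end closure_subset[of \<Omega>] by (cases "s = \<tau>") auto
  have cont: "continuous_on {0..\<tau>} (\<lambda>s. f (X s, s))"
    if "continuous_on (closure \<Omega> \<times> {0..T}) f" for f :: "_ \<Rightarrow> real"
    using X_cl \<tau> by (intro continuous_intros continuous_on_compose2[OF that] cX) auto
  have inner: "dt T u (X s, s) * u (X 0, 0) - dt T u (X 0, 0) * u (X s, s) = 0 \<and>
      exp (- M * T) * \<bar>u (X 0, 0)\<bar> - \<bar>u (X s, s)\<bar> \<le> 0" if s: "s \<in> {0<..<\<tau>}" for s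
  proof -
    obtain E where E: "exp (- M * T) \<le> E" "u (X s, s) = E * u (X 0, 0)" "dt T u (X s, s) = E * dt T u (X 0, 0)"
    proof (rule transport_along_curve[OF \<Omega> T u dtu q eq])
      show "0 < s" "s < T" using s \<tau> by auto
      show "X r \<in> \<Omega>" if "0 \<le> r" "r \<le> s" for r using that s by (intro X_in) auto
      show "(X has_vector_derivative H (X r)) (at r within {0..s})" if "0 \<le> r" "r \<le> s" for r
        by (rule has_vector_derivative_within_subset[OF X']) (use that s in auto)
    qed
    have "0 \<le> E" using E(1) order_trans[OF exp_ge_zero] by blast
    then have "\<bar>u (X s, s)\<bar> = E * \<bar>u (X 0, 0)\<bar>" using E(2) by (simp add: abs_mult)
    moreover have "exp (- M * T) * \<bar>u (X 0, 0)\<bar> \<le> E * \<bar>u (X 0, 0)\<bar>"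
      using E(1) by (rule mult_right_mono) simp
    ultimately show ?thesis unfolding E(3) using E(2) by simp
  qed
  have cl: "closure {0<..<\<tau>} = {0..\<tau>}" using \<tau> by simp
  have "dt T u (X \<tau>, \<tau>) * u (X 0, 0) - dt T u (X 0, 0) * u (X \<tau>, \<tau>) = 0"
    by (rule continuous_constant_on_closure[of "{0<..<\<tau>}", unfolded cl])
      (use inner \<tau> in \<open>auto intro!: continuous_intros cont[OF cu] cont[OF cdt]\<close>)
  then show "dt T u (X \<tau>, \<tau>) * u (X 0, 0) = dt T u (X 0, 0) * u (X \<tau>, \<tau>)" by simp
  have "exp (- M * T) * \<bar>u (X 0, 0)\<bar> - \<bar>u (X \<tau>, \<tau>)\<bar> \<le> 0"
    by (rule continuous_le_on_closure[of "{0<..<\<tau>}", unfolded cl])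
      (use inner \<tau> in \<open>auto intro!: continuous_intros cont[OF cu]\<close>)
  then show "exp (- M * T) * \<bar>u (X 0, 0)\<bar> \<le> \<bar>u (X \<tau>, \<tau>)\<bar>" by simp
qed

text \<open>Inside the domain this is the fundamental theorem of calculus; both sides are continuous up to the boundary.\<close>

lemma time_increment:
  fixes \<Omega> :: "(real^'n) set"
  assumes \<Omega>: "open \<Omega>" and T: "0 < T"
    and u: "C1_closure (\<Omega> \<times> {0<..<T}) u" and dtu: "C1_closure (\<Omega> \<times> {0<..<T}) (dt T u)"
    and y: "y \<in> closure \<Omega>" and t: "0 \<le> t" "t \<le> T"
  shows "u (y, t) - u (y, 0) = integral {0..t} (\<lambda>s. dt T u (y, s))"
proof -
  have cu: "continuous_on (closure \<Omega> \<times> {0..T}) u" by (rule C1_cylinder_continuous[OF T u])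
  have cdt: "continuous_on (closure \<Omega> \<times> {0..T}) (dt T u)" by (rule C1_cylinder_continuous[OF T dtu])
  have "u (y, t) - u (y, 0) - integral (cbox 0 t) (\<lambda>s. dt T u (y, s)) = 0"
  proof (rule continuous_constant_on_closure[of \<Omega>])
    have "continuous_on (closure \<Omega> \<times> cbox 0 t) (\<lambda>(x, s). dt T u (x, s))"
      using t by (auto intro: continuous_on_subset[OF cdt])
    from integral_continuous_on_param[OF this]
    show "continuous_on (closure \<Omega>) (\<lambda>y. u (y, t) - u (y, 0) - integral (cbox 0 t) (\<lambda>s. dt T u (y, s)))"
      using t by (intro continuous_intros continuous_on_compose2[OF cu]) auto
    fix x assume x: "x \<in> \<Omega>"
    have "((\<lambda>s. dt T u (x, s)) has_integral u (x, t) - u (x, 0)) {0..t}"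
    proof (rule fundamental_theorem_of_calculus_interior)
      show "continuous_on {0..t} (\<lambda>s. u (x, s))"
        using t x closure_subset by (intro continuous_on_compose2[OF cu] continuous_intros) auto
      show "((\<lambda>s. u (x, s)) has_vector_derivative dt T u (x, s)) (at s)" if "s \<in> {0<..<t}" for s
        using time_derivative[OF \<Omega> T u x, of s] that t by auto
    qed (use t in simp)
    then show "u (x, t) - u (x, 0) - integral (cbox 0 t) (\<lambda>s. dt T u (x, s)) = 0"
      by (simp add: integral_unique)
  qed (rule y)
  then show ?thesis by simp
qed

text \<open>The Cauchy-Schwarz inequality, from the nonnegative integral of the squared deviation from the mean.\<close>

lemma integral_square_le:
  fixes f :: "real \<Rightarrow> real"
  assumes f: "continuous_on {0..T} f" and t: "0 \<le> t" "t \<le> T"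
  shows "(integral {0..t} f)\<^sup>2 \<le> T * integral {0..T} (\<lambda>s. (f s)\<^sup>2)"
proof (cases "t = 0")
  case True
  have "0 \<le> integral {0..T} (\<lambda>s. (f s)\<^sup>2)"
    using f by (intro integral_nonneg integrable_continuous_real continuous_intros) auto
  then show ?thesis using True t by simp
next
  case False
  then have "0 < t" using t by simp
  have ft: "continuous_on {0..t} f" using f t by (auto intro: continuous_on_subset)
  define m where "m = integral {0..t} f / t"
  have i: "f integrable_on {0..t}" "(\<lambda>s. (f s)\<^sup>2) integrable_on {0..t}"
    using ft by (auto intro!: integrable_continuous_real continuous_intros)
  have "0 \<le> integral {0..t} (\<lambda>s. (f s - m)\<^sup>2)"
    using ft by (intro integral_nonneg integrable_continuous_real continuous_intros) auto
  also have "(\<lambda>s. (f s - m)\<^sup>2) = (\<lambda>s. (f s)\<^sup>2 - (2 * m) * f s + m\<^sup>2)"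
    by (simp add: power2_diff algebra_simps)
  also have "integral {0..t} (\<lambda>s. (f s)\<^sup>2 - (2 * m) * f s + m\<^sup>2) =
      integral {0..t} (\<lambda>s. (f s)\<^sup>2) - (2 * m) * integral {0..t} f + t * m\<^sup>2"
  proof (rule integral_unique)
    have "((\<lambda>s. m\<^sup>2) has_integral t * m\<^sup>2) {0..t}"
      using has_integral_const_real[of "m\<^sup>2" 0 t] \<open>0 < t\<close> by simp
    then show "((\<lambda>s. (f s)\<^sup>2 - (2 * m) * f s + m\<^sup>2) has_integral
        integral {0..t} (\<lambda>s. (f s)\<^sup>2) - (2 * m) * integral {0..t} f + t * m\<^sup>2) {0..t}"
      using i by (intro has_integral_add has_integral_diff has_integral_mult_right integrable_integral)
  qed
  finally have "(integral {0..t} f)\<^sup>2 \<le> t * integral {0..t} (\<lambda>s. (f s)\<^sup>2)"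
    using \<open>0 < t\<close> by (simp add: m_def field_simps power2_eq_square)
  also have "\<dots> \<le> T * integral {0..T} (\<lambda>s. (f s)\<^sup>2)"
  proof (intro mult_mono)
    show "integral {0..t} (\<lambda>s. (f s)\<^sup>2) \<le> integral {0..T} (\<lambda>s. (f s)\<^sup>2)"
      using f ft i(2) t by (intro integral_subset_le integrable_continuous_real continuous_intros) auto
    show "0 \<le> integral {0..t} (\<lambda>s. (f s)\<^sup>2)" by (intro integral_nonneg i) auto
  qed (use t in auto)
  finally show ?thesis .
qed

section \<open>The pointwise estimate\<close>

text \<open>Here \<open>m\<close> bounds \<open>|a|\<close> from below and \<open>A\<close> bounds its gradient. Then \<open>exp (- M T) m\<close> bounds \<open>|u|\<close> from
  below at the exit point, and \<open>M + M A / m\<close> bounds the quotient of the time derivative of \<open>u\<close> and \<open>u\<close>.\<close>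

definition stability_const :: "real \<Rightarrow> real \<Rightarrow> real \<Rightarrow> real \<Rightarrow> real" where
  "stability_const T M m A =
     2 * (1 + T * (M + M * A / m)\<^sup>2) / (exp (- M * T) * m)\<^sup>2"

lemma square_add_le: "(y + z)\<^sup>2 \<le> 2 * y\<^sup>2 + 2 * z\<^sup>2" for y z :: real
  using zero_le_power2[of "y - z"] by (simp add: power2_sum power2_diff)

text \<open>The core of the proof. At time zero the equation gives
  \<open>q1 - q2 = - (w1 - w2) / a\<close> with \<open>wj\<close> the time derivatives at time zero. The quotient \<open>wj / a\<close> is carried
  along the characteristic to \<open>Wj / Vj\<close>, the same quotient at the exit point \<open>P\<close> and the exit time. Finally
  \<open>W1 / V1 - W2 / V2\<close> is controlled by \<open>W1 - W2\<close> and by \<open>V1 - V2\<close>, and the latter is the time integral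
  of the difference of the time derivatives at \<open>P\<close>, because \<open>u1\<close> and \<open>u2\<close> start from the same value.\<close>

lemma coefficient_difference_le:
  fixes \<Omega> :: "(real^'n) set"
  assumes \<Omega>: "open \<Omega>" and T: "0 < T" and M: "0 \<le> M"
    and sol1: "transport_solution \<Omega> T H p1 a u1" and sol2: "transport_solution \<Omega> T H p2 a u2"
    and p1: "p1 \<in> bounded_coefficients \<Omega> M" and p2: "p2 \<in> bounded_coefficients \<Omega> M"
    and dt1: "C1_closure (\<Omega> \<times> {0<..<T}) (dt T u1)" and dt2: "C1_closure (\<Omega> \<times> {0<..<T}) (dt T u2)"
    and a: "C1_closure \<Omega> a" and m: "0 < m" "\<And>x. x \<in> closure \<Omega> \<Longrightarrow> m \<le> \<bar>a x\<bar>"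
    and A: "\<And>x. x \<in> \<Omega> \<Longrightarrow> norm (gradient a x) \<le> A"
    and H: "continuous_on \<Omega> H" "\<And>x. x \<in> \<Omega> \<Longrightarrow> norm (H x) \<le> M"
    and \<tau>: "0 < \<tau>" "\<tau> < T"
    and X_in: "\<And>s. 0 \<le> s \<Longrightarrow> s < \<tau> \<Longrightarrow> X s \<in> \<Omega>" and X_end: "X \<tau> \<in> closure \<Omega>"
    and cX: "continuous_on {0..\<tau>} X"
    and X': "\<And>s. 0 \<le> s \<Longrightarrow> s < \<tau> \<Longrightarrow> (X has_vector_derivative H (X s)) (at s within {0..\<tau>})"
  defines "q1 \<equiv> recovered_coefficient T H a u1" and "q2 \<equiv> recovered_coefficient T H a u2"
    and "W \<equiv> \<lambda>z. dt T u1 z - dt T u2 z"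
  shows "(q1 (X 0) - q2 (X 0))\<^sup>2 \<le> stability_const T M m A *
    ((W (X \<tau>, \<tau>))\<^sup>2 + integral {0..T} (\<lambda>s. (W (X \<tau>, s))\<^sup>2))"
proof -
  let ?x = "X 0" and ?P = "X \<tau>"
  have x: "?x \<in> \<Omega>" using X_in[of 0] \<tau> by simp
  have cl: "\<Omega> \<subseteq> closure \<Omega>" by (rule closure_subset)
  have a0: "\<forall>y\<in>closure \<Omega>. a y \<noteq> 0" using m by force
  have init: "u1 (y, 0) = a y" "u2 (y, 0) = a y" if "y \<in> \<Omega>" for y
    using sol1 sol2 that by (auto simp: transport_solution_def)
  have u1: "C1_closure (\<Omega> \<times> {0<..<T}) u1" and u2: "C1_closure (\<Omega> \<times> {0<..<T}) u2"
    using sol1 sol2 by (auto simp: transport_solution_def)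
  note eqs1 = transport_equation_everywhere[OF \<Omega> T M sol1 p1 dt1 a a0 H(1), folded q1_def]
  note eqs2 = transport_equation_everywhere[OF \<Omega> T M sol2 p2 dt2 a a0 H(1), folded q2_def]
  define \<kappa> where "\<kappa> = a ?x"
  define w1 w2 V1 V2 W1 W2 where defs: "w1 = dt T u1 (?x, 0)" "w2 = dt T u2 (?x, 0)"
    "V1 = u1 (?P, \<tau>)" "V2 = u2 (?P, \<tau>)" "W1 = dt T u1 (?P, \<tau>)" "W2 = dt T u2 (?P, \<tau>)"
  define \<mu> where "\<mu> = exp (- M * T) * m"
  define Ka where "Ka = M + M * A / m"
  have \<mu>: "0 < \<mu>" using m by (simp add: \<mu>_def)
  have \<kappa>: "m \<le> \<bar>\<kappa>\<bar>" "\<kappa> \<noteq> 0" using m(2)[of ?x] m(1) x cl by (auto simp: \<kappa>_def)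
  have \<mu>_le: "\<mu> \<le> exp (- M * T) * \<bar>\<kappa>\<bar>" unfolding \<mu>_def using \<kappa> by simp
  \<comment> \<open>Both quotients are transported to the exit point.\<close>
  have 1: "W1 * \<kappa> = w1 * V1" "\<mu> \<le> \<bar>V1\<bar>"
    using transport_to_boundary[OF \<Omega> T u1 dt1 eqs1(2-4) \<tau> X_in X_end cX X'] init[OF x] \<mu>_le
    by (auto simp: defs \<kappa>_def)
  have 2: "W2 * \<kappa> = w2 * V2" "\<mu> \<le> \<bar>V2\<bar>"
    using transport_to_boundary[OF \<Omega> T u2 dt2 eqs2(2-4) \<tau> X_in X_end cX X'] init[OF x] \<mu>_le
    by (auto simp: defs \<kappa>_def)
  have V0: "V1 \<noteq> 0" "V2 \<noteq> 0" using 1 2 \<mu> by auto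
  have ratio: "w1 / \<kappa> = W1 / V1" "w2 / \<kappa> = W2 / V2" using 1 2 V0 \<kappa> by (auto simp: field_simps)
  have "q1 ?x - q2 ?x = - (w1 / \<kappa> - w2 / \<kappa>)"
    by (simp add: q1_def q2_def recovered_coefficient_def defs \<kappa>_def diff_divide_distrib add_divide_distrib)
  also have "\<dots> = - ((W1 - W2) + W1 / V1 * (V2 - V1)) / V2"
    unfolding ratio using V0 by (simp add: field_simps)
  finally have diff: "q1 ?x - q2 ?x = - ((W1 - W2) + w1 / \<kappa> * (V2 - V1)) / V2" unfolding ratio .
  have "\<bar>w1 / \<kappa>\<bar> \<le> Ka"
  proof -
    have "q1 ?x = - (w1 + H ?x \<bullet> gradient a ?x) / \<kappa>"
      by (simp only: q1_def recovered_coefficient_def defs \<kappa>_def)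
    then have "w1 / \<kappa> = - q1 ?x - (H ?x \<bullet> gradient a ?x) / \<kappa>"
      using \<kappa>(2) by (simp add: field_simps)
    then have "\<bar>w1 / \<kappa>\<bar> \<le> \<bar>q1 ?x\<bar> + \<bar>H ?x \<bullet> gradient a ?x\<bar> / \<bar>\<kappa>\<bar>"
      unfolding abs_divide[of "H ?x \<bullet> gradient a ?x" \<kappa>, symmetric] by linarith
    also have "\<bar>q1 ?x\<bar> \<le> M" by (rule eqs1(3)[OF x])
    also have "\<bar>H ?x \<bullet> gradient a ?x\<bar> / \<bar>\<kappa>\<bar> \<le> (M * A) / m"
    proof (rule frac_le)
      have "\<bar>H ?x \<bullet> gradient a ?x\<bar> \<le> norm (H ?x) * norm (gradient a ?x)" by (rule Cauchy_Schwarz_ineq2)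
      also have "\<dots> \<le> M * A" using H(2)[OF x] A[OF x] M by (intro mult_mono) auto
      finally show "\<bar>H ?x \<bullet> gradient a ?x\<bar> \<le> M * A" .
      then show "0 \<le> M * A" by linarith
    qed (use \<kappa> m in auto)
    finally show ?thesis by (simp add: Ka_def)
  qed
  then have Ka: "\<bar>w1 / \<kappa> * (V2 - V1)\<bar> \<le> Ka * \<bar>V1 - V2\<bar>"
    unfolding abs_mult abs_minus_commute[of V2] by (rule mult_right_mono) simp
  have cW: "continuous_on {0..T} (\<lambda>s. W (?P, s))"
    unfolding W_def using X_end
    by (intro continuous_intros continuous_on_compose2[OF C1_cylinder_continuous[OF T dt1]]
        continuous_on_compose2[OF C1_cylinder_continuous[OF T dt2]]) auto
  have V12: "(V1 - V2)\<^sup>2 \<le> T * integral {0..T} (\<lambda>s. (W (?P, s))\<^sup>2)"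
  proof -
    have "u1 (?P, 0) - u2 (?P, 0) = 0"
    proof (rule continuous_constant_on_closure[of \<Omega>])
      show "continuous_on (closure \<Omega>) (\<lambda>y. u1 (y, 0) - u2 (y, 0))"
        using T by (intro continuous_intros continuous_on_compose2[OF C1_cylinder_continuous[OF T u1]]
            continuous_on_compose2[OF C1_cylinder_continuous[OF T u2]]) auto
    qed (use init X_end in auto)
    then have "V1 - V2 = integral {0..\<tau>} (\<lambda>s. dt T u1 (?P, s)) - integral {0..\<tau>} (\<lambda>s. dt T u2 (?P, s))"
      using time_increment[OF \<Omega> T u1 dt1 X_end, of \<tau>] time_increment[OF \<Omega> T u2 dt2 X_end, of \<tau>] \<tau>
      by (simp add: defs)
    also have "\<dots> = integral {0..\<tau>} (\<lambda>s. W (?P, s))"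
      unfolding W_def
    proof (rule integral_diff[symmetric])
      show "(\<lambda>s. dt T u1 (?P, s)) integrable_on {0..\<tau>}" "(\<lambda>s. dt T u2 (?P, s)) integrable_on {0..\<tau>}"
        using X_end \<tau> by (intro integrable_continuous_real continuous_intros
          continuous_on_compose2[OF C1_cylinder_continuous[OF T dt1]]
          continuous_on_compose2[OF C1_cylinder_continuous[OF T dt2]]; auto)+
    qed
    finally show ?thesis using integral_square_le[OF cW, of \<tau>] \<tau> by simp
  qed
  have J: "0 \<le> integral {0..T} (\<lambda>s. (W (?P, s))\<^sup>2)" (is "0 \<le> ?J")
    using cW by (intro integral_nonneg integrable_continuous_real continuous_intros) auto
  have "(q1 ?x - q2 ?x) * V2 = - ((W1 - W2) + w1 / \<kappa> * (V2 - V1))"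
    unfolding diff using V0 by simp
  then have "((q1 ?x - q2 ?x) * V2)\<^sup>2 = ((W1 - W2) + w1 / \<kappa> * (V2 - V1))\<^sup>2"
    by (simp only: power2_minus)
  then have "(q1 ?x - q2 ?x)\<^sup>2 * V2\<^sup>2 = ((W1 - W2) + w1 / \<kappa> * (V2 - V1))\<^sup>2"
    by (simp only: power_mult_distrib)
  also have "\<dots> \<le> 2 * (W1 - W2)\<^sup>2 + 2 * (w1 / \<kappa> * (V2 - V1))\<^sup>2"
    by (rule square_add_le)
  also have "(w1 / \<kappa> * (V2 - V1))\<^sup>2 \<le> (Ka * \<bar>V1 - V2\<bar>)\<^sup>2"
    using Ka by (intro abs_le_square_iff[THEN iffD1]) linarith
  also have "(Ka * \<bar>V1 - V2\<bar>)\<^sup>2 = Ka\<^sup>2 * (V1 - V2)\<^sup>2" by (simp add: power_mult_distrib)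
  also have "\<dots> \<le> Ka\<^sup>2 * (T * ?J)" using V12 by (intro mult_left_mono) auto
  finally have "(q1 ?x - q2 ?x)\<^sup>2 * V2\<^sup>2 \<le> 2 * (W1 - W2)\<^sup>2 + 2 * (T * Ka\<^sup>2) * ?J"
    by (simp add: mult_ac)
  also have "\<dots> \<le> 2 * (1 + T * Ka\<^sup>2) * ((W1 - W2)\<^sup>2 + ?J)"
    using J T by (simp add: algebra_simps)
  finally have main: "(q1 ?x - q2 ?x)\<^sup>2 * V2\<^sup>2 \<le> 2 * (1 + T * Ka\<^sup>2) * ((W1 - W2)\<^sup>2 + ?J)" .
  have "\<mu>\<^sup>2 \<le> V2\<^sup>2" using 2(2) \<mu> by (intro abs_le_square_iff[THEN iffD1]) linarith
  then have "(q1 ?x - q2 ?x)\<^sup>2 * \<mu>\<^sup>2 \<le> (q1 ?x - q2 ?x)\<^sup>2 * V2\<^sup>2" by (intro mult_left_mono) auto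
  also note main
  finally have le: "(q1 ?x - q2 ?x)\<^sup>2 * \<mu>\<^sup>2 \<le> 2 * (1 + T * Ka\<^sup>2) * ((W1 - W2)\<^sup>2 + ?J)" .
  have "0 < \<mu>\<^sup>2" using \<mu> by simp
  from le[folded pos_le_divide_eq[OF this]]
  have "(q1 ?x - q2 ?x)\<^sup>2 \<le> (2 * (1 + T * Ka\<^sup>2) / \<mu>\<^sup>2) * ((W1 - W2)\<^sup>2 + ?J)"
    unfolding times_divide_eq_left .
  also have "2 * (1 + T * Ka\<^sup>2) / \<mu>\<^sup>2 = stability_const T M m A"
    unfolding stability_const_def Ka_def \<mu>_def ..
  also have "W1 - W2 = W (?P, \<tau>)" unfolding W_def defs ..
  finally show ?thesis .
qed

lemma C1_closure_frechet_bounded: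
  fixes f :: "'a::euclidean_space \<Rightarrow> 'b::real_normed_vector"
  assumes "C1_closure S f" "bounded S"
  obtains B where "\<And>x b. x \<in> S \<Longrightarrow> b \<in> Basis \<Longrightarrow> norm (frechet_derivative f (at x) b) \<le> B"
proof -
  have "\<exists>B. \<forall>x\<in>S. norm (frechet_derivative f (at x) b) \<le> B" if "b \<in> Basis" for b
  proof -
    have "\<forall>b\<in>Basis. \<exists>g. continuous_on (closure S) g \<and> (\<forall>x\<in>S. g x = frechet_derivative f (at x) b)"
      using assms(1) unfolding C1_closure_def by (rule conjunct2[OF conjunct2])
    from bspec[OF this that]
    obtain g where g: "continuous_on (closure S) g" "\<forall>x\<in>S. g x = frechet_derivative f (at x) b"
      by (elim exE conjE)
    have "compact (closure S)" using assms(2) by simp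
    then have "bounded (g ` closure S)"
      by (intro compact_imp_bounded compact_continuous_image g(1))
    then obtain B where B: "\<And>y. y \<in> g ` closure S \<Longrightarrow> norm y \<le> B" unfolding bounded_iff by blast
    have "norm (frechet_derivative f (at x) b) \<le> B" if "x \<in> S" for x
    proof -
      have "g x \<in> g ` closure S" using that closure_subset by blast
      then have "norm (g x) \<le> B" by (rule B)
      then show ?thesis using bspec[OF g(2) that] by simp
    qed
    then show ?thesis by blast
  qed
  then have "\<forall>b\<in>Basis. \<exists>B. \<forall>x\<in>S. norm (frechet_derivative f (at x) b) \<le> B" by blast
  from bchoice[OF this] obtain B where B: "\<forall>b\<in>Basis. \<forall>x\<in>S. norm (frechet_derivative f (at x) b) \<le> B b" ..
  show ?thesis
  proof (rule that[of "\<Sum>b\<in>Basis. \<bar>B b\<bar>"])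
    fix x and b :: 'a assume *: "x \<in> S" "b \<in> Basis"
    have "norm (frechet_derivative f (at x) b) \<le> \<bar>B b\<bar>"
      using bspec[OF bspec[OF B *(2)] *(1)] by linarith
    also have "\<dots> \<le> (\<Sum>b\<in>Basis. \<bar>B b\<bar>)" using * by (intro member_le_sum) auto
    finally show "norm (frechet_derivative f (at x) b) \<le> (\<Sum>b\<in>Basis. \<bar>B b\<bar>)" .
  qed
qed

text \<open>The suprema in the norm are over sets that are bounded above because \<open>H\<close> and its derivatives extend
  continuously to a compact set; only then does the bound on the norm bound the values.\<close>

lemma admissible_field_bounds:
  fixes \<Omega> :: "(real^'n) set"
  assumes H: "C1_closure \<Omega> H" "C1_norm \<Omega> H \<le> M" and \<Omega>: "bounded \<Omega>" "\<Omega> \<noteq> {}"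
  shows "\<And>x. x \<in> closure \<Omega> \<Longrightarrow> norm (H x) \<le> M"
    and "\<And>x v. x \<in> \<Omega> \<Longrightarrow> norm (frechet_derivative H (at x) v) \<le> (real CARD('n))\<^sup>2 * M * norm v"
proof -
  define fro where "fro x = sqrt (\<Sum>j\<in>UNIV. \<Sum>k\<in>UNIV. (jacobian H (at x) $ j $ k)\<^sup>2)" for x
  have entry: "jacobian H (at x) $ j $ k = frechet_derivative H (at x) (axis k 1) $ j" for x j k
    by (simp add: jacobian_def matrix_def)
  obtain x1 where x1: "x1 \<in> \<Omega>" using \<Omega> by blast
  have bdd1: "bdd_above ((\<lambda>x. norm (H x)) ` closure \<Omega>)"
  proof -
    have "compact (closure \<Omega>)" using \<Omega> by simp
    moreover have "continuous_on (closure \<Omega>) (\<lambda>x. norm (H x))"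
      using H(1) by (auto simp: C1_closure_def intro: continuous_on_norm)
    ultimately show ?thesis by (intro bounded_imp_bdd_above compact_imp_bounded compact_continuous_image)
  qed
  obtain B where B: "\<And>x b. x \<in> \<Omega> \<Longrightarrow> b \<in> Basis \<Longrightarrow> norm (frechet_derivative H (at x) b) \<le> B"
    using C1_closure_frechet_bounded[OF H(1) \<Omega>(1)] by blast
  have bdd2: "bdd_above (fro ` \<Omega>)"
  proof (rule bdd_aboveI2)
    fix x assume x: "x \<in> \<Omega>"
    have "(jacobian H (at x) $ j $ k)\<^sup>2 \<le> B\<^sup>2" for j k
    proof -
      have "\<bar>jacobian H (at x) $ j $ k\<bar> \<le> norm (frechet_derivative H (at x) (axis k 1))"
        unfolding entry by (rule component_le_norm_cart)
      also have "\<dots> \<le> B" using x by (intro B) (simp_all add: axis_in_Basis_iff)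
      finally show ?thesis by (intro abs_le_square_iff[THEN iffD1]) linarith
    qed
    then have "(\<Sum>j\<in>UNIV. \<Sum>k\<in>UNIV. (jacobian H (at x) $ j $ k)\<^sup>2) \<le> (\<Sum>j\<in>(UNIV::'n set). \<Sum>k\<in>(UNIV::'n set). B\<^sup>2)"
      by (intro sum_mono)
    then show "fro x \<le> sqrt (\<Sum>j\<in>(UNIV::'n set). \<Sum>k\<in>(UNIV::'n set). B\<^sup>2)"
      unfolding fro_def by (rule real_sqrt_le_mono)
  qed
  let ?A = "SUP x\<in>closure \<Omega>. norm (H x)" and ?B = "SUP x\<in>\<Omega>. fro x"
  have sum: "?A + ?B \<le> M" using H(2) by (simp add: C1_norm_def fro_def)
  have A: "norm (H x) \<le> ?A" if "x \<in> closure \<Omega>" for x by (rule cSUP_upper[OF that bdd1])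
  have B: "fro x \<le> ?B" if "x \<in> \<Omega>" for x by (rule cSUP_upper[OF that bdd2])
  have "0 \<le> fro x1" by (simp add: fro_def sum_nonneg)
  then have B0: "0 \<le> ?B" using B[OF x1] by linarith
  have "x1 \<in> closure \<Omega>" using x1 closure_subset by blast
  then have A0: "0 \<le> ?A" using A[of x1] norm_ge_zero[of "H x1"] by linarith
  show "norm (H x) \<le> M" if "x \<in> closure \<Omega>" for x
    using A[OF that] B0 sum by linarith
  show "norm (frechet_derivative H (at x) v) \<le> (real CARD('n))\<^sup>2 * M * norm v" if x: "x \<in> \<Omega>" for x v
  proof -
    have "\<bar>jacobian H (at x) $ j $ k\<bar> \<le> M" for j k
    proof -
      have "(jacobian H (at x) $ j $ k)\<^sup>2 \<le> (\<Sum>k\<in>UNIV. (jacobian H (at x) $ j $ k)\<^sup>2)"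
        by (rule member_le_sum[where f="\<lambda>k. (jacobian H (at x) $ j $ k)\<^sup>2"]) auto
      also have "\<dots> \<le> (\<Sum>j\<in>UNIV. \<Sum>k\<in>UNIV. (jacobian H (at x) $ j $ k)\<^sup>2)"
        by (rule member_le_sum[where f="\<lambda>j. \<Sum>k\<in>UNIV. (jacobian H (at x) $ j $ k)\<^sup>2"]) (auto simp: sum_nonneg)
      finally have "sqrt ((jacobian H (at x) $ j $ k)\<^sup>2) \<le> fro x"
        unfolding fro_def by (rule real_sqrt_le_mono)
      then show ?thesis using B[OF x] A0 sum by simp
    qed
    then have on: "onorm ((*v) (jacobian H (at x))) \<le> real CARD('n) * real CARD('n) * M"
      by (rule onorm_le_matrix_component)
    have "H differentiable (at x)" using H(1) x by (simp add: C1_closure_def)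
    then have "(H has_derivative (\<lambda>h. jacobian H (at x) *v h)) (at x)" by (rule jacobian_works[THEN iffD1])
    then have "frechet_derivative H (at x) v = jacobian H (at x) *v v"
      by (metis frechet_derivative_at)
    also have "norm \<dots> \<le> onorm ((*v) (jacobian H (at x))) * norm v"
      by (rule onorm) (rule matrix_vector_mul_bounded_linear)
    also have "\<dots> \<le> (real CARD('n) * real CARD('n) * M) * norm v" using on by (rule mult_right_mono) simp
    finally show ?thesis by (simp add: power2_eq_square)
  qed
qed

lemma ennreal_powr_half_mono:
  assumes "x \<le> ennreal (c\<^sup>2) * y" "0 \<le> c"
  shows "ennreal_powr x (1/2) \<le> ennreal c * ennreal_powr y (1/2)"
proof (cases "y = \<infinity>")
  case True
  show ?thesis
  proof (cases "c = 0")
    case True then show ?thesis using assms by (simp add: ennreal_powr_def)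
  next
    case False
    then show ?thesis using assms \<open>y = \<infinity>\<close> by (simp add: ennreal_powr_def ennreal_mult_top)
  qed
next
  case False
  then obtain r where r: "0 \<le> r" "y = ennreal r" by (cases y) auto
  have "x \<le> ennreal (c\<^sup>2 * r)" using assms r by (simp add: ennreal_mult)
  moreover have "ennreal (c\<^sup>2 * r) < top" by simp
  ultimately obtain s where s: "0 \<le> s" "x = ennreal s" by (cases x) (auto simp: top_unique)
  have "s \<le> c\<^sup>2 * r" using \<open>x \<le> ennreal (c\<^sup>2 * r)\<close> s r by simp
  then have "sqrt s \<le> sqrt (c\<^sup>2 * r)" by (rule real_sqrt_le_mono)
  then have "sqrt s \<le> c * sqrt r" using assms by (simp add: real_sqrt_mult)
  then show ?thesis using r s assms
    by (simp add: ennreal_powr_def powr_half_sqrt ennreal_mult[symmetric])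
qed

section \<open>The integrated estimate\<close>

lemma nn_integral_cylinder_slice:
  fixes f :: "real \<Rightarrow> real"
  assumes "continuous_on {0..T} f" "\<And>s. s \<in> {0..T} \<Longrightarrow> 0 \<le> f s"
  shows "(\<integral>\<^sup>+s. ennreal (f s) \<partial>restrict_space lborel {0<..<T}) = ennreal (integral {0..T} f)"
proof -
  have "(f has_integral integral {0..T} f) {0..T}"
    using assms(1) by (intro integrable_integral integrable_continuous_real)
  then have "(f has_integral integral {0..T} f) {0<..<T}"
    by (simp add: has_integral_Icc_iff_Ioo)
  from nn_integral_has_integral_lebesgue[OF _ this] assms(2)
  have "(\<integral>\<^sup>+s. ennreal (indicator {0<..<T} s * f s) \<partial>lborel) = ennreal (integral {0..T} f)"
    by auto
  moreover have "(\<integral>\<^sup>+s. ennreal (f s) \<partial>restrict_space lborel {0<..<T}) =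
      (\<integral>\<^sup>+s. ennreal (indicator {0<..<T} s * f s) \<partial>lborel)"
    by (subst nn_integral_restrict_space) (auto intro!: nn_integral_cong simp: indicator_def)
  ultimately show ?thesis by simp
qed

text \<open>The pointwise estimate is integrated over the cell. Its right-hand side is a continuous function
  of the exit point and the exit time, so the comparison of volume with surface measure times time applies.\<close>

lemma coefficient_trace_estimate:
  fixes \<Omega> \<Gamma> :: "(real^'n) set"
  assumes "outflow \<Omega> x0 e \<eta> r \<epsilon> G L c M b"
    and bounded: "bounded \<Omega>" and bdry: "\<Gamma> \<in> sets borel" "\<Gamma> \<subseteq> frontier \<Omega>" "frontier \<Omega> \<inter> ball x0 r \<subseteq> \<Gamma>"
    and bT: "b < T" and M: "0 \<le> M"
    and sol1: "transport_solution \<Omega> T H p1 a u1" and sol2: "transport_solution \<Omega> T H p2 a u2"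
    and p1: "p1 \<in> bounded_coefficients \<Omega> M" and p2: "p2 \<in> bounded_coefficients \<Omega> M"
    and dt1: "C1_closure (\<Omega> \<times> {0<..<T}) (dt T u1)" and dt2: "C1_closure (\<Omega> \<times> {0<..<T}) (dt T u2)"
    and a: "C1_closure \<Omega> a" and m: "0 < m" "\<And>x. x \<in> closure \<Omega> \<Longrightarrow> m \<le> \<bar>a x\<bar>"
    and A: "\<And>x. x \<in> \<Omega> \<Longrightarrow> norm (gradient a x) \<le> A"
    and H: "continuous_on \<Omega> H" "\<And>x. x \<in> \<Omega> \<Longrightarrow> norm (H x) \<le> M"
    and GH: "\<And>x. x \<in> boundary_cone.cell \<Omega> x0 e \<eta> r \<epsilon> \<Longrightarrow> G x = H x"
  shows "L2_norm (lebesgue_on (boundary_cone.cell \<Omega> x0 e \<eta> r \<epsilon>)) (\<lambda>x. p1 x - p2 x) \<le>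
    ennreal (sqrt (stability_const T M m A * flux_const CARD('n) M * (1 + T))) *
    lateral_L2_norm \<Gamma> T (\<lambda>z. dt T u1 z - dt T u2 z)"
proof -
  interpret outflow \<Omega> x0 e \<eta> r \<epsilon> G L c M b by fact
  have T: "0 < T" using bT b(1) by simp
  have a0: "\<forall>y\<in>closure \<Omega>. a y \<noteq> 0" using m by force
  interpret separated_exit cell \<Gamma> exit_point exit_time M
  proof
    show "cell \<in> sets borel" using open_cell by simp
    show "emeasure lborel cell < \<infinity>" using bounded_cell by (rule emeasure_bounded_finite)
    show "exit_point x \<in> \<Gamma>" if "x \<in> cell" for x
      using exit_point_frontier[OF that] exit_point_closure[OF that] closure_cell_ball bdry(3) by blast
  qed (use exit_point_measurable exit_time_measurable exit_separation bdry M in auto)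
  let ?S = "closure \<Omega>" and ?B = "stability_const T M m A" and ?f = "flux_const CARD('n) M"
  let ?N = "restrict_space lborel {0<..<T} :: real measure"
  let ?P = "surface_measure \<Gamma> \<Otimes>\<^sub>M ?N"
  interpret N: sigma_finite_measure ?N
    by (intro sigma_finite_measure_restrict_space sigma_finite_lborel) simp
  have S: "compact ?S" "\<Gamma> \<subseteq> ?S" using bounded bdry by (auto simp: frontier_def)
  have B0: "0 \<le> ?B" using m T by (simp add: stability_const_def)
  have f0: "0 < ?f" using M by (rule flux_const_pos)
  define W where "W = (\<lambda>z. dt T u1 z - dt T u2 z)"
  define J where "J y = integral {0..T} (\<lambda>s. (W (y, s))\<^sup>2)" for y
  \<comment> \<open>The right-hand side of the pointwise estimate, as a function on the lateral boundary.\<close>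
  define F where "F z = (W z)\<^sup>2 + J (fst z)" for z
  have cW: "continuous_on (?S \<times> {0..T}) W"
    unfolding W_def by (intro continuous_intros C1_cylinder_continuous[OF T] dt1 dt2)
  have cW2: "continuous_on (?S \<times> {0..T}) (\<lambda>z. (W z)\<^sup>2)" by (intro continuous_intros cW)
  have "continuous_on (?S \<times> cbox 0 T) (\<lambda>(y, s). (W (y, s))\<^sup>2)"
    using cW2 by (simp add: case_prod_beta)
  from integral_continuous_on_param[OF this]
  have cJ: "continuous_on ?S J" unfolding J_def by simp
  have cF: "continuous_on (?S \<times> {0..T}) F"
    unfolding F_def by (intro continuous_intros cW continuous_on_compose2[OF cJ]) auto
  have cWs: "continuous_on {0..T} (\<lambda>s. (W (y, s))\<^sup>2)" if "y \<in> ?S" for y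
    using that by (intro continuous_on_compose2[OF cW2] continuous_intros) auto
  have J0: "0 \<le> J y" if "y \<in> ?S" for y
    unfolding J_def using cWs[OF that] by (intro integral_nonneg integrable_continuous_real) auto
  have slice_J: "ennreal (J y) = (\<integral>\<^sup>+s. ennreal ((W (y, s))\<^sup>2) \<partial>?N)" if "y \<in> ?S" for y
    unfolding J_def using cWs[OF that] by (intro nn_integral_cylinder_slice[symmetric]) auto
  have W_meas: "(\<lambda>z. ennreal ((W z)\<^sup>2)) \<in> borel_measurable ?P"
    by (rule measurable_compose[OF lateral_measurable[OF cW2 S(2)]]) simp
  have F_meas: "(\<lambda>z. ennreal (F z)) \<in> borel_measurable ?P"
    by (rule measurable_compose[OF lateral_measurable[OF cF S(2)]]) simp
  have emN: "emeasure ?N (space ?N) = ennreal T"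
    using T by (simp add: space_restrict_space emeasure_restrict_space)
  have F_int: "(\<integral>\<^sup>+z. ennreal (F z) \<partial>?P) = ennreal (1 + T) * (\<integral>\<^sup>+z. ennreal ((W z)\<^sup>2) \<partial>?P)"
  proof -
    have "(\<integral>\<^sup>+z. ennreal (F z) \<partial>?P) = (\<integral>\<^sup>+y. \<integral>\<^sup>+s. ennreal (F (y, s)) \<partial>?N \<partial>surface_measure \<Gamma>)"
      by (rule N.nn_integral_fst[OF F_meas, symmetric])
    also have "\<dots> = (\<integral>\<^sup>+y. ennreal (1 + T) * (\<integral>\<^sup>+s. ennreal ((W (y, s))\<^sup>2) \<partial>?N) \<partial>surface_measure \<Gamma>)"
    proof (rule nn_integral_cong)
      fix y assume y: "y \<in> space (surface_measure \<Gamma>)"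
      then have yS: "y \<in> ?S" using S by (auto simp: space_surface_measure)
      have meas: "(\<lambda>s. ennreal ((W (y, s))\<^sup>2)) \<in> borel_measurable ?N"
        using measurable_compose[OF measurable_Pair1'[OF y] W_meas] .
      have "(\<integral>\<^sup>+s. ennreal (F (y, s)) \<partial>?N) = (\<integral>\<^sup>+s. ennreal ((W (y, s))\<^sup>2) + ennreal (J y) \<partial>?N)"
        using J0[OF yS] by (simp add: F_def)
      also have "\<dots> = (\<integral>\<^sup>+s. ennreal ((W (y, s))\<^sup>2) \<partial>?N) + ennreal (J y) * ennreal T"
        using meas emN by (subst nn_integral_add) auto
      also have "\<dots> = ennreal (1 + T) * (\<integral>\<^sup>+s. ennreal ((W (y, s))\<^sup>2) \<partial>?N)"
        unfolding slice_J[OF yS] using T by (simp add: distrib_right mult.commute)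
      finally show "(\<integral>\<^sup>+s. ennreal (F (y, s)) \<partial>?N) = ennreal (1 + T) * (\<integral>\<^sup>+s. ennreal ((W (y, s))\<^sup>2) \<partial>?N)" .
    qed
    also have "\<dots> = ennreal (1 + T) * (\<integral>\<^sup>+y. \<integral>\<^sup>+s. ennreal ((W (y, s))\<^sup>2) \<partial>?N \<partial>surface_measure \<Gamma>)"
      by (intro nn_integral_cmult N.borel_measurable_nn_integral_fst W_meas)
    also have "(\<integral>\<^sup>+y. \<integral>\<^sup>+s. ennreal ((W (y, s))\<^sup>2) \<partial>?N \<partial>surface_measure \<Gamma>) = (\<integral>\<^sup>+z. ennreal ((W z)\<^sup>2) \<partial>?P)"
      by (rule N.nn_integral_fst[OF W_meas])
    finally show ?thesis .
  qed
  let ?q1 = "recovered_coefficient T H a u1" and ?q2 = "recovered_coefficient T H a u2"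
  have pointwise: "(?q1 x - ?q2 x)\<^sup>2 \<le> ?B * F (exit_point x, exit_time x)" if x: "x \<in> cell" for x
  proof -
    have "(?q1 (flow x 0) - ?q2 (flow x 0))\<^sup>2 \<le> ?B * ((W (flow x (exit_time x), exit_time x))\<^sup>2 +
        integral {0..T} (\<lambda>s. (W (flow x (exit_time x), s))\<^sup>2))"
      unfolding W_def
    proof (rule coefficient_difference_le[OF open_\<Omega> T M sol1 sol2 p1 p2 dt1 dt2 a m A H])
      show "0 < exit_time x" "exit_time x < T" using exit_time(1,2)[OF x] bT by auto
      show "flow x s \<in> \<Omega>" if "0 \<le> s" "s < exit_time x" for s
        using exit_time(4)[OF x that] cell_subset by blast
      show "flow x (exit_time x) \<in> closure \<Omega>"
        using exit_point_frontier[OF x] by (simp add: exit_point_def frontier_def)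
      show "continuous_on {0..exit_time x} (flow x)" by (rule continuous_on_subset[OF flow(1)]) simp
      show "(flow x has_vector_derivative H (flow x s)) (at s within {0..exit_time x})"
        if "0 \<le> s" "s < exit_time x" for s
        using flow_within[of s "exit_time x" x] that exit_time(2)[OF x] GH[OF exit_time(4)[OF x that]] by auto
    qed
    then show ?thesis by (simp add: flow(2) exit_point_def F_def J_def)
  qed
  have q_ae: "AE x in lebesgue_on cell. p1 x = ?q1 x \<and> p2 x = ?q2 x"
  proof -
    have "AE x in lebesgue_on \<Omega>. p1 x = ?q1 x" "AE x in lebesgue_on \<Omega>. p2 x = ?q2 x"
      using transport_equation_everywhere(1)[OF open_\<Omega> T M sol1 p1 dt1 a a0 H(1)]
        transport_equation_everywhere(1)[OF open_\<Omega> T M sol2 p2 dt2 a a0 H(1)] by auto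
    then have "AE x in lebesgue. x \<in> \<Omega> \<longrightarrow> p1 x = ?q1 x" "AE x in lebesgue. x \<in> \<Omega> \<longrightarrow> p2 x = ?q2 x"
      using open_\<Omega> by (auto simp: AE_restrict_space_iff borel_open)
    then have "AE x in lebesgue. x \<in> cell \<longrightarrow> p1 x = ?q1 x \<and> p2 x = ?q2 x"
      by eventually_elim (use cell_subset in auto)
    then show ?thesis using open_cell by (subst AE_restrict_space_iff) (auto simp: borel_open)
  qed
  have "(\<integral>\<^sup>+x. ennreal ((p1 x - p2 x)\<^sup>2) \<partial>lebesgue_on cell) \<le>
      (\<integral>\<^sup>+x. ennreal ?B * ennreal (F (exit_point x, exit_time x)) \<partial>lebesgue_on cell)"
  proof (rule nn_integral_mono_AE)
    have "AE x in lebesgue_on cell. x \<in> cell"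
      using AE_space[of "lebesgue_on cell"] by simp
    with q_ae show "AE x in lebesgue_on cell. ennreal ((p1 x - p2 x)\<^sup>2) \<le>
        ennreal ?B * ennreal (F (exit_point x, exit_time x))"
    proof eventually_elim
      case (elim x)
      then have "ennreal ((p1 x - p2 x)\<^sup>2) \<le> ennreal (?B * F (exit_point x, exit_time x))"
        using pointwise by (intro ennreal_leI) auto
      then show ?case using B0 by (simp add: ennreal_mult')
    qed
  qed
  also have "\<dots> = (\<integral>\<^sup>+x. ennreal ?B * ennreal (F (exit_point x, exit_time x)) \<partial>restrict_space lborel cell)"
    using open_cell by (simp add: nn_integral_restrict_space nn_integral_completion borel_open)
  also have "\<dots> = ennreal ?B * (\<integral>\<^sup>+x. ennreal (F (exit_point x, exit_time x)) \<partial>restrict_space lborel cell)"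
  proof (rule nn_integral_cmult)
    have "(\<lambda>x. (exit_point x, exit_time x)) \<in> measurable (restrict_space borel cell) (restrict_space borel (?S \<times> {0..T}))"
    proof (rule measurable_restrict_space2)
      show "(\<lambda>x. (exit_point x, exit_time x)) \<in> space (restrict_space borel cell) \<rightarrow> ?S \<times> {0..T}"
        using exit_time(1,2) exit_point_frontier bT
        by (fastforce simp: space_restrict_space frontier_def intro: less_imp_le)
      show "(\<lambda>x. (exit_point x, exit_time x)) \<in> borel_measurable (restrict_space borel cell)"
        by (intro borel_measurable_Pair exit_point_measurable exit_time_measurable)
    qed
    from measurable_compose[OF this borel_measurable_continuous_on_restrict[OF cF]]
    have "(\<lambda>x. F (exit_point x, exit_time x)) \<in> borel_measurable (restrict_space borel cell)" .
    moreover have "sets (restrict_space lborel cell) = sets (restrict_space borel cell)"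
      by (intro sets_restrict_space_cong) simp
    ultimately have "(\<lambda>x. F (exit_point x, exit_time x)) \<in> borel_measurable (restrict_space lborel cell)"
      by (simp cong: measurable_cong_sets)
    then show "(\<lambda>x. ennreal (F (exit_point x, exit_time x))) \<in> borel_measurable (restrict_space lborel cell)"
      by simp
  qed
  also have "\<dots> \<le> ennreal ?B * (ennreal ?f * (\<integral>\<^sup>+z. ennreal (F z) \<partial>?P))"
  proof (rule mult_left_mono)
    show "(\<integral>\<^sup>+x. ennreal (F (exit_point x, exit_time x)) \<partial>restrict_space lborel cell) \<le>
        ennreal ?f * (\<integral>\<^sup>+z. ennreal (F z) \<partial>?P)"
      using exit_time(1,2) by (intro trace_integral_le[OF S cF b(1) bT]) (auto intro: less_imp_le)
  qed simp
  also have "\<dots> = ennreal (?B * ?f * (1 + T)) * (\<integral>\<^sup>+z. ennreal ((W z)\<^sup>2) \<partial>?P)"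
    unfolding F_int using B0 f0 T by (simp add: ennreal_mult mult.assoc)
  also have "?B * ?f * (1 + T) = (sqrt (?B * ?f * (1 + T)))\<^sup>2"
    using B0 f0 T by simp
  finally have "ennreal_powr (\<integral>\<^sup>+x. ennreal ((p1 x - p2 x)\<^sup>2) \<partial>lebesgue_on cell) (1/2) \<le>
      ennreal (sqrt (?B * ?f * (1 + T))) * ennreal_powr (\<integral>\<^sup>+z. ennreal ((W z)\<^sup>2) \<partial>?P) (1/2)"
    using B0 f0 T by (intro ennreal_powr_half_mono) auto
  then show ?thesis unfolding lateral_L2_norm_def L2_norm_def W_def .
qed

section \<open>The stability theorem\<close>

theorem theorem2:
  fixes \<Omega> \<Gamma> :: "(real^'n) set" and x0 :: "real^'n" and T \<delta>0 M :: real
  assumes "is_domain \<Omega>" and "bounded \<Omega>" and "smooth_boundary \<Omega>"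
    and "subboundary \<Omega> \<Gamma>" and "x0 \<in> \<Gamma>"
    and "T > 0" and "\<delta>0 > 0" and "M > 0"
  shows "\<exists>D. is_domain D \<and> D \<subseteq> \<Omega> \<and>
    x0 \<in> frontier D \<inter> frontier \<Omega> \<and> frontier D \<inter> frontier \<Omega> \<subseteq> \<Gamma> \<and>
    (\<forall>a :: real^'n \<Rightarrow> real. C1_closure \<Omega> a \<and> (\<forall>x\<in>closure \<Omega>. \<bar>a x\<bar> \<noteq> 0) \<longrightarrow>
      (\<forall>M0 > 0. \<exists>C > 0. \<exists>\<theta>\<in>{0<..<1}.
        \<forall>H \<in> admissible_fields \<Omega> x0 \<delta>0 M.
        \<forall>p1 \<in> bounded_coefficients \<Omega> M. \<forall>p2 \<in> bounded_coefficients \<Omega> M.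
        \<forall>u1 u2. transport_solution \<Omega> T H p1 a u1 \<and> transport_solution \<Omega> T H p2 a u2 \<and>
          C1_closure (\<Omega> \<times> {0<..<T}) (dt T u1) \<and> C1_closure (\<Omega> \<times> {0<..<T}) (dt T u2) \<and>
          L2_Linf_norm T D (dt T u1) \<le> ennreal M0 \<and>
          L2_Linf_norm T D (dt T u2) \<le> ennreal M0 \<longrightarrow>
          (let d = lateral_L2_norm \<Gamma> T (\<lambda>z. dt T u1 z - dt T u2 z) in
           L2_norm (lebesgue_on D) (\<lambda>x. p1 x - p2 x) \<le>
             ennreal C * (ennreal_powr d \<theta> + d))))"
proof -
  have op: "open \<Omega>" and ne: "\<Omega> \<noteq> {}"
    using assms(1) by (auto simp: is_domain_def)
  obtain O' where O': "open O'" "\<Gamma> = frontier \<Omega> \<inter> O'"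
    using assms(4) by (auto simp: subboundary_def openin_open)
  have x0: "x0 \<in> frontier \<Omega>" "x0 \<in> O'" using assms(5) O' by auto
  define n where "n = real CARD('n)"
  have n: "1 \<le> n" unfolding n_def using zero_less_card_finite[where 'a='n] by linarith
  define e where "e = outward_normal \<Omega> x0"
  have "\<exists>v U \<rho>. defining_function \<Omega> x0 U \<rho> \<and> v = sgn (gradient \<rho> x0)"
    using assms(3) x0(1) unfolding smooth_boundary_def by blast
  then have "\<exists>U \<rho>. defining_function \<Omega> x0 U \<rho> \<and> e = sgn (gradient \<rho> x0)"
    unfolding e_def outward_normal_def by (rule someI_ex)
  then obtain U \<rho> where \<rho>: "defining_function \<Omega> x0 U \<rho>" and e: "e = sgn (gradient \<rho> x0)" by blast
  have norm_e: "norm e = 1" using \<rho> unfolding e by (auto simp: defining_function_def norm_sgn)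
  \<comment> \<open>The aperture: \<open>2 \<eta> M \<le> \<delta>0 / 2\<close> forces every admissible field into the cone near \<open>x0\<close>.\<close>
  define \<eta> where "\<eta> = min (1/4) (\<delta>0 / (4 * M))"
  have eta: "0 < \<eta>" "\<eta> \<le> 1/4" "2 * \<eta> * M \<le> \<delta>0 / 2"
  proof -
    show "0 < \<eta>" "\<eta> \<le> 1/4" using assms by (auto simp: \<eta>_def)
    have "\<eta> * M \<le> \<delta>0 / (4 * M) * M" using assms by (intro mult_right_mono) (auto simp: \<eta>_def)
    then show "2 * \<eta> * M \<le> \<delta>0 / 2" using assms by simp
  qed
  obtain r1 where r1: "0 < r1"
    "\<And>x y. x \<in> closure \<Omega> \<Longrightarrow> x \<in> ball x0 r1 \<Longrightarrow> y \<in> ball x0 r1 \<Longrightarrow> y \<noteq> x \<Longrightarrow>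
       \<eta> * norm (x - y) \<le> (x - y) \<bullet> e \<Longrightarrow> y \<in> \<Omega>"
    using defining_function_cone[OF \<rho> op eta(1), folded e] by blast
  obtain r2 where r2: "0 < r2" "ball x0 r2 \<subseteq> O'" using O' x0 openE by blast
  define r where "r = min r1 r2"
  have r: "0 < r" "r \<le> r1" "r \<le> r2" using r1 r2 by (auto simp: r_def)
  \<comment> \<open>\<open>Bf\<close> bounds the derivative of an admissible field as an operator, \<open>7 Bf\<close> is its Lipschitz constant on the cell,
    and the extension from the cell costs another factor \<open>n\<close>.\<close>
  define Bf where "Bf = n\<^sup>2 * M"
  have Bf: "0 < Bf" using n assms by (simp add: Bf_def)
  define L where "L = n * (7 * Bf)"
  have L: "0 < L" using n Bf by (simp add: L_def)
  define b where "b = min (T / 2) (1 / (2 * L))"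
  have b: "0 < b" "b < T" "L * b \<le> 1/2"
  proof -
    show "0 < b" "b < T" using assms L by (auto simp: b_def)
    have "L * b \<le> L * (1 / (2 * L))" using L by (intro mult_left_mono) (auto simp: b_def)
    then show "L * b \<le> 1/2" using L by simp
  qed
  \<comment> \<open>The ratio \<open>\<epsilon> / \<eta>\<close>, half the radius of a ball around \<open>x0\<close> containing the cell. In turn, the bounds keep the
    cell in the ball of the cone property, keep the field in the cone, and let curves leave before time \<open>b\<close>.\<close>
  define s where "s = min (r / 60) (min (\<delta>0 / (28 * Bf)) (\<delta>0 * b / 16))"
  have s: "0 < s" "30 * s < r" "14 * Bf * s \<le> \<delta>0 / 2" "4 * s < \<delta>0 / 2 * b"
  proof -
    show "0 < s" using r Bf b assms by (auto simp: s_def)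
    have "s \<le> r / 60" "s \<le> \<delta>0 / (28 * Bf)" "s \<le> \<delta>0 * b / 16" by (auto simp: s_def)
    then show "30 * s < r" using r by linarith
    have "0 < \<delta>0 * b" using assms b by simp
    then show "4 * s < \<delta>0 / 2 * b" using \<open>s \<le> \<delta>0 * b / 16\<close> by simp
    have "14 * Bf * s \<le> 14 * Bf * (\<delta>0 / (28 * Bf))"
      using Bf \<open>s \<le> \<delta>0 / (28 * Bf)\<close> by (intro mult_left_mono) auto
    then show "14 * Bf * s \<le> \<delta>0 / 2" using Bf by simp
  qed
  define \<epsilon> where "\<epsilon> = \<eta> * s"
  have eps: "0 < \<epsilon>" "30 * \<epsilon> < \<eta> * r" "\<epsilon> / \<eta> = s"
    using eta s by (auto simp: \<epsilon>_def mult.left_commute)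
  interpret boundary_cone \<Omega> x0 e \<eta> r \<epsilon>
  proof
    fix x y assume "x \<in> closure \<Omega>" "x \<in> ball x0 r" "y \<in> ball x0 r" "y \<noteq> x"
      "\<eta> * norm (x - y) \<le> (x - y) \<bullet> e"
    then show "y \<in> \<Omega>" using r by (intro r1(2)[of x y]) auto
  qed (use op x0 norm_e eta eps in auto)
  have near_\<Gamma>: "frontier \<Omega> \<inter> ball x0 r \<subseteq> \<Gamma>" using O' r2 r by auto
  have \<Gamma>_borel: "\<Gamma> \<in> sets borel"
    unfolding O'(2) using O'(1) by (intro sets.Int borel_open borel_closed) auto
  \<comment> \<open>Every admissible field, extended from the cell, satisfies the hypotheses with the same constants.\<close>
  have field: "\<exists>G. (\<forall>x\<in>cell. G x = H x) \<and> outflow \<Omega> x0 e \<eta> r \<epsilon> G L (\<delta>0 / 2) M b"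
    and field_bounds: "continuous_on \<Omega> H" "\<And>x. x \<in> \<Omega> \<Longrightarrow> norm (H x) \<le> M"
    if H: "H \<in> admissible_fields \<Omega> x0 \<delta>0 M" for H
  proof -
    have H1: "C1_closure \<Omega> H" "C1_norm \<Omega> H \<le> M" "\<delta>0 < H x0 \<bullet> e"
      using H by (auto simp: admissible_fields_def e_def)
    have cH: "continuous_on (closure \<Omega>) H" using H1(1) by (simp add: C1_closure_def)
    show "continuous_on \<Omega> H" by (rule continuous_on_subset[OF cH closure_subset])
    note bnd = admissible_field_bounds[OF H1(1,2) assms(2) ne]
    show normH: "norm (H x) \<le> M" if "x \<in> \<Omega>" for x using bnd(1) that closure_subset by blast
    have lipH: "(7 * Bf)-lipschitz_on cell H"
    proof (rule cell_lipschitz)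
      show "H differentiable at x" if "x \<in> \<Omega>" for x using H1(1) that by (simp add: C1_closure_def)
      show "norm (frechet_derivative H (at x) v) \<le> Bf * norm v" if "x \<in> \<Omega>" for x v
        using bnd(2)[OF that] by (simp add: Bf_def n_def)
    qed (use Bf in simp)
    obtain G where G: "\<And>x. x \<in> cell \<Longrightarrow> G x = H x" "L-lipschitz_on UNIV G"
      using lipschitz_extension_cart[OF lipH] unfolding L_def n_def by blast
    have lip_cl: "(7 * Bf)-lipschitz_on (closure cell) H"
      by (rule lipschitz_on_closure[OF lipH continuous_on_subset[OF cH closure_mono[OF cell_subset]]])
    have "outflow \<Omega> x0 e \<eta> r \<epsilon> G L (\<delta>0 / 2) M b"
    proof unfold_locales
      show "norm (G x) \<le> M" if "x \<in> cell" for x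
        using G(1)[OF that] normH cell_subset that by auto
      show "\<delta>0 / 2 \<le> G x \<bullet> e" if x: "x \<in> cell" for x
      proof -
        have "x0 \<in> closure cell" "x \<in> closure cell"
          using x0_frontier_cell x closure_subset by (auto simp: frontier_def)
        then have "norm (H x0 - H x) \<le> 7 * Bf * norm (x - x0)"
          using lipschitz_onD[OF lip_cl, of x0 x] by (simp add: dist_norm norm_minus_commute)
        also have "\<dots> \<le> 7 * Bf * (2 * s)" using cell_near[OF x] eps(3) Bf by (intro mult_left_mono) auto
        also have "\<dots> \<le> \<delta>0 / 2" using s(3) by simp
        finally have "(H x0 - H x) \<bullet> e \<le> \<delta>0 / 2"
          using norm_cauchy_schwarz[of "H x0 - H x" e] norm_e by simp
        then show ?thesis using H1(3) G(1)[OF x] by (simp add: inner_diff_left)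
      qed
    qed (use G b eta eps s assms in auto)
    then show "\<exists>G. (\<forall>x\<in>cell. G x = H x) \<and> outflow \<Omega> x0 e \<eta> r \<epsilon> G L (\<delta>0 / 2) M b"
      using G(1) by blast
  qed
  show ?thesis
  proof (intro exI[of _ cell] conjI allI impI)
    show "is_domain cell" by (rule is_domain_cell)
    show "cell \<subseteq> \<Omega>" by (rule cell_subset)
    show "x0 \<in> frontier cell \<inter> frontier \<Omega>" using x0_frontier_cell x0 by simp
    show "frontier cell \<inter> frontier \<Omega> \<subseteq> \<Gamma>"
      using closure_cell_ball near_\<Gamma> by (auto simp: frontier_def)
    fix a :: "real^'n \<Rightarrow> real" and M0 :: real
    assume "C1_closure \<Omega> a \<and> (\<forall>x\<in>closure \<Omega>. \<bar>a x\<bar> \<noteq> 0)" "0 < M0"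
    then have a: "C1_closure \<Omega> a" "\<And>x. x \<in> closure \<Omega> \<Longrightarrow> \<bar>a x\<bar> \<noteq> 0" by auto
    have "continuous_on (closure \<Omega>) (\<lambda>x. \<bar>a x\<bar>)"
      using a(1) by (auto simp: C1_closure_def intro!: continuous_intros)
    moreover have "compact (closure \<Omega>)" "closure \<Omega> \<noteq> {}" using assms(2) ne by auto
    ultimately obtain y where y: "y \<in> closure \<Omega>" "\<And>x. x \<in> closure \<Omega> \<Longrightarrow> \<bar>a y\<bar> \<le> \<bar>a x\<bar>"
      using continuous_attains_inf[of "closure \<Omega>" "\<lambda>x. \<bar>a x\<bar>"] by blast
    define m where "m = \<bar>a y\<bar>"
    have m: "0 < m" "\<And>x. x \<in> closure \<Omega> \<Longrightarrow> m \<le> \<bar>a x\<bar>" using y a(2)[of y] by (auto simp: m_def)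
    obtain A1 where A1: "\<And>x b. x \<in> \<Omega> \<Longrightarrow> b \<in> Basis \<Longrightarrow> norm (frechet_derivative a (at x) b) \<le> A1"
      using C1_closure_frechet_bounded[OF a(1) assms(2)] by blast
    define A where "A = (\<Sum>b\<in>(Basis :: (real^'n) set). A1)"
    have A: "norm (gradient a x) \<le> A" if "x \<in> \<Omega>" for x
      unfolding gradient_def A_def using A1[OF that] by (intro sum_norm_le) auto
    define C where "C = 1 + sqrt (stability_const T M m A * flux_const CARD('n) M * (1 + T))"
    have C: "sqrt (stability_const T M m A * flux_const CARD('n) M * (1 + T)) \<le> C" "0 < C"
    proof -
      have "0 \<le> stability_const T M m A" using assms by (simp add: stability_const_def)
      then have "0 \<le> stability_const T M m A * flux_const CARD('n) M * (1 + T)"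
        using flux_const_pos[of M "CARD('n)"] assms by simp
      then show "0 < C" unfolding C_def by (intro add_pos_nonneg real_sqrt_ge_zero) auto
    qed (simp add: C_def)
    show "\<exists>C>0. \<exists>\<theta>\<in>{0<..<1}.
        \<forall>H \<in> admissible_fields \<Omega> x0 \<delta>0 M.
        \<forall>p1 \<in> bounded_coefficients \<Omega> M. \<forall>p2 \<in> bounded_coefficients \<Omega> M.
        \<forall>u1 u2. transport_solution \<Omega> T H p1 a u1 \<and> transport_solution \<Omega> T H p2 a u2 \<and>
          C1_closure (\<Omega> \<times> {0<..<T}) (dt T u1) \<and> C1_closure (\<Omega> \<times> {0<..<T}) (dt T u2) \<and>
          L2_Linf_norm T cell (dt T u1) \<le> ennreal M0 \<and>
          L2_Linf_norm T cell (dt T u2) \<le> ennreal M0 \<longrightarrow>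
          (let d = lateral_L2_norm \<Gamma> T (\<lambda>z. dt T u1 z - dt T u2 z) in
           L2_norm (lebesgue_on cell) (\<lambda>x. p1 x - p2 x) \<le>
             ennreal C * (ennreal_powr d \<theta> + d))"
    \<comment> \<open>The estimate is linear in the lateral norm, which is one of the two summands on the right.\<close>
    proof (intro exI[of _ C] conjI bexI[of _ "1/2"] ballI allI impI, unfold Let_def)
      show "0 < C" by (rule C(2))
      fix H p1 p2 u1 u2
      assume H: "H \<in> admissible_fields \<Omega> x0 \<delta>0 M"
        and p: "p1 \<in> bounded_coefficients \<Omega> M" "p2 \<in> bounded_coefficients \<Omega> M"
        and sol: "transport_solution \<Omega> T H p1 a u1 \<and> transport_solution \<Omega> T H p2 a u2 \<and>
          C1_closure (\<Omega> \<times> {0<..<T}) (dt T u1) \<and> C1_closure (\<Omega> \<times> {0<..<T}) (dt T u2) \<and>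
          L2_Linf_norm T cell (dt T u1) \<le> ennreal M0 \<and> L2_Linf_norm T cell (dt T u2) \<le> ennreal M0"
      let ?d = "lateral_L2_norm \<Gamma> T (\<lambda>z. dt T u1 z - dt T u2 z)"
      obtain G where G: "\<forall>x\<in>cell. G x = H x" "outflow \<Omega> x0 e \<eta> r \<epsilon> G L (\<delta>0 / 2) M b"
        using field[OF H] by blast
      have "L2_norm (lebesgue_on cell) (\<lambda>x. p1 x - p2 x) \<le>
          ennreal (sqrt (stability_const T M m A * flux_const CARD('n) M * (1 + T))) * ?d"
        by (rule coefficient_trace_estimate[OF G(2) assms(2) \<Gamma>_borel _ near_\<Gamma> b(2) _ _ _ p _ _ a(1) m A
              field_bounds[OF H]])
          (use sol O' assms G(1) in auto)
      also have "\<dots> \<le> ennreal C * (ennreal_powr ?d (1/2) + ?d)"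
        using C by (intro mult_mono ennreal_leI) (auto simp: add_increasing)
      finally show "L2_norm (lebesgue_on cell) (\<lambda>x. p1 x - p2 x) \<le>
          ennreal C * (ennreal_powr ?d (1/2) + ?d)" .
    qed simp
  qed
qed

end
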